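(* Let $(M,g_t,H_t,\phi_t)$ be a solution to generalized Ricci flow (with $\phi_t$ a solution of the associated dilaton flow), and suppose $u=e^{-f}$ is a solution of $\square^*_\phi u=0$. Then $$\square^*_\phi\bigl(R^{H,f+\phi}\,u\bigr)=-2\,\bigl|\mathrm{Rc}^{H,f+\phi}\bigr|^2u .$$
   Context: Conventions: inner products and norms of tensors and forms are full tensor contractions, e.g. $|H|^2=H_{ijk}H^{ijk}$. $\mathrm{Rc}$ and $R$ are the Ricci tensor and scalar curvature of $g$; $\Delta=\mathrm{tr}_g\nabla^2$; $d^*_g$ is the codifferential, $(d^*_gH)_{jk}=-\nabla^iH_{ijk}$; $H^2(X,Y)=\langle i_XH,i_YH\rangle$; $\square=\frac{\partial}{\partial t}-\Delta$. Generalized Ricci flow: a one-parameter family of Riemannian metrics $g_t$ and closed three-forms $H_t=H_0+db_t$ with $\frac{\partial}{\partial t}g=-2\mathrm{Rc}+\frac12H^2$, $\frac{\partial}{\partial t}b=-d^*_gH$. Dilaton flow: smooth functions $\phi_t$ with $\square\phi=\frac16|H|^2$. A triple $(g_t,H_t,\phi_t)$ is called a solution of generalized Ricci flow if both hold. For a function $F$: $$\mathrm{Rc}^{H,F}=\mathrm{Rc}-\tfrac14H^2+\nabla^2F-\tfrac12\bigl(d^*_gH+i_{\nabla F}H\bigr),\qquad R^{H,F}=R-\tfrac1{12}|H|^2+2\Delta F-|\nabla F|^2 .$$ Weighted conjugate heat operator: $\square^*_\phi=-\frac{\partial}{\partial t}-\Delta+2\nabla\phi+R^{H,\phi}$, i.e.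 $\square^*_\phi u=-\frac{\partial u}{\partial t}-\Delta u+2\langle\nabla\phi,\nabla u\rangle+R^{H,\phi}u$. *)

theory Defs
  imports "HOL-Analysis.Analysis"
begin

section \<open>Smooth maps\<close>

text \<open>
  The derivatives are taken within \<open>S\<close>, so that the notion also covers the sets
  \<open>I \<times> V\<close> with \<open>I\<close> a nondegenerate interval (possibly containing endpoints) and \<open>V\<close> open;
  derivatives within such a set, as well as within an open set, are unique.
\<close>

primrec Ck_on :: "nat \<Rightarrow> 'a::real_normed_vector set \<Rightarrow> ('a \<Rightarrow> 'b::real_normed_vector) \<Rightarrow> bool" where
  "Ck_on 0 S f \<longleftrightarrow> continuous_on S f"
| "Ck_on (Suc k) S f \<longleftrightarrow>
     (\<forall>x\<in>S. f differentiable (at x within S)) \<and>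
     (\<forall>v. Ck_on k S (\<lambda>x. frechet_derivative f (at x within S) v))"

definition smooth_on :: "'a::real_normed_vector set \<Rightarrow> ('a \<Rightarrow> 'b::real_normed_vector) \<Rightarrow> bool" where
  "smooth_on S f \<longleftrightarrow> (\<forall>k. Ck_on k S f)"


section \<open>Smooth manifolds\<close>

text \<open>
  A chart is a pair of its domain and its coordinate map; values of the coordinate map
  outside the domain are irrelevant. A manifold is an open subset \<open>M\<close> of a Hausdorff second
  countable space with an atlas \<open>A\<close>, which need not be maximal.
\<close>

type_synonym ('m, 'n) chart = "'m set \<times> ('m \<Rightarrow> real ^ 'n)"

abbreviation chart_dom :: "('m, 'n::finite) chart \<Rightarrow> 'm set" where
  "chart_dom c \<equiv> fst c"

abbreviation coord :: "('m, 'n::finite) chart \<Rightarrow> 'm \<Rightarrow> real ^ 'n" where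
  "coord c \<equiv> snd c"

definition para :: "('m, 'n::finite) chart \<Rightarrow> real ^ 'n \<Rightarrow> 'm" where
  "para c = inv_into (chart_dom c) (coord c)"

definition is_chart :: "('m::topological_space, 'n::finite) chart \<Rightarrow> bool" where
  "is_chart c \<longleftrightarrow> open (chart_dom c) \<and> open (coord c ` chart_dom c) \<and>
     homeomorphism (chart_dom c) (coord c ` chart_dom c) (coord c) (para c)"

definition smooth_manifold ::
  "'m::{t2_space, second_countable_topology} set \<Rightarrow> ('m, 'n::finite) chart set \<Rightarrow> bool" where
  "smooth_manifold M A \<longleftrightarrow>
     (\<forall>c\<in>A. is_chart c) \<and> (\<Union>c\<in>A. chart_dom c) = M \<and>
     (\<forall>c\<in>A. \<forall>c'\<in>A. smooth_on (coord c ` (chart_dom c \<inter> chart_dom c')) (coord c' \<circ> para c))"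

text \<open>The coordinate vector field \<open>\<partial>/\<partial>x\<^sup>i\<close> of the chart \<open>c\<close>, applied to \<open>h\<close> at \<open>p\<close>.\<close>

definition pd :: "('m, 'n::finite) chart \<Rightarrow> 'n \<Rightarrow> ('m \<Rightarrow> real) \<Rightarrow> 'm \<Rightarrow> real" where
  "pd c i h p = frechet_derivative (\<lambda>y. h (para c y)) (at (coord c p)) (axis i 1)"


section \<open>Tensor fields\<close>

text \<open>
  A covariant tensor field is given by its components \<open>T c p i j \<dots>\<close> in every chart \<open>c\<close> of the
  atlas at every point \<open>p\<close> of the domain of \<open>c\<close>, subject to the tensorial transformation law;
  other arguments are junk. Scalars computed from tensors are first computed from components
  in a chart, so they too carry a chart argument, on whose choice the value does not depend.
\<close>

type_synonym ('m, 'n) tensor0 = "('m, 'n) chart \<Rightarrow> 'm \<Rightarrow> real"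
type_synonym ('m, 'n) tensor1 = "('m, 'n) chart \<Rightarrow> 'm \<Rightarrow> 'n \<Rightarrow> real"
type_synonym ('m, 'n) tensor2 = "('m, 'n) chart \<Rightarrow> 'm \<Rightarrow> 'n \<Rightarrow> 'n \<Rightarrow> real"
type_synonym ('m, 'n) tensor3 = "('m, 'n) chart \<Rightarrow> 'm \<Rightarrow> 'n \<Rightarrow> 'n \<Rightarrow> 'n \<Rightarrow> real"

text \<open>\<open>jacobian c c' p a i\<close> is \<open>\<partial>x\<^sup>a/\<partial>x'\<^sup>i\<close>, for the coordinates \<open>x\<close> of \<open>c\<close> and \<open>x'\<close> of \<open>c'\<close>.\<close>

definition jacobian ::
  "('m, 'n::finite) chart \<Rightarrow> ('m, 'n) chart \<Rightarrow> 'm \<Rightarrow> 'n \<Rightarrow> 'n \<Rightarrow> real" where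
  "jacobian c c' p a i = pd c' i (\<lambda>q. coord c q $ a) p"

definition tensorial2 :: "('m, 'n::finite) chart set \<Rightarrow> ('m, 'n) tensor2 \<Rightarrow> bool" where
  "tensorial2 A T \<longleftrightarrow>
     (\<forall>c\<in>A. \<forall>c'\<in>A. \<forall>p \<in> chart_dom c \<inter> chart_dom c'. \<forall>i j.
        T c' p i j = (\<Sum>a\<in>UNIV. \<Sum>b\<in>UNIV. jacobian c c' p a i * jacobian c c' p b j * T c p a b))"

definition tensorial3 :: "('m, 'n::finite) chart set \<Rightarrow> ('m, 'n) tensor3 \<Rightarrow> bool" where
  "tensorial3 A T \<longleftrightarrow>
     (\<forall>c\<in>A. \<forall>c'\<in>A. \<forall>p \<in> chart_dom c \<inter> chart_dom c'. \<forall>i j k.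
        T c' p i j k = (\<Sum>a\<in>UNIV. \<Sum>b\<in>UNIV. \<Sum>d\<in>UNIV.
          jacobian c c' p a i * jacobian c c' p b j * jacobian c c' p d k * T c p a b d))"

definition smooth_function_family ::
  "real set \<Rightarrow> ('m, 'n::finite) chart set \<Rightarrow> (real \<Rightarrow> 'm \<Rightarrow> real) \<Rightarrow> bool" where
  "smooth_function_family I A h \<longleftrightarrow>
     (\<forall>c\<in>A. smooth_on (I \<times> coord c ` chart_dom c) (\<lambda>(t, y). h t (para c y)))"

definition metric_family ::
  "real set \<Rightarrow> ('m, 'n::finite) chart set \<Rightarrow> (real \<Rightarrow> ('m, 'n) tensor2) \<Rightarrow> bool" where
  "metric_family I A g \<longleftrightarrow>
     (\<forall>t\<in>I. tensorial2 A (g t) \<and>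
        (\<forall>c\<in>A. \<forall>p\<in>chart_dom c.
           (\<forall>i j. g t c p i j = g t c p j i) \<and>
           (\<forall>v :: real ^ 'n. v \<noteq> 0 \<longrightarrow> (\<Sum>i\<in>UNIV. \<Sum>j\<in>UNIV. g t c p i j * v $ i * v $ j) > 0))) \<and>
     (\<forall>c\<in>A. \<forall>i j. smooth_on (I \<times> coord c ` chart_dom c) (\<lambda>(t, y). g t c (para c y) i j))"

definition two_form_family ::
  "real set \<Rightarrow> ('m, 'n::finite) chart set \<Rightarrow> (real \<Rightarrow> ('m, 'n) tensor2) \<Rightarrow> bool" where
  "two_form_family I A b \<longleftrightarrow>
     (\<forall>t\<in>I. tensorial2 A (b t) \<and>
        (\<forall>c\<in>A. \<forall>p\<in>chart_dom c. \<forall>i j. b t c p i j = - b t c p j i)) \<and>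
     (\<forall>c\<in>A. \<forall>i j. smooth_on (I \<times> coord c ` chart_dom c) (\<lambda>(t, y). b t c (para c y) i j))"

definition three_form :: "('m, 'n::finite) chart set \<Rightarrow> ('m, 'n) tensor3 \<Rightarrow> bool" where
  "three_form A H \<longleftrightarrow>
     tensorial3 A H \<and>
     (\<forall>c\<in>A. \<forall>p\<in>chart_dom c. \<forall>i j k. H c p i j k = - H c p j i k \<and> H c p i j k = - H c p i k j) \<and>
     (\<forall>c\<in>A. \<forall>i j k. smooth_on (coord c ` chart_dom c) (\<lambda>y. H c (para c y) i j k))"

definition ext_d2 :: "('m, 'n::finite) tensor2 \<Rightarrow> ('m, 'n) tensor3" where
  "ext_d2 b c p i j k =
     pd c i (\<lambda>q. b c q j k) p + pd c j (\<lambda>q. b c q k i) p + pd c k (\<lambda>q. b c q i j) p"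

definition closed3 :: "('m, 'n::finite) chart set \<Rightarrow> ('m, 'n) tensor3 \<Rightarrow> bool" where
  "closed3 A H \<longleftrightarrow>
     (\<forall>c\<in>A. \<forall>p\<in>chart_dom c. \<forall>i j k l.
        pd c i (\<lambda>q. H c q j k l) p - pd c j (\<lambda>q. H c q i k l) p +
        pd c k (\<lambda>q. H c q i j l) p - pd c l (\<lambda>q. H c q i j k) p = 0)"


section \<open>Riemannian geometry in coordinates\<close>

definition ginv :: "('m, 'n::finite) tensor2 \<Rightarrow> ('m, 'n) chart \<Rightarrow> 'm \<Rightarrow> 'n \<Rightarrow> 'n \<Rightarrow> real" where
  "ginv g c p i j = matrix_inv (\<chi> a b. g c p a b) $ i $ j"

text \<open>\<open>christoffel g c p k i j\<close> is \<open>\<Gamma>\<^sup>k\<^sub>i\<^sub>j\<close>.\<close>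

definition christoffel ::
  "('m, 'n::finite) tensor2 \<Rightarrow> ('m, 'n) chart \<Rightarrow> 'm \<Rightarrow> 'n \<Rightarrow> 'n \<Rightarrow> 'n \<Rightarrow> real" where
  "christoffel g c p k i j =
     (1/2) * (\<Sum>l\<in>UNIV. ginv g c p k l *
       (pd c i (\<lambda>q. g c q j l) p + pd c j (\<lambda>q. g c q i l) p - pd c l (\<lambda>q. g c q i j) p))"

text \<open>
  \<open>riemann g c p l i j k\<close> is the component along \<open>\<partial>\<^sub>l\<close> of
  \<open>(\<nabla>\<^sub>i\<nabla>\<^sub>j - \<nabla>\<^sub>j\<nabla>\<^sub>i)\<partial>\<^sub>k\<close>. The Ricci tensor is the trace over \<open>l\<close> and \<open>i\<close>, so that round
  spheres have positive Ricci curvature.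
\<close>

definition riemann ::
  "('m, 'n::finite) tensor2 \<Rightarrow> ('m, 'n) chart \<Rightarrow> 'm \<Rightarrow> 'n \<Rightarrow> 'n \<Rightarrow> 'n \<Rightarrow> 'n \<Rightarrow> real" where
  "riemann g c p l i j k =
     pd c i (\<lambda>q. christoffel g c q l j k) p - pd c j (\<lambda>q. christoffel g c q l i k) p +
     (\<Sum>m\<in>UNIV. christoffel g c p l i m * christoffel g c p m j k
               - christoffel g c p l j m * christoffel g c p m i k)"

definition ricci :: "('m, 'n::finite) tensor2 \<Rightarrow> ('m, 'n) tensor2" where
  "ricci g c p j k = (\<Sum>i\<in>UNIV. riemann g c p i i j k)"

definition trace_g :: "('m, 'n::finite) tensor2 \<Rightarrow> ('m, 'n) tensor2 \<Rightarrow> ('m, 'n) tensor0" where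
  "trace_g g T c p = (\<Sum>i\<in>UNIV. \<Sum>j\<in>UNIV. ginv g c p i j * T c p i j)"

definition scalar_curv :: "('m, 'n::finite) tensor2 \<Rightarrow> ('m, 'n) tensor0" where
  "scalar_curv g = trace_g g (ricci g)"

text \<open>Full tensor contractions of the components of two tensors at a point.\<close>

definition inner1 ::
  "('m, 'n::finite) tensor2 \<Rightarrow> ('m, 'n) chart \<Rightarrow> 'm \<Rightarrow> ('n \<Rightarrow> real) \<Rightarrow> ('n \<Rightarrow> real) \<Rightarrow> real" where
  "inner1 g c p S T = (\<Sum>i\<in>UNIV. \<Sum>i'\<in>UNIV. ginv g c p i i' * S i * T i')"

definition inner2 ::
  "('m, 'n::finite) tensor2 \<Rightarrow> ('m, 'n) chart \<Rightarrow> 'm \<Rightarrow>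
   ('n \<Rightarrow> 'n \<Rightarrow> real) \<Rightarrow> ('n \<Rightarrow> 'n \<Rightarrow> real) \<Rightarrow> real" where
  "inner2 g c p S T =
     (\<Sum>i\<in>UNIV. \<Sum>i'\<in>UNIV. \<Sum>j\<in>UNIV. \<Sum>j'\<in>UNIV.
        ginv g c p i i' * ginv g c p j j' * S i j * T i' j')"

definition inner3 ::
  "('m, 'n::finite) tensor2 \<Rightarrow> ('m, 'n) chart \<Rightarrow> 'm \<Rightarrow>
   ('n \<Rightarrow> 'n \<Rightarrow> 'n \<Rightarrow> real) \<Rightarrow> ('n \<Rightarrow> 'n \<Rightarrow> 'n \<Rightarrow> real) \<Rightarrow> real" where
  "inner3 g c p S T =
     (\<Sum>i\<in>UNIV. \<Sum>i'\<in>UNIV. \<Sum>j\<in>UNIV. \<Sum>j'\<in>UNIV. \<Sum>k\<in>UNIV. \<Sum>k'\<in>UNIV.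
        ginv g c p i i' * ginv g c p j j' * ginv g c p k k' * S i j k * T i' j' k')"

definition differential :: "('m \<Rightarrow> real) \<Rightarrow> ('m, 'n::finite) tensor1" where
  "differential F c p i = pd c i F p"

definition grad ::
  "('m, 'n::finite) tensor2 \<Rightarrow> ('m \<Rightarrow> real) \<Rightarrow> ('m, 'n) chart \<Rightarrow> 'm \<Rightarrow> 'n \<Rightarrow> real" where
  "grad g F c p i = (\<Sum>j\<in>UNIV. ginv g c p i j * differential F c p j)"

definition cov1 :: "('m, 'n::finite) tensor2 \<Rightarrow> ('m, 'n) tensor1 \<Rightarrow> ('m, 'n) tensor2" where
  "cov1 g \<alpha> c p i j =
     pd c i (\<lambda>q. \<alpha> c q j) p - (\<Sum>m\<in>UNIV. christoffel g c p m i j * \<alpha> c p m)"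

text \<open>\<open>cov3 g H c p l i j k\<close> is \<open>\<nabla>\<^sub>l H\<^sub>i\<^sub>j\<^sub>k\<close>.\<close>

definition cov3 ::
  "('m, 'n::finite) tensor2 \<Rightarrow> ('m, 'n) tensor3 \<Rightarrow>
   ('m, 'n) chart \<Rightarrow> 'm \<Rightarrow> 'n \<Rightarrow> 'n \<Rightarrow> 'n \<Rightarrow> 'n \<Rightarrow> real" where
  "cov3 g H c p l i j k =
     pd c l (\<lambda>q. H c q i j k) p -
     (\<Sum>m\<in>UNIV. christoffel g c p m l i * H c p m j k
               + christoffel g c p m l j * H c p i m k
               + christoffel g c p m l k * H c p i j m)"

definition hess :: "('m, 'n::finite) tensor2 \<Rightarrow> ('m \<Rightarrow> real) \<Rightarrow> ('m, 'n) tensor2" where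
  "hess g F = cov1 g (differential F)"

definition laplacian :: "('m, 'n::finite) tensor2 \<Rightarrow> ('m \<Rightarrow> real) \<Rightarrow> ('m, 'n) tensor0" where
  "laplacian g F = trace_g g (hess g F)"

definition codiff3 :: "('m, 'n::finite) tensor2 \<Rightarrow> ('m, 'n) tensor3 \<Rightarrow> ('m, 'n) tensor2" where
  "codiff3 g H c p j k = - (\<Sum>i\<in>UNIV. \<Sum>l\<in>UNIV. ginv g c p i l * cov3 g H c p l i j k)"

definition Hsq :: "('m, 'n::finite) tensor2 \<Rightarrow> ('m, 'n) tensor3 \<Rightarrow> ('m, 'n) tensor2" where
  "Hsq g H c p i j = inner2 g c p (H c p i) (H c p j)"

definition i_grad ::
  "('m, 'n::finite) tensor2 \<Rightarrow> ('m \<Rightarrow> real) \<Rightarrow> ('m, 'n) tensor3 \<Rightarrow> ('m, 'n) tensor2" where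
  "i_grad g F H c p j k = (\<Sum>i\<in>UNIV. grad g F c p i * H c p i j k)"


section \<open>Generalized Ricci flow\<close>

definition Rc_gen ::
  "('m, 'n::finite) tensor2 \<Rightarrow> ('m, 'n) tensor3 \<Rightarrow> ('m \<Rightarrow> real) \<Rightarrow> ('m, 'n) tensor2" where
  "Rc_gen g H F c p i j =
     ricci g c p i j - (1/4) * Hsq g H c p i j + hess g F c p i j
     - (1/2) * (codiff3 g H c p i j + i_grad g F H c p i j)"

definition R_gen ::
  "('m, 'n::finite) tensor2 \<Rightarrow> ('m, 'n) tensor3 \<Rightarrow> ('m \<Rightarrow> real) \<Rightarrow> ('m, 'n) tensor0" where
  "R_gen g H F c p =
     scalar_curv g c p - (1/12) * inner3 g c p (H c p) (H c p)
     + 2 * laplacian g F c p - inner1 g c p (differential F c p) (differential F c p)"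

text \<open>Time derivatives are one-sided at the endpoints belonging to \<open>I\<close>.\<close>

definition heat_op ::
  "real set \<Rightarrow> (real \<Rightarrow> ('m, 'n::finite) tensor2) \<Rightarrow> (real \<Rightarrow> 'm \<Rightarrow> real) \<Rightarrow>
   real \<Rightarrow> ('m, 'n) tensor0" where
  "heat_op I g h t c p =
     vector_derivative (\<lambda>s. h s p) (at t within I) - laplacian (g t) (h t) c p"

definition conj_heat_op ::
  "real set \<Rightarrow> (real \<Rightarrow> ('m, 'n::finite) tensor2) \<Rightarrow> (real \<Rightarrow> ('m, 'n) tensor3) \<Rightarrow>
   (real \<Rightarrow> 'm \<Rightarrow> real) \<Rightarrow> (real \<Rightarrow> 'm \<Rightarrow> real) \<Rightarrow> real \<Rightarrow> ('m, 'n) tensor0" where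
  "conj_heat_op I g H \<phi> u t c p =
     - vector_derivative (\<lambda>s. u s p) (at t within I) - laplacian (g t) (u t) c p
     + 2 * inner1 (g t) c p (differential (\<phi> t) c p) (differential (u t) c p)
     + R_gen (g t) (H t) (\<phi> t) c p * u t p"

text \<open>
  The background form \<open>H0\<close> is not required to be the value of \<open>H\<close> at a specific time;
  that case is included.
\<close>

definition generalized_Ricci_flow ::
  "real set \<Rightarrow> ('m, 'n::finite) chart set \<Rightarrow> (real \<Rightarrow> ('m, 'n) tensor2) \<Rightarrow>
   (real \<Rightarrow> ('m, 'n) tensor3) \<Rightarrow> (real \<Rightarrow> 'm \<Rightarrow> real) \<Rightarrow> bool" where
  "generalized_Ricci_flow I A g H \<phi> \<longleftrightarrow>
     metric_family I A g \<and>
     (\<exists>H0 b. three_form A H0 \<and> closed3 A H0 \<and> two_form_family I A b \<and>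
        (\<forall>t\<in>I. \<forall>c\<in>A. \<forall>p\<in>chart_dom c.
           (\<forall>i j k. H t c p i j k = H0 c p i j k + ext_d2 (b t) c p i j k) \<and>
           (\<forall>i j. vector_derivative (\<lambda>s. b s c p i j) (at t within I)
                    = - codiff3 (g t) (H t) c p i j))) \<and>
     (\<forall>t\<in>I. \<forall>c\<in>A. \<forall>p\<in>chart_dom c. \<forall>i j.
        vector_derivative (\<lambda>s. g s c p i j) (at t within I)
          = - 2 * ricci (g t) c p i j + (1/2) * Hsq (g t) (H t) c p i j) \<and>
     smooth_function_family I A \<phi> \<and>
     (\<forall>t\<in>I. \<forall>c\<in>A. \<forall>p\<in>chart_dom c.
        heat_op I g \<phi> t c p = (1/6) * inner3 (g t) c p (H t c p) (H t c p))"

end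

theory Submission
  imports Defs "HOL-Library.Function_Algebras"
begin

text \<open>
  Put \<open>F = f + \<phi>\<close>, \<open>E = Rc - H\<^sup>2/4 + \<nabla>\<^sup>2F\<close>, \<open>B = d\<^sup>*H + i\<^bsub>\<nabla>F\<^esub>H\<close> and \<open>v = R\<^bsup>H,F\<^esup>\<close>. Since \<open>u = e\<^bsup>-f\<^esup>\<close> is
  annihilated by the conjugate heat operator, the claim amounts to
  \<open>\<partial>\<^sub>t v = - \<Delta>\<^sub>F v + \<langle>\<nabla>F, \<nabla>v\<rangle> + 2 |E|\<^sup>2 + |B|\<^sup>2/2\<close> with the drift Laplacian
  \<open>\<Delta>\<^sub>F = \<Delta> - \<langle>\<nabla>F, \<nabla>\<cdot>\<rangle>\<close>.

  Everything is computed in one chart with the twisted derivatives \<open>D\<^sub>l = \<partial>\<^sub>l + \<theta>\<^sub>l\<close>, where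
  \<open>\<theta>\<^sub>l = \<Gamma>\<^sup>m\<^sub>m\<^sub>l - \<partial>\<^sub>lF\<close> is the logarithmic derivative of the density \<open>e\<^bsup>-F\<^esup> \<surd>det g\<close>; then
  \<open>Rc + \<nabla>\<^sup>2F\<close> is \<open>D\<^sub>l\<Gamma>\<^sup>l\<^sub>j\<^sub>k - \<partial>\<^sub>j\<theta>\<^sub>k - \<Gamma>\<^sup>l\<^sub>j\<^sub>p\<Gamma>\<^sup>p\<^sub>l\<^sub>k\<close>. The first variation of
  \<open>R + 2\<Delta>F - |\<nabla>F|\<^sup>2\<close> is derived for an arbitrary derivation commuting with the \<open>\<partial>\<^sub>l\<close>. For \<open>\<partial>\<^sub>t\<close> it is the
  usual variation formula; for \<open>\<partial>\<^sub>k\<close>, because \<open>D\<^sub>iD\<^sub>l\<close> is symmetric, it is the contracted Bianchi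
  identity. Along the flow the logarithm of the density has time derivative \<open>\<Delta>\<^sub>F F\<close>, and Bochner's formula for \<open>F\<close> together
  with \<open>dH = 0\<close> gives the equation for \<open>v\<close>.
\<close>

section \<open>Sums over indices\<close>

text \<open>The weight is what makes the worst terms cancel. In terms of \<open>ric\<close> the flow
  reads \<partial>_t g = -2 ric + 2 Hess F + H^2/2. The Hessian part, pushed through two weighted
  divergences, yields a fourth-order term in F, the transport term of \<open>scal\<close> and a
  pairing of \<open>ric\<close> with Hess F. The fourth-order term is removed by the variation of
  the density, the pairing by the variation of the inverse metric in the trace of
  \<open>ric\<close>. What survives is a square: E is symmetric and B antisymmetric, so Rc^{H,F} = E
  - B/2 has squared norm |E|^2 + |B|^2/4.

  Two features of the setting shape the rest. Time derivatives at an endpoint of the interval are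
  one-sided, so uniqueness of derivatives and symmetry of second derivatives are established on
  products of an interval with an open set. And H is given only as H_0 + db, so its smoothness,
  closedness and evolution are derived from H_0 and b. The tensor computation takes place in a ring
  without division, whence the doubled identities and 12 v in place of v.\<close>

abbreviation index_sum :: "('n::finite \<Rightarrow> 'r::comm_monoid_add) \<Rightarrow> 'r"  (binder "\<Oplus>" 10)
  where "index_sum f \<equiv> sum f UNIV"

lemma index_sum_swap2: "(\<Oplus>a b. f a b) = (\<Oplus>b a. f a b)"
  by (rule sum.swap)

lemma index_sum_swap23: "(\<Oplus>a b c. f a b c) = (\<Oplus>a c b. f a b c)"
  by (intro sum.cong refl sum.swap)

lemma index_sum_swap13: "(\<Oplus>a b c. f a b c) = (\<Oplus>c b a. f a b c)"
  by (rule trans[OF index_sum_swap2], rule trans[OF index_sum_swap23], rule index_sum_swap2)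

lemma index_sum_rotate3: "(\<Oplus>a b c. f a b c) = (\<Oplus>b c a. f a b c)"
  by (rule trans[OF index_sum_swap2], rule index_sum_swap23)

lemma index_sum_swap34: "(\<Oplus>a b c e. f a b c e) = (\<Oplus>a b e c. f a b c e)"
  by (intro sum.cong refl sum.swap)

lemma index_sum_2413: "(\<Oplus>a b c e. f a b c e) = (\<Oplus>b e a c. f a b c e)"
  by (rule trans[OF index_sum_swap2], rule trans[OF index_sum_swap34], rule index_sum_swap23)

lemma index_sum_4321: "(\<Oplus>a b c e. f a b c e) = (\<Oplus>e c b a. f a b c e)"
  by (rule trans[OF index_sum_swap2], rule trans[OF index_sum_swap23],
      rule trans[OF index_sum_swap2], rule trans[OF index_sum_swap34],
      rule trans[OF index_sum_swap23], rule index_sum_swap2)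

text \<open>Full contractions list each tensor index next to its metric partner. This order gathers
  the free indices outside and the partners inside, where they assemble to
  \<open>H_up\<close>.\<close>

lemma index_sum_unpair: "(\<Oplus>p a q b r. f p a q b r) = (\<Oplus>a b p q r. f p a q b r)"
  by (rule trans[OF index_sum_swap2], rule sum.cong[OF refl],
      rule trans[OF index_sum_swap23], rule index_sum_swap2)

lemma index_sum_3412: "(\<Oplus>a b c e. f a b c e) = (\<Oplus>c e a b. f a b c e)"
  by (rule trans[OF index_sum_swap23], rule trans[OF index_sum_swap2],
      rule trans[OF index_sum_swap34], rule index_sum_swap23)

lemma index_sum_4312: "(\<Oplus>a b c e. f a b c e) = (\<Oplus>e c a b. f a b c e)"
  by (rule trans[OF index_sum_3412], rule index_sum_swap2)

lemma index_sum_rotate2_5: "(\<Oplus>a b c p q. f a b c p q) = (\<Oplus>p q a b c. f a b c p q)"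
  by (rule trans[OF index_sum_swap34], rule trans[OF _ index_sum_3412], intro sum.cong refl,
      rule index_sum_swap2)

lemma index_sum_swap_pairs4: "(\<Oplus>a a' b b'. f a a' b b') = (\<Oplus>a' a b' b. f a a' b b')"
  by (rule trans[OF index_sum_swap2], rule sum.cong[OF refl], rule sum.cong[OF refl],
      rule index_sum_swap2)

lemma index_sum_swap_pairs6:
  "(\<Oplus>a a' b b' c c'. f a a' b b' c c') = (\<Oplus>a' a b' b c' c. f a a' b b' c c')"
  by (rule trans[OF index_sum_swap2], rule sum.cong[OF refl], rule sum.cong[OF refl],
      rule index_sum_swap_pairs4)

lemma index_sum_4132: "(\<Oplus>a b c e. f a b c e) = (\<Oplus>e a c b. f a b c e)"
  by (rule trans[OF index_sum_swap34], rule trans[OF index_sum_swap23], rule trans[OF index_sum_swap2],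
      rule trans[OF index_sum_swap34], rule refl)

lemma index_sum_3142: "(\<Oplus>a b c e. f a b c e) = (\<Oplus>c a e b. f a b c e)"
  by (rule trans[OF index_sum_swap23], rule trans[OF index_sum_swap2], rule index_sum_swap34)

section \<open>Weighted tensor calculus in a differential ring\<close>

text \<open>Models the smooth functions \<open>S\<close> inside the ring of all functions: the ring
  operations are those of the type, while the rules for derivations hold on \<open>S\<close>
  only.\<close>

locale differential_ring =
  fixes S :: "'r::comm_ring_1 set" and d :: "'k \<Rightarrow> 'r \<Rightarrow> 'r"
  assumes S_0 [simp]: "0 \<in> S"
    and S_add [simp]: "a \<in> S \<Longrightarrow> b \<in> S \<Longrightarrow> a + b \<in> S"
    and S_uminus [simp]: "a \<in> S \<Longrightarrow> - a \<in> S"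
    and S_mult [simp]: "a \<in> S \<Longrightarrow> b \<in> S \<Longrightarrow> a * b \<in> S"
    and S_d [simp]: "a \<in> S \<Longrightarrow> d k a \<in> S"
    and d_add [simp]: "a \<in> S \<Longrightarrow> b \<in> S \<Longrightarrow> d k (a + b) = d k a + d k b"
    and d_mult [simp]: "a \<in> S \<Longrightarrow> b \<in> S \<Longrightarrow> d k (a * b) = d k a * b + a * d k b"
    and d_commute: "a \<in> S \<Longrightarrow> d k (d l a) = d l (d k a)"
begin

lemma S_diff [simp]: "a \<in> S \<Longrightarrow> b \<in> S \<Longrightarrow> a - b \<in> S"
  using S_add[of a "- b"] by simp

lemma d_0 [simp]: "d k 0 = 0"
  using d_add[of 0 0 k] by simp

lemma d_uminus [simp]: "a \<in> S \<Longrightarrow> d k (- a) = - d k a"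
  using d_add[of a "- a" k] by (simp add: eq_neg_iff_add_eq_0 add.commute)

lemma d_diff [simp]: "a \<in> S \<Longrightarrow> b \<in> S \<Longrightarrow> d k (a - b) = d k a - d k b"
  using d_add[of a "- b" k] by simp

lemma S_sum [simp]: "(\<And>i. i \<in> A \<Longrightarrow> f i \<in> S) \<Longrightarrow> sum f A \<in> S"
  by (induction A rule: infinite_finite_induct) auto

lemma d_sum [simp]: "(\<And>i. i \<in> A \<Longrightarrow> f i \<in> S) \<Longrightarrow> d k (sum f A) = (\<Sum>i\<in>A. d k (f i))"
  by (induction A rule: infinite_finite_induct) auto

text \<open>A numeral acts as repeated addition, so it is a constant for \<open>d\<close> by
  additivity alone.\<close>

lemma of_nat_mult:
  assumes "a \<in> S"
  shows "of_nat n * a \<in> S \<and> d k (of_nat n * a) = of_nat n * d k a"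
  using assms by (induction n) (simp_all add: distrib_right)

lemma S_numeral_mult [simp]: "a \<in> S \<Longrightarrow> numeral n * a \<in> S"
  using of_nat_mult[of a "numeral n"] by simp

lemma d_numeral_mult [simp]: "a \<in> S \<Longrightarrow> d k (numeral n * a) = numeral n * d k a"
  using of_nat_mult[of a "numeral n"] by simp

end

text \<open>
  The derivation \<open>None\<close> is \<open>\<partial>\<^sub>t\<close> and \<open>Some i\<close> is \<open>\<partial>\<^sub>i\<close>; \<open>G\<close> is the inverse metric, and \<open>\<psi> k\<close>
  stands for the derivative of \<open>F - log (det g) / 2\<close> in the direction \<open>k\<close>.
\<close>

locale weighted_metric = differential_ring S d
  for S :: "'r::comm_ring_1 set" and d :: "'n::finite option \<Rightarrow> 'r \<Rightarrow> 'r" +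
  fixes G :: "'n \<Rightarrow> 'n \<Rightarrow> 'r" and \<Gamma> :: "'n \<Rightarrow> 'n \<Rightarrow> 'n \<Rightarrow> 'r" and F :: 'r
    and \<theta> :: "'n \<Rightarrow> 'r" and \<psi> :: "'n option \<Rightarrow> 'r"
  assumes S_G [simp]: "G i j \<in> S" and S_\<Gamma> [simp]: "\<Gamma> l i j \<in> S" and S_F [simp]: "F \<in> S"
    and S_\<psi> [simp]: "\<psi> k \<in> S"
    and G_sym: "G i j = G j i" and \<Gamma>_sym: "\<Gamma> l i j = \<Gamma> l j i"
    and d_G: "d (Some l) (G i j) = - (\<Oplus>m. G i m * \<Gamma> j l m + G j m * \<Gamma> i l m)"
    and \<theta>_eq: "\<theta> l = (\<Oplus>m. \<Gamma> m m l) - d (Some l) F"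
    and d_\<theta>: "d k (\<theta> l) = - d (Some l) (\<psi> k)"
    and \<psi>_Some: "\<psi> (Some l) = - \<theta> l"
begin

abbreviation pard :: "'n \<Rightarrow> 'r \<Rightarrow> 'r" ("\<partial>") where "\<partial> i \<equiv> d (Some i)"

text \<open>With \<rho> = e^{-F} sqrt(det g) this is \<rho>^{-1} \<partial>_i (\<rho> a). Summed
  over the components of a vector field it is the weighted divergence.\<close>

definition D :: "'n \<Rightarrow> 'r \<Rightarrow> 'r" where "D i a = \<partial> i a + \<theta> i * a"

definition X :: "'n \<Rightarrow> 'r" where "X l = (\<Oplus>m. G l m * \<partial> m F)"

definition drift_lap :: "'r \<Rightarrow> 'r" where "drift_lap a = (\<Oplus>l. D l (\<Oplus>m. G l m * \<partial> m a))"

text \<open>\<open>ric\<close> is the weighted tensor \<open>Rc + \<nabla>\<^sup>2F\<close> and \<open>scal\<close> is \<open>R + 2\<Delta>F - |\<nabla>F|\<^sup>2\<close>.\<close>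

definition ric :: "'n \<Rightarrow> 'n \<Rightarrow> 'r" where
  "ric j k = (\<Oplus>l. D l (\<Gamma> l j k)) - \<partial> j (\<theta> k) - (\<Oplus>l p. \<Gamma> l j p * \<Gamma> p l k)"

definition scal :: "'r" where
  "scal = (\<Oplus>j k. G j k * ric j k) + drift_lap F"

text \<open>The weighted divergence \<nabla>_j T^{jl} - (\<partial>_j F) T^{jl}: one Christoffel
  term and the gradient of F are hidden in \<theta>.\<close>

definition div_up :: "('n \<Rightarrow> 'n \<Rightarrow> 'r) \<Rightarrow> 'n \<Rightarrow> 'r" where
  "div_up T l = (\<Oplus>j. D j (T j l)) + (\<Oplus>j m. T j m * \<Gamma> l j m)"

definition divdiv :: "('n \<Rightarrow> 'n \<Rightarrow> 'r) \<Rightarrow> 'r" where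
  "divdiv T = (\<Oplus>l. D l (div_up T l))"

section \<open>Rules for the twisted derivative\<close>

lemma S_\<theta> [simp]: "\<theta> l \<in> S"
  by (simp add: \<theta>_eq)

lemma S_D [simp]: "a \<in> S \<Longrightarrow> D i a \<in> S"
  by (simp add: D_def)

lemma S_X [simp]: "X l \<in> S"
  by (simp add: X_def)

lemma S_ric [simp]: "ric j k \<in> S"
  by (simp add: ric_def)

lemma S_drift_lap [simp]: "a \<in> S \<Longrightarrow> drift_lap a \<in> S"
  by (simp add: drift_lap_def)

lemma S_scal [simp]: "scal \<in> S"
  by (simp add: scal_def)

lemma S_div_up [simp]: "(\<And>i j. T i j \<in> S) \<Longrightarrow> div_up T l \<in> S"
  by (simp add: div_up_def)

lemma D_add: "a \<in> S \<Longrightarrow> b \<in> S \<Longrightarrow> D i (a + b) = D i a + D i b"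
  by (simp add: D_def algebra_simps)

lemma D_numeral: "a \<in> S \<Longrightarrow> D i (numeral n * a) = numeral n * D i a"
  by (simp add: D_def distrib_left mult.left_commute)

lemma D_diff: "a \<in> S \<Longrightarrow> b \<in> S \<Longrightarrow> D i (a - b) = D i a - D i b"
  by (simp add: D_def algebra_simps)

lemma D_uminus: "a \<in> S \<Longrightarrow> D i (- a) = - D i a"
  by (simp add: D_def algebra_simps)

lemma D_sum: "(\<And>j. j \<in> A \<Longrightarrow> f j \<in> S) \<Longrightarrow> D i (sum f A) = (\<Sum>j\<in>A. D i (f j))"
  by (simp add: D_def sum_distrib_left sum.distrib)

lemma D_mult1: "a \<in> S \<Longrightarrow> b \<in> S \<Longrightarrow> D i (a * b) = D i a * b + a * \<partial> i b"
  by (simp add: D_def algebra_simps)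

lemma D_mult2: "a \<in> S \<Longrightarrow> b \<in> S \<Longrightarrow> D i (a * b) = \<partial> i a * b + a * D i b"
  by (simp add: D_def algebra_simps)

lemma \<theta>_closed: "\<partial> i (\<theta> j) = \<partial> j (\<theta> i)"
  using d_\<theta>[of "Some i" j] by (simp add: \<psi>_Some)

lemma D_commute: "a \<in> S \<Longrightarrow> D i (D j a) = D j (D i a)"
  using \<theta>_closed[of i j] d_commute[of a "Some i" "Some j"]
  by (simp add: D_def algebra_simps)

lemma D_D_transpose:
  assumes "\<And>i j. a i j \<in> S"
  shows "(\<Oplus>i j. D i (D j (a i j))) = (\<Oplus>i j. D i (D j (a j i)))"
  by (subst index_sum_swap2) (simp add: D_commute assms)

text \<open>The commutator has order zero, because only the coefficient \<theta>_j is differentiated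
  by it.\<close>

lemma d_D: "a \<in> S \<Longrightarrow> d k (D j a) = D j (d k a) - \<partial> j (\<psi> k) * a"
  using d_commute[of a k "Some j"] by (simp add: D_def d_\<theta> algebra_simps)

section \<open>Weighted Ricci and scalar curvature and their first variation\<close>

lemma ric_sym: "ric j k = ric k j"
proof -
  have "(\<Oplus>l p. \<Gamma> l j p * \<Gamma> p l k) = (\<Oplus>l p. \<Gamma> l k p * \<Gamma> p l j)"
    by (subst index_sum_swap2) (simp add: \<Gamma>_sym mult.commute)
  moreover have "D l (\<Gamma> l j k) = D l (\<Gamma> l k j)" for l
    by (simp add: \<Gamma>_sym)
  ultimately show ?thesis
    unfolding ric_def using \<theta>_closed[of j k] by simp
qed

text \<open>The inverse metric is parallel, so its weighted divergence \<open>div_up G\<close>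
  retains only the weight and equals minus the gradient of F.\<close>

lemma D_G: "(\<Oplus>j. D j (G j l)) = - (\<Oplus>j m. G j m * \<Gamma> l j m) - X l"
proof -
  have "(\<Oplus>j m. G l m * \<Gamma> j j m) = (\<Oplus>j m. G j l * \<Gamma> m m j)"
    by (subst index_sum_swap2) (simp add: G_sym)
  moreover have "(\<Oplus>j. \<partial> j F * G j l) = X l"
    by (simp add: X_def G_sym mult.commute)
  ultimately show ?thesis
    by (simp add: D_def d_G \<theta>_eq sum.distrib sum_negf sum_subtractf algebra_simps sum_distrib_left)
qed

text \<open>The left side is the ordinary Laplacian; the drift comes from the divergence of the
  inverse metric in \<open>D_G\<close>.\<close>

lemma trace_hessian:
  assumes [simp]: "a \<in> S"
  shows "(\<Oplus>j m. G j m * (\<partial> j (\<partial> m a) - (\<Oplus>l. \<Gamma> l j m * \<partial> l a)))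
    = drift_lap a + (\<Oplus>l. X l * \<partial> l a)"
proof -
  have "drift_lap a = (\<Oplus>l m. D l (G l m) * \<partial> m a) + (\<Oplus>l m. G l m * \<partial> l (\<partial> m a))"
    by (simp add: drift_lap_def D_sum D_mult1 sum.distrib)
  also have "(\<Oplus>l m. D l (G l m) * \<partial> m a) = (\<Oplus>m. (\<Oplus>l. D l (G l m)) * \<partial> m a)"
    by (subst index_sum_swap2) (simp add: sum_distrib_right)
  also have "\<dots> = - (\<Oplus>m j p. G j p * \<Gamma> m j p * \<partial> m a) - (\<Oplus>m. X m * \<partial> m a)"
    by (simp add: D_G left_diff_distrib sum_subtractf sum_distrib_right sum_negf)
  also have "(\<Oplus>m j p. G j p * \<Gamma> m j p * \<partial> m a) = (\<Oplus>j p m. G j p * \<Gamma> m j p * \<partial> m a)"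
    by (rule index_sum_rotate3)
  finally show ?thesis
    by (simp add: right_diff_distrib sum_subtractf sum_distrib_left mult.assoc)
qed

text \<open>Moving the metric inside \<open>D\<close> costs the Christoffel terms of \<partial>G.
  For A = d\<Gamma> these are what the variation of the quadratic term of \<open>ric\<close>
  produces, so the two cancel in \<open>trace_d_ric\<close>.\<close>

lemma trace_D:
  assumes [simp]: "\<And>l i j. A l i j \<in> S"
  shows "(\<Oplus>j m l. G j m * D l (A l j m)) = (\<Oplus>l. D l (\<Oplus>j m. G j m * A l j m))
    + (\<Oplus>j m l p. G j m * (A l j p * \<Gamma> p l m + \<Gamma> l j p * A p l m))"
proof -
  have "(\<Oplus>l. D l (\<Oplus>j m. G j m * A l j m))
      = (\<Oplus>l j m. \<partial> l (G j m) * A l j m) + (\<Oplus>l j m. G j m * D l (A l j m))"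
    by (simp add: D_sum D_mult2 sum.distrib)
  also have "(\<Oplus>l j m. G j m * D l (A l j m)) = (\<Oplus>j m l. G j m * D l (A l j m))"
    by (rule index_sum_rotate3)
  also have "(\<Oplus>l j m. \<partial> l (G j m) * A l j m)
      = - (\<Oplus>l j m p. G j p * \<Gamma> m l p * A l j m) - (\<Oplus>l j m p. G m p * \<Gamma> j l p * A l j m)"
    by (simp add: d_G sum.distrib sum_negf sum_subtractf sum_distrib_left algebra_simps)
  also have "(\<Oplus>l j m p. G j p * \<Gamma> m l p * A l j m) = (\<Oplus>j m l p. G j m * (A l j p * \<Gamma> p l m))"
    by (rule trans[OF index_sum_2413]) (simp add: ac_simps)
  also have "(\<Oplus>l j m p. G m p * \<Gamma> j l p * A l j m) = (\<Oplus>j m l p. G j m * (\<Gamma> l j p * A p l m))"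
    by (rule trans[OF index_sum_4321]) (simp add: ac_simps G_sym \<Gamma>_sym)
  finally show ?thesis
    by (simp add: distrib_left sum.distrib)
qed

text \<open>Obtained by differentiating \<open>D_G\<close>, not from a formula for the variation of
  \<Gamma>; commuting \<open>d\<close> past \<open>D\<close> contributes the gradient of
  \<psi>.\<close>

lemma trace_d_\<Gamma>:
  "(\<Oplus>j m. G j m * d k (\<Gamma> l j m))
    = div_up (\<lambda>i j. - d k (G i j)) l + (\<Oplus>j. G l j * \<partial> j (\<psi> k)) - d k (X l)"
proof -
  have "d k (\<Oplus>j m. G j m * \<Gamma> l j m) = d k (- (\<Oplus>j. D j (G j l)) - X l)"
    by (simp add: D_G)
  then have "(\<Oplus>j m. d k (G j m) * \<Gamma> l j m) + (\<Oplus>j m. G j m * d k (\<Gamma> l j m))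
      = - (\<Oplus>j. D j (d k (G j l))) + (\<Oplus>j. \<partial> j (\<psi> k) * G j l) - d k (X l)"
    by (simp add: sum.distrib d_D sum_subtractf)
  then show ?thesis
    by (simp add: div_up_def sum_negf D_uminus G_sym algebra_simps)
qed

text \<open>A weighted Palatini identity: the traced variation of the Ricci tensor is a divergence,
  up to terms from the change of the weight.\<close>

lemma trace_d_ric:
  "(\<Oplus>j m. G j m * d k (ric j m))
    = (\<Oplus>l. D l (\<Oplus>j m. G j m * d k (\<Gamma> l j m))) + drift_lap (\<psi> k) + (\<Oplus>l. X l * \<partial> l (\<psi> k))"
proof -
  have "d k (\<partial> j (\<theta> m)) = - \<partial> j (\<partial> m (\<psi> k))" for j m
    using d_commute[of "\<theta> m" k "Some j"] by (simp add: d_\<theta>)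
  then have "d k (ric j m) = (\<Oplus>l. D l (d k (\<Gamma> l j m)))
      + (\<partial> j (\<partial> m (\<psi> k)) - (\<Oplus>l. \<Gamma> l j m * \<partial> l (\<psi> k)))
      - (\<Oplus>l p. d k (\<Gamma> l j p) * \<Gamma> p l m + \<Gamma> l j p * d k (\<Gamma> p l m))" for j m
    by (simp add: ric_def d_D sum_subtractf mult.commute)
  then have "(\<Oplus>j m. G j m * d k (ric j m)) = (\<Oplus>j m l. G j m * D l (d k (\<Gamma> l j m)))
      + (\<Oplus>j m. G j m * (\<partial> j (\<partial> m (\<psi> k)) - (\<Oplus>l. \<Gamma> l j m * \<partial> l (\<psi> k))))
      - (\<Oplus>j m l p. G j m * (d k (\<Gamma> l j p) * \<Gamma> p l m + \<Gamma> l j p * d k (\<Gamma> p l m)))"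
    by (simp only: distrib_left right_diff_distrib sum.distrib sum_subtractf sum_distrib_left)
  then show ?thesis
    by (simp add: trace_D trace_hessian)
qed

lemma d_drift_lap_F: "d k (drift_lap F) = (\<Oplus>l. D l (d k (X l))) - (\<Oplus>l. X l * \<partial> l (\<psi> k))"
  by (simp only: drift_lap_def X_def[symmetric])
    (simp add: d_D sum_subtractf mult.commute)

text \<open>The terms with the variation of X and with X applied to \<psi> occur in the trace of
  \<open>ric\<close> and in \<open>drift_lap F\<close> with opposite signs and cancel.\<close>

lemma d_scal:
  "d k scal = divdiv (\<lambda>i j. - d k (G i j)) + (\<Oplus>i j. d k (G i j) * ric i j) + 2 * drift_lap (\<psi> k)"
  by (simp add: scal_def d_drift_lap_F trace_d_ric trace_d_\<Gamma> divdiv_def drift_lap_def[of "\<psi> k"]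
      sum.distrib D_add D_diff sum_subtractf)

section \<open>Divergence of mixed tensors and the contracted Bianchi identity\<close>

definition ric1 :: "'n \<Rightarrow> 'n \<Rightarrow> 'r" where "ric1 i k = (\<Oplus>j. G i j * ric j k)"

lemma S_ric1 [simp]: "ric1 i k \<in> S"
  by (simp add: ric1_def)

text \<open>Raising the index under \<open>D\<close> produces the two terms of \<partial>G. One
  cancels the quadratic term of \<open>ric\<close>; the other contracts \<Gamma>^i with the same
  array G^{lp} \<Gamma>^m_{kp} that stands under \<open>D\<close>.\<close>

lemma ric1_eq:
  "ric1 i k = (\<Oplus>l. D l (\<Oplus>j. G i j * \<Gamma> l k j)) + (\<Oplus>l m p. \<Gamma> i l m * (G l p * \<Gamma> m k p))
    - (\<Oplus>j. G i j * \<partial> j (\<theta> k))"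
proof -
  have "(\<Oplus>l. D l (\<Oplus>j. G i j * \<Gamma> l k j))
      = (\<Oplus>l j. \<partial> l (G i j) * \<Gamma> l k j) + (\<Oplus>l j. G i j * D l (\<Gamma> l k j))"
    by (simp add: D_sum D_mult2 sum.distrib)
  also have "(\<Oplus>l j. G i j * D l (\<Gamma> l k j)) = (\<Oplus>j l. G i j * D l (\<Gamma> l j k))"
    by (subst index_sum_swap2) (simp add: \<Gamma>_sym)
  also have "(\<Oplus>l j. \<partial> l (G i j) * \<Gamma> l k j)
      = - (\<Oplus>l j p. G i p * \<Gamma> j l p * \<Gamma> l k j) - (\<Oplus>l j p. G j p * \<Gamma> i l p * \<Gamma> l k j)"
    by (simp add: d_G sum.distrib sum_negf sum_subtractf sum_distrib_left algebra_simps)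
  also have "(\<Oplus>l j p. G i p * \<Gamma> j l p * \<Gamma> l k j) = (\<Oplus>j l p. G i j * (\<Gamma> l j p * \<Gamma> p l k))"
    by (rule trans[OF index_sum_swap13]) (simp add: ac_simps \<Gamma>_sym)
  also have "(\<Oplus>l j p. G j p * \<Gamma> i l p * \<Gamma> l k j) = (\<Oplus>l m p. \<Gamma> i l m * (G l p * \<Gamma> m k p))"
    by (rule trans[OF index_sum_swap13]) (rule trans[OF index_sum_swap23], simp add: ac_simps G_sym \<Gamma>_sym)
  finally show ?thesis
    by (simp add: ric1_def ric_def right_diff_distrib sum_subtractf sum_distrib_left)
qed

text \<open>The weighted divergence of T^j_k; the sum is the Christoffel correction for the lower
  index.\<close>

definition div_mixed :: "('n \<Rightarrow> 'n \<Rightarrow> 'r) \<Rightarrow> 'n \<Rightarrow> 'r" where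
  "div_mixed T k = (\<Oplus>j. D j (T j k)) - (\<Oplus>a b. \<Gamma> a k b * T b a)"

lemma S_div_mixed [simp]: "(\<And>i j. T i j \<in> S) \<Longrightarrow> div_mixed T k \<in> S"
  by (simp add: div_mixed_def)

lemma div_up_raise:
  assumes [simp]: "\<And>i j. T i j \<in> S"
  shows "div_up (\<lambda>i j. \<Oplus>k. T i k * G k j) l = (\<Oplus>k. G l k * div_mixed T k)"
proof -
  have "(\<Oplus>j. D j (\<Oplus>k. T j k * G k l))
      = (\<Oplus>j k. D j (T j k) * G k l) + (\<Oplus>j k. T j k * \<partial> j (G k l))"
    by (simp add: D_sum D_mult1 sum.distrib)
  also have "(\<Oplus>j k. T j k * \<partial> j (G k l))
      = - (\<Oplus>j k m. T j k * G k m * \<Gamma> l j m) - (\<Oplus>j k m. T j k * G l m * \<Gamma> k j m)"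
    by (simp add: d_G sum.distrib sum_negf sum_subtractf sum_distrib_left algebra_simps)
  also have "(\<Oplus>j k m. T j k * G k m * \<Gamma> l j m) = (\<Oplus>j m. (\<Oplus>k. T j k * G k m) * \<Gamma> l j m)"
    by (rule trans[OF index_sum_swap23]) (simp add: sum_distrib_right)
  also have "(\<Oplus>j k m. T j k * G l m * \<Gamma> k j m) = (\<Oplus>k a b. G l k * (\<Gamma> a k b * T b a))"
    by (rule trans[OF index_sum_swap13]) (simp add: ac_simps \<Gamma>_sym)
  also have "(\<Oplus>j k. D j (T j k) * G k l) = (\<Oplus>k j. G l k * D j (T j k))"
    by (rule trans[OF index_sum_swap2]) (simp add: ac_simps G_sym)
  finally show ?thesis
    by (simp add: div_up_def div_mixed_def right_diff_distrib sum_subtractf sum_distrib_left)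
qed

lemma divdiv_raise:
  assumes [simp]: "\<And>i j. T i j \<in> S"
  shows "divdiv (\<lambda>i j. \<Oplus>k. T i k * G k j) = (\<Oplus>l. D l (\<Oplus>k. G l k * div_mixed T k))"
  by (simp add: divdiv_def div_up_raise)

text \<open>Both terms of \<partial>_k G contribute equally for symmetric T. Hence the Christoffel
  correction in \<open>div_mixed\<close> is half the pairing of \<partial>_k G with T.\<close>

lemma d_G_contract:
  assumes sym: "\<And>i j. T i j = T j i"
  shows "(\<Oplus>i j. \<partial> k (G i j) * T i j) = - 2 * (\<Oplus>a b. \<Gamma> a k b * (\<Oplus>j. G b j * T j a))"
proof -
  have "(\<Oplus>i j. \<partial> k (G i j) * T i j)
      = - (\<Oplus>i j m. G i m * \<Gamma> j k m * T i j) - (\<Oplus>i j m. G j m * \<Gamma> i k m * T i j)"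
    by (simp add: d_G sum.distrib sum_negf sum_subtractf sum_distrib_left algebra_simps)
  also have "(\<Oplus>i j m. G i m * \<Gamma> j k m * T i j) = (\<Oplus>a b j. \<Gamma> a k b * (G b j * T j a))"
    by (rule trans[OF index_sum_rotate3]) (simp add: ac_simps G_sym)
  also have "(\<Oplus>i j m. G j m * \<Gamma> i k m * T i j) = (\<Oplus>a b j. \<Gamma> a k b * (G b j * T j a))"
    by (rule trans[OF index_sum_swap23]) (simp add: ac_simps G_sym sym)
  finally show ?thesis
    by (simp add: sum_distrib_left)
qed

text \<open>
  This is \<open>d_scal\<close> with \<open>k\<close> a coordinate direction: \<open>ric1\<close> differs from half the divergence of \<open>-\<partial>\<^sub>kG\<close>
  by \<open>D\<^sub>l\<close> of an antisymmetric array and a gradient, and \<open>D\<^sub>iD\<^sub>l\<close> kills antisymmetric arrays.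
\<close>

lemma bianchi: "2 * div_mixed ric1 k = \<partial> k scal"
proof -
  define a where "a i l = (\<Oplus>j. G i j * \<Gamma> l k j)" for i l
  define c where "c i = (\<Oplus>l m. \<Gamma> i l m * a l m)" for i
  have S [simp]: "a i l \<in> S" "c i \<in> S" for i l
    by (simp_all add: a_def c_def)
  have h: "- \<partial> k (G i l) = a i l + a l i" for i l
    by (simp add: a_def d_G sum.distrib)
  have c': "(\<Oplus>j m. (a j m + a m j) * \<Gamma> i j m) = c i + c i" for i
  proof -
    have "(\<Oplus>j m. a m j * \<Gamma> i j m) = c i"
      by (subst index_sum_swap2) (simp add: c_def \<Gamma>_sym mult.commute)
    moreover have "(\<Oplus>j m. a j m * \<Gamma> i j m) = c i"
      by (simp add: c_def mult.commute)
    ultimately show ?thesis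
      by (simp add: distrib_right sum.distrib)
  qed
  have "ric1 i k = (\<Oplus>l. D l (a i l)) + c i - (\<Oplus>j. G i j * \<partial> j (\<theta> k))" for i
    by (simp add: ric1_eq a_def c_def sum_distrib_left)
  then have 1: "(\<Oplus>i. D i (ric1 i k)) = (\<Oplus>i l. D i (D l (a i l))) + (\<Oplus>i. D i (c i)) - drift_lap (\<theta> k)"
    by (simp add: D_add D_diff D_sum sum.distrib sum_subtractf drift_lap_def)
  have "divdiv (\<lambda>i j. - \<partial> k (G i j)) =
      (\<Oplus>i l. D i (D l (a l i))) + (\<Oplus>i l. D i (D l (a i l))) + ((\<Oplus>i. D i (c i)) + (\<Oplus>i. D i (c i)))"
    by (simp add: h divdiv_def div_up_def c' D_add D_numeral D_sum sum.distrib sum_distrib_left)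
  also have "(\<Oplus>i l. D i (D l (a l i))) = (\<Oplus>i l. D i (D l (a i l)))"
    by (rule D_D_transpose) simp
  finally have 2: "divdiv (\<lambda>i j. - \<partial> k (G i j)) = 2 * (\<Oplus>i. D i (ric1 i k)) + 2 * drift_lap (\<theta> k)"
    unfolding 1 by simp
  have "drift_lap (\<psi> (Some k)) = - drift_lap (\<theta> k)"
    by (simp add: \<psi>_Some drift_lap_def sum_negf D_uminus)
  then show ?thesis
    using d_G_contract[of ric k, OF ric_sym, folded ric1_def]
    by (simp add: d_scal 2 div_mixed_def algebra_simps)
qed

section \<open>The mixed Hessian \<nabla>_b \<nabla>^a F and Bochner's formula\<close>

definition hess1 :: "'n \<Rightarrow> 'n \<Rightarrow> 'r" where
  "hess1 a b = \<partial> b (X a) + (\<Oplus>c. \<Gamma> a b c * X c)"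

lemma S_hess1 [simp]: "hess1 a b \<in> S"
  by (simp add: hess1_def)

text \<open>The commutator of D_a and \<partial>_b supplies the derivative of \<theta>, the product
  rule supplies D_a \<Gamma>^a_{bc}, and the Christoffel correction of the divergence supplies the
  quadratic term: these are the three parts of \<open>ric\<close>.\<close>

lemma bochner: "div_mixed hess1 b = \<partial> b (drift_lap F) + (\<Oplus>c. ric b c * X c)"
proof -
  have "D a (\<partial> b (X a)) = \<partial> b (D a (X a)) - \<partial> a (\<theta> b) * X a" for a
    using d_D[of "X a" "Some b" a] by (simp add: \<psi>_Some)
  then have 1: "(\<Oplus>a. D a (\<partial> b (X a))) = \<partial> b (drift_lap F) - (\<Oplus>a. \<partial> b (\<theta> a) * X a)"
    by (simp add: drift_lap_def X_def[symmetric] sum_subtractf \<theta>_closed[of b])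
  have "(\<Oplus>a c. D a (\<Gamma> a b c) * X c) = (\<Oplus>c. (\<Oplus>a. D a (\<Gamma> a b c)) * X c)"
    by (subst index_sum_swap2) (simp add: sum_distrib_right)
  also have "\<dots> = (\<Oplus>c. ric b c * X c) + (\<Oplus>c. \<partial> b (\<theta> c) * X c) + (\<Oplus>c l p. \<Gamma> l b p * (\<Gamma> p l c * X c))"
    by (simp add: ric_def sum.distrib left_diff_distrib distrib_right sum_subtractf sum_distrib_right mult.assoc)
  also have "(\<Oplus>c l p. \<Gamma> l b p * (\<Gamma> p l c * X c)) = (\<Oplus>l p c. \<Gamma> l b p * (\<Gamma> p l c * X c))"
    by (rule index_sum_rotate3)
  finally show ?thesis
    by (simp add: div_mixed_def hess1_def D_add D_sum D_mult1 1 sum.distrib distrib_left sum_distrib_left)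
qed

text \<open>Leibniz rule for a contraction; the Christoffel corrections in \<open>div_mixed\<close>
  and \<open>hess1\<close> cancel each other.\<close>

lemma div_contract_X:
  assumes [simp]: "\<And>i j. T i j \<in> S"
  shows "(\<Oplus>l. D l (\<Oplus>c. T l c * X c)) = (\<Oplus>c. div_mixed T c * X c) + (\<Oplus>l c. T l c * hess1 c l)"
proof -
  have "(\<Oplus>l c. T l c * hess1 c l) = (\<Oplus>l c. T l c * \<partial> l (X c)) + (\<Oplus>l c e. T l c * (\<Gamma> c l e * X e))"
    by (simp add: hess1_def distrib_left sum.distrib sum_distrib_left)
  also have "(\<Oplus>l c e. T l c * (\<Gamma> c l e * X e)) = (\<Oplus>c a b. \<Gamma> a c b * T b a * X c)"
    by (rule trans[OF index_sum_swap13]) (simp add: ac_simps \<Gamma>_sym)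
  finally have 1: "(\<Oplus>l c. T l c * hess1 c l) = (\<Oplus>l c. T l c * \<partial> l (X c)) + (\<Oplus>c a b. \<Gamma> a c b * T b a * X c)" .
  have "(\<Oplus>l. D l (\<Oplus>c. T l c * X c)) = (\<Oplus>l c. D l (T l c) * X c) + (\<Oplus>l c. T l c * \<partial> l (X c))"
    by (simp add: D_sum D_mult1 sum.distrib)
  also have "(\<Oplus>l c. D l (T l c) * X c) = (\<Oplus>c l. D l (T l c) * X c)"
    by (rule index_sum_swap2)
  finally show ?thesis
    unfolding 1 by (simp add: div_mixed_def left_diff_distrib sum_subtractf sum_distrib_right)
qed

text \<open>The divergence of the Bianchi identity. It yields the leading term of the backward heat
  equation, since -\<partial>_t G contains -2 \<open>ric\<close> with raised indices.\<close>

lemma divdiv_ric: "2 * divdiv (\<lambda>i j. \<Oplus>k. ric1 i k * G k j) = drift_lap scal"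
proof -
  have *: "(\<Oplus>k. G l k * (2 * div_mixed ric1 k)) = 2 * (\<Oplus>k. G l k * div_mixed ric1 k)" for l
    by (simp add: sum_distrib_left ac_simps)
  show ?thesis
    unfolding drift_lap_def bianchi[symmetric] *
    by (simp add: divdiv_raise D_numeral flip: sum_distrib_left)
qed

text \<open>Bochner's formula reduces the first divergence to the gradient of
  \<open>drift_lap F\<close> and \<open>ric\<close> applied to X; the second divergence of the
  latter follows from the Leibniz rule and the Bianchi identity.\<close>

lemma divdiv_hess: "2 * divdiv (\<lambda>i j. \<Oplus>k. hess1 i k * G k j) = 2 * drift_lap (drift_lap F)
    + (\<Oplus>c. X c * \<partial> c scal) + 2 * (\<Oplus>l c. ric1 l c * hess1 c l)"
proof -
  have "(\<Oplus>k. G l k * (\<Oplus>c. ric k c * X c)) = (\<Oplus>c. ric1 l c * X c)" for l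
    unfolding ric1_def sum_distrib_left sum_distrib_right
    by (subst index_sum_swap2) (simp add: mult.assoc)
  then have "divdiv (\<lambda>i j. \<Oplus>k. hess1 i k * G k j) = drift_lap (drift_lap F) + (\<Oplus>l. D l (\<Oplus>c. ric1 l c * X c))"
    by (simp add: divdiv_raise bochner distrib_left sum.distrib D_add drift_lap_def[of "drift_lap F"])
  moreover have "2 * (\<Oplus>c. div_mixed ric1 c * X c) = (\<Oplus>c. X c * \<partial> c scal)"
    unfolding bianchi[symmetric] sum_distrib_left by (simp add: ac_simps)
  ultimately show ?thesis
    by (simp add: div_contract_X distrib_left)
qed

section \<open>Pairings of gradients and of 2-tensors, product rules for the drift Laplacian\<close>

definition grad_inner :: "'r \<Rightarrow> 'r \<Rightarrow> 'r" where
  "grad_inner a b = (\<Oplus>i j. G i j * \<partial> i a * \<partial> j b)"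

definition norm2 :: "('n \<Rightarrow> 'n \<Rightarrow> 'r) \<Rightarrow> ('n \<Rightarrow> 'n \<Rightarrow> 'r) \<Rightarrow> 'r" where
  "norm2 T U = (\<Oplus>i i' j j'. G i i' * G j j' * T i j * U i' j')"

lemma grad_inner_commute: "grad_inner a b = grad_inner b a"
  unfolding grad_inner_def by (subst index_sum_swap2) (simp add: G_sym ac_simps)

lemma grad_inner_mult:
  "a \<in> S \<Longrightarrow> b \<in> S \<Longrightarrow> grad_inner (a * b) e = a * grad_inner b e + b * grad_inner a e"
  by (simp add: grad_inner_def distrib_left distrib_right sum.distrib sum_distrib_left ac_simps)

lemma grad_inner_add:
  "a \<in> S \<Longrightarrow> b \<in> S \<Longrightarrow> grad_inner e (a + b) = grad_inner e a + grad_inner e b"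
  by (simp add: grad_inner_def distrib_left sum.distrib)

lemma X_eq_grad_inner: "(\<Oplus>l. X l * \<partial> l a) = grad_inner a F"
  by (simp add: X_def grad_inner_def sum_distrib_left sum_distrib_right ac_simps)

lemma drift_lap_add: "a \<in> S \<Longrightarrow> b \<in> S \<Longrightarrow> drift_lap (a + b) = drift_lap a + drift_lap b"
  by (simp add: drift_lap_def distrib_left sum.distrib D_add)

lemma drift_lap_numeral: "a \<in> S \<Longrightarrow> drift_lap (numeral n * a) = numeral n * drift_lap a"
proof -
  assume "a \<in> S"
  moreover have "(\<Oplus>m. G l m * (numeral n * \<partial> m a)) = numeral n * (\<Oplus>m. G l m * \<partial> m a)" for l
    by (simp add: sum_distrib_left mult.left_commute)
  ultimately show ?thesis
    by (simp add: drift_lap_def D_numeral flip: sum_distrib_left)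
qed

lemma D_mult_grad:
  assumes [simp]: "a \<in> S" "b \<in> S"
  shows "(\<Oplus>l. D l (a * (\<Oplus>m. G l m * \<partial> m b))) = a * drift_lap b + grad_inner a b"
proof -
  have "(\<Oplus>l. \<partial> l a * (\<Oplus>m. G l m * \<partial> m b)) = grad_inner a b"
    by (simp add: grad_inner_def sum_distrib_left ac_simps)
  then show ?thesis
    by (simp add: D_mult2 sum.distrib drift_lap_def flip: sum_distrib_left)
qed

text \<open>The factor a plays the role of an outer derivative, as the ring has no composition: for
  e = exp(-f) one takes a = -e and b = f.\<close>

lemma drift_lap_chain:
  assumes "a \<in> S" "b \<in> S" and eq: "\<And>m. \<partial> m e = a * \<partial> m b"
  shows "drift_lap e = a * drift_lap b + grad_inner a b"
proof -
  have "(\<Oplus>m. G l m * \<partial> m e) = a * (\<Oplus>m. G l m * \<partial> m b)" for l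
    by (simp add: eq sum_distrib_left mult.left_commute)
  then show ?thesis
    using D_mult_grad[OF assms(1,2)] by (simp add: drift_lap_def[of e])
qed

lemma drift_lap_mult:
  assumes [simp]: "a \<in> S" "b \<in> S"
  shows "drift_lap (a * b) = a * drift_lap b + b * drift_lap a + 2 * grad_inner a b"
proof -
  have "(\<Oplus>m. G l m * \<partial> m (a * b)) = a * (\<Oplus>m. G l m * \<partial> m b) + b * (\<Oplus>m. G l m * \<partial> m a)" for l
    by (simp add: distrib_left sum.distrib sum_distrib_left ac_simps)
  then show ?thesis
    using grad_inner_commute[of b a]
    by (simp add: drift_lap_def[of "a * b"] D_add sum.distrib D_mult_grad)
qed

lemma norm2_raise1: "(\<Oplus>i j. (\<Oplus>k. (\<Oplus>m. G i m * T m k) * G k j) * U i j) = norm2 T U"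
proof -
  have "(\<Oplus>i j. (\<Oplus>k. (\<Oplus>m. G i m * T m k) * G k j) * U i j)
      = (\<Oplus>i j k m. G m i * (G k j * (T m k * U i j)))"
    by (simp add: sum_distrib_left sum_distrib_right G_sym ac_simps)
  also have "\<dots> = norm2 T U"
    by (rule trans[OF index_sum_4132]) (simp add: norm2_def ac_simps)
  finally show ?thesis .
qed

lemma norm2_raise2: "(\<Oplus>a b. (\<Oplus>c e. G a c * G b e * T c e) * U a b) = norm2 T U"
proof -
  have "(\<Oplus>a b. (\<Oplus>c e. G a c * G b e * T c e) * U a b)
      = (\<Oplus>a b c e. G c a * (G e b * (T c e * U a b)))"
    by (simp add: sum_distrib_left sum_distrib_right G_sym ac_simps)
  also have "\<dots> = norm2 T U"
    by (rule trans[OF index_sum_3142]) (simp add: norm2_def ac_simps)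
  finally show ?thesis .
qed

lemma norm2_commute: "norm2 T U = norm2 U T"
  unfolding norm2_def by (rule trans[OF index_sum_swap_pairs4]) (simp add: G_sym ac_simps)

lemma norm2_transpose: "norm2 T U = norm2 (\<lambda>i j. T j i) (\<lambda>i j. U j i)"
  unfolding norm2_def by (rule trans[OF index_sum_3412]) (simp add: ac_simps)

text \<open>Raising the index of dF commutes with covariant differentiation. The right side is the
  form in which the Hessian enters the flow of the inverse metric.\<close>

lemma hess1_eq: "hess1 i k = (\<Oplus>a. G i a * (\<partial> a (\<partial> k F) - (\<Oplus>m. \<Gamma> m a k * \<partial> m F)))"
proof -
  have "\<partial> k (X i) = (\<Oplus>a. \<partial> k (G i a) * \<partial> a F) + (\<Oplus>a. G i a * \<partial> k (\<partial> a F))"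
    by (simp add: X_def sum.distrib)
  also have "(\<Oplus>a. \<partial> k (G i a) * \<partial> a F)
      = - (\<Oplus>a m. G i m * \<Gamma> a k m * \<partial> a F) - (\<Oplus>a m. G a m * \<Gamma> i k m * \<partial> a F)"
    by (simp add: d_G sum.distrib sum_negf sum_subtractf sum_distrib_left algebra_simps)
  also have "(\<Oplus>a m. G i m * \<Gamma> a k m * \<partial> a F) = (\<Oplus>a m. G i a * (\<Gamma> m a k * \<partial> m F))"
    by (subst index_sum_swap2) (simp add: \<Gamma>_sym ac_simps)
  also have "(\<Oplus>a m. G a m * \<Gamma> i k m * \<partial> a F) = (\<Oplus>c. \<Gamma> i k c * X c)"
    by (subst index_sum_swap2) (simp add: X_def sum_distrib_left G_sym ac_simps)
  finally show ?thesis
    by (simp add: hess1_def right_diff_distrib sum_subtractf sum_distrib_left d_commute[of F "Some k"])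
qed

end

section \<open>Three-forms\<close>

text \<open>Three bilinear forms instead of one, because the derivative of |H|^2 hits one metric
  factor at a time and each resulting term has again this shape.\<close>

definition contract3 :: "('n::finite \<Rightarrow> 'n \<Rightarrow> 'r::comm_ring_1) \<Rightarrow> ('n \<Rightarrow> 'n \<Rightarrow> 'r) \<Rightarrow> ('n \<Rightarrow> 'n \<Rightarrow> 'r) \<Rightarrow>
    ('n \<Rightarrow> 'n \<Rightarrow> 'n \<Rightarrow> 'r) \<Rightarrow> ('n \<Rightarrow> 'n \<Rightarrow> 'n \<Rightarrow> 'r) \<Rightarrow> 'r" where
  "contract3 G1 G2 G3 A C =
    (\<Oplus>i i' j j' k k'. G1 i i' * G2 j j' * G3 k k' * A i j k * C i' j' k')"

text \<open>
  The linear bookkeeping of the evolution equation, on variables so that the simplifier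
  cannot rewrite inside the tensor expressions.
\<close>

lemma collect_divdiv:
  fixes h :: "'r::comm_ring_1"
  assumes "2 * h = P + 4 * N - 4 * R" and "6 * P = p" and "2 * N = n" and "2 * R = r"
  shows "2 * (12 * h) = 2 * p + 24 * n - 24 * r"
proof -
  have "2 * (12 * h) = 12 * (2 * h)" by simp
  also have "\<dots> = 2 * (6 * P) + 24 * (2 * N) - 24 * (2 * R)"
    unfolding assms(1) by (simp add: algebra_simps)
  finally show ?thesis unfolding assms .
qed

lemma collect_ric:
  fixes g :: "'r::comm_ring_1"
  assumes "2 * g = 4 * a - b - 4 * c"
  shows "2 * (12 * g) = 48 * a - 12 * b - 48 * c"
proof -
  have "2 * (12 * g) = 12 * (2 * g)" by simp
  then show ?thesis unfolding assms by (simp add: algebra_simps)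
qed

lemma collect_norm:
  fixes g :: "'r::comm_ring_1"
  assumes "2 * g = 4 * a - b - 4 * c"
  shows "2 * (3 * g + 2 * (- 3 * k)) = 12 * a - 3 * b - 12 * c - 12 * k"
proof -
  have "2 * (3 * g + 2 * (- 3 * k)) = 3 * (2 * g) - 12 * k" by (simp add: algebra_simps)
  then show ?thesis unfolding assms by (simp add: algebra_simps)
qed

lemma collect_flux:
  fixes a :: "'r::comm_ring_1"
  assumes "6 * x = 6 * b + q + 6 * n"
  shows "12 * (a + k + x) = 12 * a + 12 * k + (12 * b + 2 * q + 12 * n)"
proof -
  have "12 * (a + k + x) = 12 * a + 12 * k + 2 * (6 * x)" by (simp add: algebra_simps)
  then show ?thesis unfolding assms by (simp add: algebra_simps)
qed

lemma collect_evolution: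
  fixes h :: "'r::comm_ring_1"
  assumes "2 * (12 * h) = 2 * (Q - 6 * DB) + 24 * (2 * LL + Xs + 2 * rN) - 24 * L"
    and "2 * (12 * g) = 48 * RR - 12 * RP - 48 * rN"
    and "2 * q = 12 * RP - 3 * PP - 12 * PN - 12 * HC"
    and "12 * DB = 12 * dc + 12 * HC + (12 * dX + 2 * XQ + 12 * PN)"
    and "s = h + g + 2 * (- LL)"
  shows "2 * (12 * s - q) = - 2 * (12 * L - Q) + 2 * (12 * Xs - XQ) + 12 * (- dc - dX)
    + 48 * RR - 24 * RP + 3 * PP"
proof -
  have "2 * (12 * s - q) = 2 * (12 * h) + 2 * (12 * g) - 48 * LL - 2 * q"
    unfolding assms(5) by (simp add: algebra_simps)
  also have "\<dots> = 2 * Q - 12 * DB + 24 * Xs - 24 * L + 48 * RR - 24 * RP + 3 * PP + 12 * PN + 12 * HC"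
    unfolding assms(1-3) by (simp add: algebra_simps)
  finally show ?thesis
    unfolding assms(4) by (simp add: algebra_simps)
qed

text \<open>\<open>torsion_free\<close> stands in for division by 2: it lets a sum that equals its
  own negative vanish.\<close>

locale weighted_metric_flux = weighted_metric S d G \<Gamma> F \<theta> \<psi>
  for S :: "'r::comm_ring_1 set" and d :: "'n::finite option \<Rightarrow> 'r \<Rightarrow> 'r" and G \<Gamma> F \<theta> \<psi> +
  fixes H :: "'n \<Rightarrow> 'n \<Rightarrow> 'n \<Rightarrow> 'r"
  assumes S_H [simp]: "H i j k \<in> S"
    and H_swap12: "H i j k = - H j i k" and H_swap23: "H i j k = - H i k j"
    and H_closed: "d (Some i) (H j k l) - d (Some j) (H i k l) + d (Some k) (H i j l) - d (Some l) (H i j k) = 0"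
    and torsion_free: "(a::'r) + a = 0 \<Longrightarrow> a = 0"
begin

section \<open>The flux with raised indices, H^2 and |H|^2\<close>

definition H_up :: "'n \<Rightarrow> 'n \<Rightarrow> 'n \<Rightarrow> 'r" where
  "H_up i a b = (\<Oplus>p q r. G i p * G a q * G b r * H p q r)"

definition H_sq :: "'n \<Rightarrow> 'n \<Rightarrow> 'r" where
  "H_sq i j = (\<Oplus>a a' b b'. G a a' * G b b' * H i a b * H j a' b')"

definition H_norm :: 'r where "H_norm = contract3 G G G H H"

definition H_sq1 :: "'n \<Rightarrow> 'n \<Rightarrow> 'r" where "H_sq1 i k = (\<Oplus>j. G i j * H_sq j k)"

definition div_H :: "'n \<Rightarrow> 'n \<Rightarrow> 'r" where "div_H a b = (\<Oplus>i. D i (H_up i a b))"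

lemma S_H_more [simp]: "H_up i a b \<in> S" "H_sq i j \<in> S" "H_norm \<in> S" "H_sq1 i j \<in> S" "div_H i j \<in> S"
  by (simp_all add: H_up_def H_sq_def H_norm_def H_sq1_def div_H_def contract3_def)

lemma H_up_swap12: "H_up i a b = - H_up a i b"
proof -
  have "H_up i a b = (\<Oplus>p q r. G i p * G a q * G b r * - H q p r)"
    unfolding H_up_def by (intro sum.cong refl arg_cong2[of _ _ _ _ "(*)"] H_swap12)
  also have "\<dots> = (\<Oplus>q p r. G i p * G a q * G b r * - H q p r)"
    by (rule index_sum_swap2)
  finally show ?thesis
    by (simp add: H_up_def sum_negf ac_simps)
qed

lemma H_up_swap23: "H_up i a b = - H_up i b a"
proof -
  have "H_up i a b = (\<Oplus>p q r. G i p * G a q * G b r * - H p r q)"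
    unfolding H_up_def by (intro sum.cong refl arg_cong2[of _ _ _ _ "(*)"] H_swap23)
  also have "\<dots> = (\<Oplus>p r q. G i p * G a q * G b r * - H p r q)"
    by (rule index_sum_swap23)
  finally show ?thesis
    by (simp add: H_up_def sum_negf ac_simps)
qed

lemma H_up_rotate: "H_up i a b = H_up a b i"
  by (metis H_up_swap12 H_up_swap23 minus_minus)

lemma contract3_eq: "contract3 G G G A H = (\<Oplus>i a b. A i a b * H_up i a b)"
  unfolding contract3_def H_up_def
  by (rule sum.cong[OF refl], rule trans[OF index_sum_unpair])
    (simp add: sum_distrib_left ac_simps)

lemma contract3_sym: "contract3 G G G A C = contract3 G G G C A"
  unfolding contract3_def by (rule trans[OF index_sum_swap_pairs6]) (simp add: G_sym ac_simps)

text \<open>Both copies of H change sign under the transposition, so the forms in the two slots may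
  be exchanged.\<close>

lemma contract3_swap12: "contract3 G1 G2 G3 H H = contract3 G2 G1 G3 H H"
proof -
  have *: "H i j k * H i' j' k' = H j i k * H j' i' k'" for i j k i' j' k'
    unfolding H_swap12[of i j k] H_swap12[of i' j' k'] by simp
  have "contract3 G1 G2 G3 H H
      = (\<Oplus>i i' j j' k k'. G1 i i' * (G2 j j' * (G3 k k' * (H j i k * H j' i' k'))))"
    unfolding contract3_def mult.assoc by (intro sum.cong refl arg_cong2[of _ _ _ _ "(*)"] *)
  also have "\<dots> = contract3 G2 G1 G3 H H"
    by (rule trans[OF index_sum_3412]) (simp add: contract3_def ac_simps)
  finally show ?thesis .
qed

lemma contract3_swap23: "contract3 G1 G2 G3 H H = contract3 G1 G3 G2 H H"
proof -
  have *: "H i j k * H i' j' k' = H i k j * H i' k' j'" for i j k i' j' k'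
    unfolding H_swap23[of i j k] H_swap23[of i' j' k'] by simp
  have "contract3 G1 G2 G3 H H
      = (\<Oplus>i i' j j' k k'. G1 i i' * (G2 j j' * (G3 k k' * (H i k j * H i' k' j'))))"
    unfolding contract3_def mult.assoc by (intro sum.cong refl arg_cong2[of _ _ _ _ "(*)"] *)
  also have "\<dots> = contract3 G1 G3 G2 H H"
    unfolding contract3_def
    by (rule sum.cong[OF refl], rule sum.cong[OF refl], rule trans[OF index_sum_3412])
      (simp add: ac_simps)
  finally show ?thesis .
qed

lemma contract3_H_sq: "contract3 K G G H H = (\<Oplus>i j. K i j * H_sq i j)"
  by (simp add: contract3_def H_sq_def sum_distrib_left mult.assoc)

text \<open>The three metric slots contribute equally, and so do the two copies of H; hence the
  factors 3 and 2.\<close>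

lemma d_H_norm:
  "d k H_norm = 3 * (\<Oplus>i j. d k (G i j) * H_sq i j) + 2 * (\<Oplus>i a b. d k (H i a b) * H_up i a b)"
proof -
  have "d k H_norm = contract3 (\<lambda>i j. d k (G i j)) G G H H + contract3 G (\<lambda>i j. d k (G i j)) G H H
     + contract3 G G (\<lambda>i j. d k (G i j)) H H
     + contract3 G G G (\<lambda>i a b. d k (H i a b)) H + contract3 G G G H (\<lambda>i a b. d k (H i a b))"
    by (simp add: H_norm_def contract3_def sum.distrib distrib_right distrib_left mult.assoc)
  also have "contract3 G (\<lambda>i j. d k (G i j)) G H H = contract3 (\<lambda>i j. d k (G i j)) G G H H"
    by (rule contract3_swap12)
  also have "contract3 G G (\<lambda>i j. d k (G i j)) H H = contract3 (\<lambda>i j. d k (G i j)) G G H H"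
    by (rule trans[OF contract3_swap23 contract3_swap12])
  also have "contract3 G G G H (\<lambda>i a b. d k (H i a b)) = contract3 G G G (\<lambda>i a b. d k (H i a b)) H"
    by (rule contract3_sym)
  finally show ?thesis
    by (simp add: contract3_H_sq contract3_eq)
qed

lemma H_sq_sym: "H_sq i j = H_sq j i"
  unfolding H_sq_def by (rule trans[OF index_sum_swap_pairs4]) (simp add: G_sym ac_simps)

lemma H_sq1_eq: "H_sq1 i k = (\<Oplus>a b. H_up i a b * H k a b)"
proof -
  have "H_sq1 i k = (\<Oplus>p a q b r. G i p * (G a q * G b r * H k a b * H p q r))"
    unfolding H_sq1_def by (subst H_sq_sym) (simp add: H_sq_def sum_distrib_left)
  also have "\<dots> = (\<Oplus>a b. H_up i a b * H k a b)"
    by (rule trans[OF index_sum_unpair]) (simp add: H_up_def sum_distrib_left ac_simps)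
  finally show ?thesis .
qed

text \<open>Closedness expresses \<partial>_i H_{kab} by \<partial>_k H_{iab} and two further terms.
  After relabelling by the antisymmetry of \<open>H_up\<close>, each of these contributes minus the
  sum on the left, which therefore occurs three times.\<close>

lemma H_closed_contract:
  "3 * (\<Oplus>i a b. H_up i a b * \<partial> i (H k a b)) = (\<Oplus>i a b. \<partial> k (H i a b) * H_up i a b)"
proof -
  let ?Z = "\<Oplus>i a b. H_up i a b * \<partial> i (H k a b)"
  have d12: "\<partial> l (H a k b) = - \<partial> l (H k a b)" for l a b
    by (subst H_swap12) simp
  have "H_up i a b * \<partial> i (H k a b) = \<partial> k (H i a b) * H_up i a b
      - H_up i a b * \<partial> a (H i k b) + H_up i a b * \<partial> b (H i k a)" for i a b
  proof -
    have *: "\<partial> i (H k a b) = \<partial> k (H i a b) - \<partial> a (H i k b) + \<partial> b (H i k a)"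
      using H_closed[of i k a b] by (simp add: algebra_simps)
    show ?thesis
      unfolding * by (simp add: algebra_simps)
  qed
  then have "?Z = (\<Oplus>i a b. \<partial> k (H i a b) * H_up i a b
      - H_up i a b * \<partial> a (H i k b) + H_up i a b * \<partial> b (H i k a))"
    by (intro sum.cong refl)
  then have "?Z = (\<Oplus>i a b. \<partial> k (H i a b) * H_up i a b)
      - (\<Oplus>i a b. H_up i a b * \<partial> a (H i k b)) + (\<Oplus>i a b. H_up i a b * \<partial> b (H i k a))"
    by (simp add: sum.distrib sum_subtractf)
  also have "(\<Oplus>i a b. H_up i a b * \<partial> a (H i k b)) = ?Z"
    by (rule trans[OF index_sum_swap2], intro sum.cong refl) (subst H_up_swap12, simp add: d12)
  also have "(\<Oplus>i a b. H_up i a b * \<partial> b (H i k a)) = (\<Oplus>i a b. - (H_up i a b * \<partial> i (H k a b)))"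
    by (rule trans[OF index_sum_rotate3[symmetric]], intro sum.cong refl)
      (subst H_up_rotate[symmetric], simp add: d12)
  also have "\<dots> = - ?Z"
    by (simp add: sum_negf)
  finally show ?thesis
    by (simp add: algebra_simps)
qed

text \<open>The analogue of the Bianchi identity for the flux: half the pairing of \<partial>_k G
  with H^2, from the Christoffel correction, and the contracted closedness together make up a sixth
  of \<partial>_k |H|^2.\<close>

lemma div_mixed_H_sq1: "6 * div_mixed H_sq1 k = 6 * (\<Oplus>a b. div_H a b * H k a b) + \<partial> k H_norm"
proof -
  have "(\<Oplus>i. D i (H_sq1 i k)) = (\<Oplus>i a b. D i (H_up i a b) * H k a b) + (\<Oplus>i a b. H_up i a b * \<partial> i (H k a b))"
    by (simp add: H_sq1_eq D_sum D_mult1 sum.distrib)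
  also have "(\<Oplus>i a b. D i (H_up i a b) * H k a b) = (\<Oplus>a b. div_H a b * H k a b)"
    by (rule trans[OF index_sum_rotate3]) (simp add: div_H_def sum_distrib_right)
  finally show ?thesis
    using d_G_contract[of H_sq k, OF H_sq_sym, folded H_sq1_def] H_closed_contract[of k, symmetric]
    by (simp add: div_mixed_def d_H_norm algebra_simps)
qed

section \<open>The weighted codifferential of the flux\<close>

lemma D_H_up_contract:
  assumes [simp]: "\<And>a b. C a b \<in> S"
  shows "(\<Oplus>l. D l (\<Oplus>a b. H_up l a b * C a b)) = (\<Oplus>a b. div_H a b * C a b) + (\<Oplus>l a b. H_up l a b * \<partial> l (C a b))"
proof -
  have "(\<Oplus>l. D l (\<Oplus>a b. H_up l a b * C a b)) = (\<Oplus>i a b. D i (H_up i a b) * C a b) + (\<Oplus>i a b. H_up i a b * \<partial> i (C a b))"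
    by (simp add: D_sum D_mult1 sum.distrib)
  also have "(\<Oplus>i a b. D i (H_up i a b) * C a b) = (\<Oplus>a b. div_H a b * C a b)"
    by (rule trans[OF index_sum_rotate3]) (simp add: div_H_def sum_distrib_right)
  finally show ?thesis .
qed

definition cov_H :: "'n \<Rightarrow> 'n \<Rightarrow> 'n \<Rightarrow> 'n \<Rightarrow> 'r" where
  "cov_H l i j k = \<partial> l (H i j k)
    - (\<Oplus>m. \<Gamma> m l i * H m j k + \<Gamma> m l j * H i m k + \<Gamma> m l k * H i j m)"

definition codiff :: "'n \<Rightarrow> 'n \<Rightarrow> 'r" where
  "codiff j k = - (\<Oplus>i l. G i l * cov_H l i j k)"

definition contract_X_H :: "'n \<Rightarrow> 'n \<Rightarrow> 'r" where
  "contract_X_H j k = (\<Oplus>i. X i * H i j k)"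

definition B :: "'n \<Rightarrow> 'n \<Rightarrow> 'r" where "B a b = codiff a b + contract_X_H a b"

lemma S_B [simp]: "codiff a b \<in> S" "contract_X_H a b \<in> S" "B a b \<in> S"
  by (simp_all add: codiff_def cov_H_def contract_X_H_def B_def)

lemma \<Gamma>_H_up: "(\<Oplus>i m. \<Gamma> a i m * H_up i m b) = 0"
proof (rule torsion_free)
  have "(\<Oplus>i m. \<Gamma> a i m * H_up i m b) = (\<Oplus>i m. \<Gamma> a i m * H_up m i b)"
    by (subst index_sum_swap2) (simp add: \<Gamma>_sym)
  also have "\<dots> = (\<Oplus>i m. - (\<Gamma> a i m * H_up i m b))"
    by (intro sum.cong refl) (subst H_up_swap12, simp)
  finally show "(\<Oplus>i m. \<Gamma> a i m * H_up i m b) + (\<Oplus>i m. \<Gamma> a i m * H_up i m b) = 0"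
    by (simp add: sum_negf eq_neg_iff_add_eq_0)
qed

text \<open>On an antisymmetric contravariant tensor the Christoffel corrections vanish by
  \<open>\<Gamma>_H_up\<close>, so the plain divergence by \<open>D\<close> is already covariant.
  The weight in \<open>D\<close> accounts for the contraction of H with the gradient of F.\<close>

lemma div_H_eq: "div_H a b = - (\<Oplus>c e. G a c * G b e * B c e)"
proof -
  \<comment> \<open>Only the index on which the divergence acts is raised here; the metric factors
    for a and b are then differentiated separately.\<close>
  define V where "V i q r = (\<Oplus>p. G i p * H p q r)" for i q r
  have [simp]: "V i q r \<in> S" for i q r
    by (simp add: V_def)
  have H_up_V: "H_up i a b = (\<Oplus>q r. G a q * G b r * V i q r)" for i a b
    unfolding H_up_def V_def
    by (rule trans[OF index_sum_rotate3]) (simp add: sum_distrib_left ac_simps)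
  have DV: "(\<Oplus>i. D i (V i c e))
      = (\<Oplus>i l. G i l * \<partial> l (H i c e)) - (\<Oplus>i l m. G i l * \<Gamma> m l i * H m c e) - contract_X_H c e" for c e
  proof -
    have "(\<Oplus>i. D i (V i c e)) = (\<Oplus>i p. D i (G i p) * H p c e) + (\<Oplus>i p. G i p * \<partial> i (H p c e))"
      by (simp add: V_def D_sum D_mult1 sum.distrib)
    also have "(\<Oplus>i p. D i (G i p) * H p c e) = (\<Oplus>p. (\<Oplus>i. D i (G i p)) * H p c e)"
      by (subst index_sum_swap2) (simp add: sum_distrib_right)
    also have "\<dots> = - (\<Oplus>p i l. G i l * \<Gamma> p l i * H p c e) - contract_X_H c e"
      by (simp add: D_G contract_X_H_def left_diff_distrib sum_subtractf sum_distrib_right sum_negf \<Gamma>_sym)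
    also have "(\<Oplus>p i l. G i l * \<Gamma> p l i * H p c e) = (\<Oplus>i l p. G i l * \<Gamma> p l i * H p c e)"
      by (rule index_sum_rotate3)
    also have "(\<Oplus>i p. G i p * \<partial> i (H p c e)) = (\<Oplus>i l. G i l * \<partial> l (H i c e))"
      by (subst index_sum_swap2) (simp add: G_sym)
    finally show ?thesis
      by (simp add: algebra_simps)
  qed
  have negB: "- B c e = (\<Oplus>i. D i (V i c e)) - (\<Oplus>l m. \<Gamma> m l c * V l m e) - (\<Oplus>l m. \<Gamma> m l e * V l c m)" for c e
  proof -
    have "- B c e = (\<Oplus>i. D i (V i c e))
      - (\<Oplus>i l m. G i l * \<Gamma> m l c * H i m e) - (\<Oplus>i l m. G i l * \<Gamma> m l e * H i c m)"
      unfolding DV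
      by (simp add: B_def codiff_def cov_H_def right_diff_distrib distrib_left sum.distrib
          sum_subtractf sum_distrib_left mult.assoc)
    also have "(\<Oplus>i l m. G i l * \<Gamma> m l c * H i m e) = (\<Oplus>l m. \<Gamma> m l c * V l m e)"
      unfolding V_def
      by (rule trans[OF index_sum_rotate3]) (simp add: sum_distrib_left ac_simps G_sym)
    also have "(\<Oplus>i l m. G i l * \<Gamma> m l e * H i c m) = (\<Oplus>l m. \<Gamma> m l e * V l c m)"
      unfolding V_def
      by (rule trans[OF index_sum_rotate3]) (simp add: sum_distrib_left ac_simps G_sym)
    finally show ?thesis .
  qed
  have "div_H a b = (\<Oplus>i q r. \<partial> i (G a q) * G b r * V i q r) + (\<Oplus>i q r. G a q * \<partial> i (G b r) * V i q r)
      + (\<Oplus>i q r. G a q * G b r * D i (V i q r))"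
    unfolding div_H_def H_up_V
    by (simp add: D_sum D_mult2 distrib_right sum.distrib)
  also have "(\<Oplus>i q r. \<partial> i (G a q) * G b r * V i q r)
      = - (\<Oplus>i q r m. G a m * \<Gamma> q i m * G b r * V i q r) - (\<Oplus>i q r m. G q m * \<Gamma> a i m * G b r * V i q r)"
    by (simp add: d_G sum.distrib sum_negf sum_subtractf sum_distrib_left algebra_simps)
  also have "(\<Oplus>i q r. G a q * \<partial> i (G b r) * V i q r)
      = - (\<Oplus>i q r m. G a q * G b m * \<Gamma> r i m * V i q r) - (\<Oplus>i q r m. G a q * G r m * \<Gamma> b i m * V i q r)"
    by (simp add: d_G sum.distrib sum_negf sum_subtractf sum_distrib_left algebra_simps)
  also have "(\<Oplus>i q r m. G q m * \<Gamma> a i m * G b r * V i q r) = (\<Oplus>i m. \<Gamma> a i m * H_up i m b)"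
    unfolding H_up_V
    by (rule sum.cong[OF refl], rule trans[OF index_sum_rotate3[symmetric]])
      (simp add: sum_distrib_left ac_simps G_sym)
  also have "\<dots> = 0"
    by (rule \<Gamma>_H_up)
  also have "(\<Oplus>i q r m. G a q * G r m * \<Gamma> b i m * V i q r) = (\<Oplus>i m. \<Gamma> b i m * H_up i a m)"
    unfolding H_up_V
    by (rule sum.cong[OF refl], rule trans[OF index_sum_rotate3[symmetric]])
      (simp add: sum_distrib_left ac_simps G_sym)
  also have "\<dots> = (\<Oplus>i m. - (\<Gamma> b i m * H_up i m a))"
    by (intro sum.cong refl) (subst H_up_swap23, simp)
  also have "\<dots> = 0"
    by (simp add: \<Gamma>_H_up sum_negf)
  also have "(\<Oplus>i q r m. G a m * \<Gamma> q i m * G b r * V i q r) = (\<Oplus>c e l m. G a c * G b e * (\<Gamma> m l c * V l m e))"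
    by (rule trans[OF index_sum_4312]) (simp add: ac_simps)
  also have "(\<Oplus>i q r m. G a q * G b m * \<Gamma> r i m * V i q r) = (\<Oplus>c e l m. G a c * G b e * (\<Gamma> m l e * V l c m))"
    by (rule trans[OF index_sum_2413]) (simp add: ac_simps)
  also have "(\<Oplus>i q r. G a q * G b r * D i (V i q r)) = (\<Oplus>c e i. G a c * G b e * D i (V i c e))"
    by (rule index_sum_rotate3)
  finally have "div_H a b = (\<Oplus>c e. G a c * G b e * - B c e)"
    unfolding negB by (simp add: right_diff_distrib sum_subtractf sum_distrib_left)
  then show ?thesis
    by (simp add: sum_negf)
qed

lemma raise_div_H: "(\<Oplus>k. G l k * (\<Oplus>a b. div_H a b * H k a b)) = - (\<Oplus>a b. H_up l a b * B a b)"
proof -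
  have "(\<Oplus>k. G l k * (\<Oplus>a b. div_H a b * H k a b))
      = - (\<Oplus>k a b c e. G l k * (G a c * (G b e * (B c e * H k a b))))"
    by (simp add: div_H_eq sum_distrib_left sum_distrib_right sum_negf mult.assoc)
  also have "(\<Oplus>k a b c e. G l k * (G a c * (G b e * (B c e * H k a b)))) = (\<Oplus>a b. H_up l a b * B a b)"
    by (rule trans[OF index_sum_rotate2_5])
      (simp add: H_up_def sum_distrib_left sum_distrib_right ac_simps G_sym)
  finally show ?thesis .
qed

lemma divdiv_H_sq: "6 * divdiv (\<lambda>i j. \<Oplus>k. H_sq1 i k * G k j)
    = drift_lap H_norm - 6 * (\<Oplus>l. D l (\<Oplus>a b. H_up l a b * B a b))"
proof -
  have "(\<Oplus>k. G l k * (6 * div_mixed H_sq1 k)) = 6 * (\<Oplus>k. G l k * div_mixed H_sq1 k)" for l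
    by (simp add: sum_distrib_left ac_simps)
  then have "6 * (\<Oplus>k. G l k * div_mixed H_sq1 k)
      = 6 * (\<Oplus>k. G l k * (\<Oplus>a b. div_H a b * H k a b)) + (\<Oplus>k. G l k * \<partial> k H_norm)" for l
    unfolding div_mixed_H_sq1 by (simp add: distrib_left sum.distrib sum_distrib_left mult.left_commute)
  then have "6 * (\<Oplus>k. G l k * div_mixed H_sq1 k)
      = (\<Oplus>k. G l k * \<partial> k H_norm) - 6 * (\<Oplus>a b. H_up l a b * B a b)" for l
    by (simp add: raise_div_H)
  then have *: "D l (6 * (\<Oplus>k. G l k * div_mixed H_sq1 k))
      = D l (\<Oplus>k. G l k * \<partial> k H_norm) - 6 * D l (\<Oplus>a b. H_up l a b * B a b)" for l
    by (simp add: D_diff D_numeral)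
  have "6 * divdiv (\<lambda>i j. \<Oplus>k. H_sq1 i k * G k j) = (\<Oplus>l. D l (6 * (\<Oplus>k. G l k * div_mixed H_sq1 k)))"
    by (simp add: divdiv_raise D_numeral flip: sum_distrib_left)
  then show ?thesis
    unfolding * by (simp add: drift_lap_def sum_subtractf flip: sum_distrib_left)
qed

text \<open>H^{lab} (i_X H)_{ab} is H^2 applied to X, so the Leibniz rule
  \<open>div_contract_X\<close> applies; it yields the transport term of |H|^2.\<close>

lemma div_H_sq_X: "6 * (\<Oplus>l. D l (\<Oplus>a b. H_up l a b * contract_X_H a b))
    = 6 * (\<Oplus>a b. div_H a b * contract_X_H a b) + (\<Oplus>c. X c * \<partial> c H_norm) + 6 * (\<Oplus>l c. H_sq1 l c * hess1 c l)"
proof -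
  have *: "(\<Oplus>c. (\<Oplus>a b. Y a b * H c a b) * X c) = (\<Oplus>a b. Y a b * contract_X_H a b)" for Y
    unfolding contract_X_H_def sum_distrib_left sum_distrib_right
    by (rule trans[OF index_sum_rotate3]) (simp add: ac_simps)
  have "6 * (\<Oplus>l. D l (\<Oplus>a b. H_up l a b * contract_X_H a b)) = 6 * (\<Oplus>l. D l (\<Oplus>c. H_sq1 l c * X c))"
    unfolding H_sq1_eq * by simp
  also have "\<dots> = (\<Oplus>c. (6 * div_mixed H_sq1 c) * X c) + 6 * (\<Oplus>l c. H_sq1 l c * hess1 c l)"
    by (simp add: div_contract_X distrib_left sum_distrib_left mult.assoc)
  also have "(\<Oplus>c. (6 * div_mixed H_sq1 c) * X c) = 6 * (\<Oplus>c. (\<Oplus>a b. div_H a b * H c a b) * X c) + (\<Oplus>c. X c * \<partial> c H_norm)"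
    unfolding div_mixed_H_sq1 distrib_right sum.distrib mult.assoc sum_distrib_left[symmetric]
    by (simp add: mult.commute)
  finally show ?thesis
    unfolding * .
qed

lemma raise_contract:
  assumes "\<And>i j. U i j = U j i"
  shows "(\<Oplus>i j. (\<Oplus>k. T i k * G k j) * U i j) = (\<Oplus>l c. (\<Oplus>j. G l j * U j c) * T c l)"
proof -
  have "(\<Oplus>l c. (\<Oplus>j. G l j * U j c) * T c l) = (\<Oplus>l i j. T i l * G l j * U i j)"
    by (simp add: sum_distrib_left sum_distrib_right assms ac_simps)
  also have "\<dots> = (\<Oplus>i j l. T i l * G l j * U i j)"
    by (rule index_sum_rotate3)
  finally show ?thesis
    by (simp add: sum_distrib_right)
qed

section \<open>Evolution of the weighted scalar curvature along the flow\<close>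

lemma divdiv_combine:
  assumes [simp]: "\<And>i j. T i j \<in> S" "\<And>i j. U i j \<in> S" "\<And>i j. V i j \<in> S"
  shows "divdiv (\<lambda>i j. T i j + 4 * U i j - 4 * V i j) = divdiv T + 4 * divdiv U - 4 * divdiv V"
proof -
  have "div_up (\<lambda>i j. T i j + 4 * U i j - 4 * V i j) l = div_up T l + 4 * div_up U l - 4 * div_up V l" for l
    by (simp add: div_up_def D_add D_diff D_numeral sum.distrib sum_subtractf distrib_left
        distrib_right left_diff_distrib mult.assoc flip: sum_distrib_left)
  then show ?thesis
    by (simp add: divdiv_def D_add D_diff D_numeral sum.distrib sum_subtractf flip: sum_distrib_left)
qed

lemma divdiv_2:
  assumes [simp]: "\<And>i j. T i j \<in> S"
  shows "divdiv (\<lambda>i j. 2 * T i j) = 2 * divdiv T"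
proof -
  have "div_up (\<lambda>i j. 2 * T i j) l = 2 * div_up T l" for l
    by (simp add: div_up_def D_numeral distrib_left mult.assoc flip: sum_distrib_left)
  then show ?thesis
    by (simp add: divdiv_def D_numeral flip: sum_distrib_left)
qed

text \<open>\<open>G_flow\<close> is twice the flow of the inverse metric with Rc = ric - Hess F,
  and w is 12 v. The quadratic terms on the right are the expansion of 24 (2 |E|^2 + |B|^2/2) with E
  = ric - H^2/4.\<close>

lemma evolution:
  assumes G_flow: "\<And>i j. 2 * d None (G i j) = 4 * (\<Oplus>k. ric1 i k * G k j)
      - (\<Oplus>k. H_sq1 i k * G k j) - 4 * (\<Oplus>k. hess1 i k * G k j)"
    and H_flow: "\<And>i j k. d None (H i j k) = - (\<partial> i (codiff j k) + \<partial> j (codiff k i) + \<partial> k (codiff i j))"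
    and F_flow: "\<psi> None = - drift_lap F"
    and w: "w = 12 * scal - H_norm"
  shows "2 * d None w = - 2 * drift_lap w + 2 * (\<Oplus>c. X c * \<partial> c w)
    + 12 * (\<Oplus>a b. (\<Oplus>c e. G a c * G b e * B c e) * B a b)
    + 48 * (\<Oplus>i j. (\<Oplus>k. ric1 i k * G k j) * ric i j)
    - 24 * (\<Oplus>i j. (\<Oplus>k. ric1 i k * G k j) * H_sq i j)
    + 3 * (\<Oplus>i j. (\<Oplus>k. H_sq1 i k * G k j) * H_sq i j)"
proof -
  let ?Ric = "\<lambda>i j. \<Oplus>k. ric1 i k * G k j"
  let ?Hsq = "\<lambda>i j. \<Oplus>k. H_sq1 i k * G k j"
  let ?Hess = "\<lambda>i j. \<Oplus>k. hess1 i k * G k j"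
  have "2 * divdiv (\<lambda>i j. - d None (G i j)) = divdiv (\<lambda>i j. 2 * - d None (G i j))"
    by (rule divdiv_2[symmetric]) simp
  also have "(\<lambda>i j. 2 * - d None (G i j)) = (\<lambda>i j. ?Hsq i j + 4 * ?Hess i j - 4 * ?Ric i j)"
    by (intro ext) (simp only: mult_minus_right G_flow, simp)
  also have "divdiv \<dots> = divdiv ?Hsq + 4 * divdiv ?Hess - 4 * divdiv ?Ric"
    by (rule divdiv_combine) simp_all
  finally have e1: "2 * divdiv (\<lambda>i j. - d None (G i j)) = divdiv ?Hsq + 4 * divdiv ?Hess - 4 * divdiv ?Ric" .
  have e2: "2 * (\<Oplus>i j. d None (G i j) * U i j) = 4 * (\<Oplus>i j. ?Ric i j * U i j)
      - (\<Oplus>i j. ?Hsq i j * U i j) - 4 * (\<Oplus>i j. ?Hess i j * U i j)" for U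
  proof -
    have "2 * (\<Oplus>i j. d None (G i j) * U i j) = (\<Oplus>i j. 2 * d None (G i j) * U i j)"
      by (simp add: sum_distrib_left mult.assoc)
    then show ?thesis
      unfolding G_flow
      by (simp only: left_diff_distrib sum_subtractf mult.assoc flip: sum_distrib_left)
  qed
  \<comment> \<open>The three terms of the exterior derivative agree after rotating the indices, as
    \<open>H_up\<close> is invariant under cyclic permutations.\<close>
  have e3: "(\<Oplus>i a b. d None (H i a b) * H_up i a b) = - 3 * (\<Oplus>l a b. H_up l a b * \<partial> l (codiff a b))"
  proof -
    have "(\<Oplus>i a b. d None (H i a b) * H_up i a b) = - (\<Oplus>i a b. H_up i a b * \<partial> i (codiff a b))
        - (\<Oplus>i a b. H_up i a b * \<partial> a (codiff b i)) - (\<Oplus>i a b. H_up i a b * \<partial> b (codiff i a))"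
      unfolding H_flow by (simp add: algebra_simps sum.distrib sum_subtractf sum_negf)
    also have "(\<Oplus>i a b. H_up i a b * \<partial> a (codiff b i)) = (\<Oplus>a b i. H_up a b i * \<partial> a (codiff b i))"
      by (rule trans[OF index_sum_rotate3], intro sum.cong refl) (subst H_up_rotate, simp)
    also have "(\<Oplus>i a b. H_up i a b * \<partial> b (codiff i a)) = (\<Oplus>b i a. H_up b i a * \<partial> b (codiff i a))"
      by (rule trans[OF index_sum_rotate3[symmetric]], intro sum.cong refl)
        (subst H_up_rotate[symmetric], simp)
    finally show ?thesis
      by simp
  qed
  \<comment> \<open>B is split so that its codifferential part meets the evolution of H from
    \<open>e3\<close>, while the part with X is left to \<open>div_H_sq_X\<close>.\<close>
  have e4: "(\<Oplus>l. D l (\<Oplus>a b. H_up l a b * B a b)) = (\<Oplus>a b. div_H a b * codiff a b)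
      + (\<Oplus>l a b. H_up l a b * \<partial> l (codiff a b)) + (\<Oplus>l. D l (\<Oplus>a b. H_up l a b * contract_X_H a b))"
    by (simp add: B_def distrib_left sum.distrib D_add D_H_up_contract)
  have e5: "(\<Oplus>a b. (\<Oplus>c e. G a c * G b e * B c e) * B a b)
      = - (\<Oplus>a b. div_H a b * codiff a b) - (\<Oplus>a b. div_H a b * contract_X_H a b)"
  proof -
    have *: "(\<Oplus>c e. G a c * G b e * B c e) = - div_H a b" for a b
      by (simp add: div_H_eq)
    show ?thesis
      unfolding * by (simp add: B_def distrib_left sum.distrib sum_negf sum_subtractf)
  qed
  have e6: "(\<Oplus>i j. ?Hsq i j * ric i j) = (\<Oplus>i j. ?Ric i j * H_sq i j)"
  proof -
    have "(\<Oplus>i j. ?Hsq i j * ric i j) = (\<Oplus>l c. ric1 l c * H_sq1 c l)"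
      by (simp only: raise_contract[of ric, OF ric_sym] ric1_def)
    also have "\<dots> = (\<Oplus>l c. H_sq1 l c * ric1 c l)"
      by (subst index_sum_swap2) (simp add: mult.commute)
    also have "\<dots> = (\<Oplus>i j. ?Ric i j * H_sq i j)"
      by (simp only: raise_contract[of H_sq, OF H_sq_sym] H_sq1_def)
    finally show ?thesis .
  qed
  have e7: "(\<Oplus>i j. ?Hess i j * ric i j) = (\<Oplus>l c. ric1 l c * hess1 c l)"
    by (simp only: raise_contract[of ric, OF ric_sym] ric1_def)
  have e8: "(\<Oplus>i j. ?Hess i j * H_sq i j) = (\<Oplus>l c. H_sq1 l c * hess1 c l)"
    by (simp only: raise_contract[of H_sq, OF H_sq_sym] H_sq1_def)
  have e9: "d None w = 12 * d None scal - d None H_norm"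
    by (simp add: w)
  have e10: "drift_lap w = 12 * drift_lap scal - drift_lap H_norm"
  proof -
    have "(\<Oplus>m. G l m * \<partial> m w) = 12 * (\<Oplus>m. G l m * \<partial> m scal) - (\<Oplus>m. G l m * \<partial> m H_norm)" for l
      by (simp add: w right_diff_distrib sum_subtractf sum_distrib_left mult.left_commute)
    then show ?thesis
      by (simp add: drift_lap_def D_diff D_numeral sum_subtractf flip: sum_distrib_left)
  qed
  have e11: "(\<Oplus>c. X c * \<partial> c w) = 12 * (\<Oplus>c. X c * \<partial> c scal) - (\<Oplus>c. X c * \<partial> c H_norm)"
    by (simp add: w right_diff_distrib sum_subtractf sum_distrib_left mult.left_commute)
  have e12: "drift_lap (- drift_lap F) = - drift_lap (drift_lap F)"
    by (simp add: drift_lap_def[of "- drift_lap F"] drift_lap_def[of "drift_lap F"] D_uminus sum_negf)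
  let ?DB = "\<Oplus>l. D l (\<Oplus>a b. H_up l a b * B a b)"
  let ?ricN = "\<Oplus>l c. ric1 l c * hess1 c l" and ?PN = "\<Oplus>l c. H_sq1 l c * hess1 c l"
  let ?HC = "\<Oplus>l a b. H_up l a b * \<partial> l (codiff a b)"
  let ?RR = "\<Oplus>i j. ?Ric i j * ric i j" and ?RP = "\<Oplus>i j. ?Ric i j * H_sq i j"
    and ?PP = "\<Oplus>i j. ?Hsq i j * H_sq i j"
  let ?dc = "\<Oplus>a b. div_H a b * codiff a b" and ?dX = "\<Oplus>a b. div_H a b * contract_X_H a b"
  let ?Xs = "\<Oplus>c. X c * \<partial> c scal" and ?XQ = "\<Oplus>c. X c * \<partial> c H_norm"
  let ?LL = "drift_lap (drift_lap F)"
  have f1: "2 * (12 * divdiv (\<lambda>i j. - d None (G i j)))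
      = 2 * (drift_lap H_norm - 6 * ?DB) + 24 * (2 * ?LL + ?Xs + 2 * ?ricN) - 24 * drift_lap scal"
    by (rule collect_divdiv[OF e1 divdiv_H_sq divdiv_hess divdiv_ric])
  have f2: "2 * (12 * (\<Oplus>i j. d None (G i j) * ric i j)) = 48 * ?RR - 12 * ?RP - 48 * ?ricN"
    by (rule collect_ric[OF e2[of ric, unfolded e6 e7]])
  have f3: "2 * d None H_norm = 12 * ?RP - 3 * ?PP - 12 * ?PN - 12 * ?HC"
    unfolding d_H_norm e3 by (rule collect_norm[OF e2[of H_sq, unfolded e8]])
  have f4: "12 * ?DB = 12 * ?dc + 12 * ?HC + (12 * ?dX + 2 * ?XQ + 12 * ?PN)"
    unfolding e4 by (rule collect_flux[OF div_H_sq_X])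
  show ?thesis
    unfolding e5 e9 e10 e11
    by (rule collect_evolution[OF f1 f2 f3 f4 d_scal[of None, unfolded F_flow e12]])
qed

section \<open>Antisymmetry of B and the evolution written with norms\<close>

lemma B_swap: "B i j = - B j i"
proof -
  have dH: "\<partial> l (H i j k) = - \<partial> l (H i k j)" for i j k l
    by (subst H_swap23) simp
  have "cov_H l i j k = - cov_H l i k j" for i j k l
  proof -
    have *: "\<Gamma> m l i * H m j k + \<Gamma> m l j * H i m k + \<Gamma> m l k * H i j m
        = - (\<Gamma> m l i * H m k j + \<Gamma> m l k * H i m j + \<Gamma> m l j * H i k m)" for m
      unfolding H_swap23[of m j k] H_swap23[of i m k] H_swap23[of i j m] by simp
    then show ?thesis
      unfolding cov_H_def dH[of l i j k] * sum_negf by simp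
  qed
  then have "G i' l * cov_H l i' i j = - (G i' l * cov_H l i' j i)" for i' l
    by (metis mult_minus_right)
  then have "codiff i j = - (\<Oplus>i' l. - (G i' l * cov_H l i' j i))"
    unfolding codiff_def by (simp only:)
  moreover have "X l * H l i j = - (X l * H l j i)" for l
    by (subst H_swap23) simp
  then have "contract_X_H i j = (\<Oplus>l. - (X l * H l j i))"
    unfolding contract_X_H_def by (simp only:)
  ultimately show ?thesis
    by (simp add: B_def codiff_def contract_X_H_def sum_negf)
qed

text \<open>Transposing both arguments fixes T and changes the sign of B. This removes the cross
  terms from |Rc^{H,F}|^2.\<close>

lemma norm2_B:
  assumes "\<And>i j. T i j = T j i"
  shows "norm2 T B = 0"
proof (rule torsion_free)
  have "norm2 T B = norm2 (\<lambda>i j. T i j) (\<lambda>i j. - B i j)"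
    by (subst norm2_transpose, rule arg_cong2[of _ _ _ _ norm2]) (auto simp: fun_eq_iff intro: assms B_swap)
  then show "norm2 T B + norm2 T B = 0"
    by (simp add: norm2_def sum_negf)
qed

lemma H_norm_trace: "(\<Oplus>i j. G i j * H_sq i j) = H_norm"
  by (simp add: H_norm_def contract3_H_sq)

lemma evolution_norm2:
  assumes "\<And>i j. 2 * d None (G i j) = 4 * (\<Oplus>k. ric1 i k * G k j)
      - (\<Oplus>k. H_sq1 i k * G k j) - 4 * (\<Oplus>k. hess1 i k * G k j)"
    and "\<And>i j k. d None (H i j k) = - (\<partial> i (codiff j k) + \<partial> j (codiff k i) + \<partial> k (codiff i j))"
    and "\<psi> None = - drift_lap F"
    and "w = 12 * scal - H_norm"
  shows "2 * d None w = - 2 * drift_lap w + 2 * grad_inner w F + 12 * norm2 B B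
    + 48 * norm2 ric ric - 24 * norm2 ric H_sq + 3 * norm2 H_sq H_sq"
  using evolution[OF assms]
  unfolding ric1_def H_sq1_def norm2_raise1 norm2_raise2 X_eq_grad_inner .

end

section \<open>The Levi-Civita connection\<close>

text \<open>\<Gamma> and \<psi> are fixed by their defining equations multiplied by 2. The
  derivative of log(det g) is written as the trace of g^{-1} dg, so no logarithm occurs.\<close>

locale metric_ring = differential_ring S d
  for S :: "'r::comm_ring_1 set" and d :: "'n::finite option \<Rightarrow> 'r \<Rightarrow> 'r" +
  fixes g G :: "'n \<Rightarrow> 'n \<Rightarrow> 'r" and \<Gamma> :: "'n \<Rightarrow> 'n \<Rightarrow> 'n \<Rightarrow> 'r" and F :: 'r
    and \<psi> :: "'n option \<Rightarrow> 'r"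
  assumes S_g [simp]: "g i j \<in> S" and S_G [simp]: "G i j \<in> S" and S_\<Gamma> [simp]: "\<Gamma> l i j \<in> S"
    and S_F [simp]: "F \<in> S" and S_\<psi> [simp]: "\<psi> p \<in> S"
    and g_sym: "g i j = g j i" and G_sym: "G i j = G j i" and \<Gamma>_sym: "\<Gamma> l i j = \<Gamma> l j i"
    and G_g: "(\<Oplus>j. G i j * g j k) = (if i = k then 1 else 0)"
    and \<Gamma>_lower: "2 * (\<Oplus>m. g k m * \<Gamma> m i j)
      = d (Some i) (g j k) + d (Some j) (g i k) - d (Some k) (g i j)"
    and \<psi>_eq: "2 * \<psi> p = 2 * d p F - (\<Oplus>a b. G a b * d p (g a b))"
    and torsion_free: "(a::'r) + a = 0 \<Longrightarrow> a = 0"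
begin

lemma cancel_2: "(2 * a = 2 * b) = ((a::'r) = b)"
proof
  assume "2 * a = 2 * b"
  then have "(a - b) + (a - b) = 0"
    by (simp add: algebra_simps)
  then show "a = b"
    using torsion_free[of "a - b"] by simp
qed simp

lemma index_sum_delta: "(\<Oplus>j. (if i = j then 1 else 0) * f j) = (f i :: 'r)"
  by (simp add: if_distrib[of "\<lambda>x. x * _"] cong: if_cong)

lemma raise_lower: "(\<Oplus>a. G i a * (\<Oplus>m. g a m * f m)) = f i"
proof -
  have "(\<Oplus>a. G i a * (\<Oplus>m. g a m * f m)) = (\<Oplus>m. (\<Oplus>a. G i a * g a m) * f m)"
    unfolding sum_distrib_left sum_distrib_right by (subst index_sum_swap2) (simp add: mult.assoc)
  then show ?thesis
    by (simp add: G_g index_sum_delta)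
qed

lemma d_inverse: "d l (G i j) = - (\<Oplus>a b. G i a * d l (g a b) * G b j)"
proof -
  \<comment> \<open>A diagonal entry of the product of G and g is 1, so 1 is smooth; its derivative
    vanishes by the product rule for 1 times 1.\<close>
  have "(1::'r) \<in> S"
    using S_sum[of UNIV "\<lambda>j. G i j * g j i"] by (simp add: G_g)
  then have "d l (1::'r) = 0"
    using d_mult[of 1 1 l] by simp
  have "d l (\<Oplus>m. G i m * g m b) = 0" for b
    unfolding G_g using \<open>d l 1 = 0\<close> by simp
  then have *: "(\<Oplus>m. d l (G i m) * g m b) = - (\<Oplus>m. G i m * d l (g m b))" for b
    by (simp add: sum.distrib eq_neg_iff_add_eq_0)
  have "d l (G i j) = (\<Oplus>b. G j b * (\<Oplus>m. g b m * d l (G i m)))"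
    by (rule raise_lower[symmetric])
  also have "\<dots> = (\<Oplus>b. G j b * (\<Oplus>m. d l (G i m) * g m b))"
    by (simp add: g_sym mult.commute)
  also have "\<dots> = - (\<Oplus>b m. G i m * d l (g m b) * G b j)"
    unfolding * by (simp add: sum_negf sum_distrib_left ac_simps G_sym)
  finally show ?thesis
    by (subst index_sum_swap2)
qed

lemma d_metric: "d (Some l) (g a b) = (\<Oplus>m. g a m * \<Gamma> m l b) + (\<Oplus>m. g b m * \<Gamma> m l a)"
proof -
  have "2 * d (Some l) (g a b) = 2 * ((\<Oplus>m. g a m * \<Gamma> m l b) + (\<Oplus>m. g b m * \<Gamma> m l a))"
    unfolding distrib_left[of 2] \<Gamma>_lower by (simp add: g_sym)
  then show ?thesis
    by (simp only: cancel_2)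
qed

lemma d_inverse_metric: "d (Some l) (G i j) = - (\<Oplus>m. G i m * \<Gamma> j l m + G j m * \<Gamma> i l m)"
proof -
  have "(\<Oplus>a b. G i a * (\<Oplus>m. g a m * \<Gamma> m l b) * G b j) = (\<Oplus>b. (\<Oplus>a. G i a * (\<Oplus>m. g a m * \<Gamma> m l b)) * G b j)"
    by (subst index_sum_swap2) (simp add: sum_distrib_right)
  also have "\<dots> = (\<Oplus>m. G j m * \<Gamma> i l m)"
    unfolding raise_lower by (simp add: G_sym mult.commute)
  finally have 1: "(\<Oplus>a b. G i a * (\<Oplus>m. g a m * \<Gamma> m l b) * G b j) = (\<Oplus>m. G j m * \<Gamma> i l m)" .
  have *: "(\<Oplus>a b. G i a * Z a b * G b j) = (\<Oplus>a. G i a * (\<Oplus>b. G j b * Z a b))" for Z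
    by (simp add: sum_distrib_left G_sym ac_simps)
  have "(\<Oplus>a b. G i a * (\<Oplus>m. g b m * \<Gamma> m l a) * G b j) = (\<Oplus>a. G i a * (\<Oplus>b. G j b * (\<Oplus>m. g b m * \<Gamma> m l a)))"
    by (rule *)
  also have "\<dots> = (\<Oplus>m. G i m * \<Gamma> j l m)"
    by (simp add: raise_lower)
  finally have 2: "(\<Oplus>a b. G i a * (\<Oplus>m. g b m * \<Gamma> m l a) * G b j) = (\<Oplus>m. G i m * \<Gamma> j l m)" .
  show ?thesis
    unfolding d_inverse d_metric distrib_left distrib_right sum.distrib 1 2 by (simp add: add.commute)
qed

lemma trace_metric: "(\<Oplus>a b. G a b * d (Some l) (g a b)) = 2 * (\<Oplus>m. \<Gamma> m m l)"
proof -
  have "(\<Oplus>a b. G a b * (\<Oplus>m. g a m * \<Gamma> m l b)) = (\<Oplus>b. \<Gamma> b l b)"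
    by (subst index_sum_swap2) (simp add: raise_lower G_sym)
  moreover have "(\<Oplus>a b. G a b * (\<Oplus>m. g b m * \<Gamma> m l a)) = (\<Oplus>a. \<Gamma> a l a)"
    by (simp add: raise_lower)
  ultimately show ?thesis
    by (simp add: d_metric distrib_left sum.distrib \<Gamma>_sym)
qed

text \<open>Both sides are minus the trace of g^{-1} (d_k g) g^{-1} (d_l g), which is symmetric in k
  and l. This makes \<psi> a closed form on spacetime, the content of the axiom
  \<open>d_\<theta>\<close>.\<close>

lemma d_trace_commute: "(\<Oplus>a b. d k (G a b) * d l (g a b)) = (\<Oplus>a b. d l (G a b) * d k (g a b))"
proof -
  have "(\<Oplus>a b. d k (G a b) * d l (g a b)) = - (\<Oplus>a b a' b'. G a a' * d k (g a' b') * G b' b * d l (g a b))"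
    for k l
    by (simp add: d_inverse sum_distrib_right sum_negf)
  moreover have "(\<Oplus>a b a' b'. G a a' * d k (g a' b') * G b' b * d l (g a b))
      = (\<Oplus>a b a' b'. G a a' * d l (g a' b') * G b' b * d k (g a b))"
    by (rule trans[OF index_sum_3412]) (simp add: ac_simps G_sym)
  ultimately show ?thesis
    by simp
qed

lemma weighted_metric:
  "weighted_metric S d G \<Gamma> F (\<lambda>l. (\<Oplus>m. \<Gamma> m m l) - d (Some l) F) \<psi>"
proof
  fix k l
  have "2 * \<psi> (Some l) = 2 * - ((\<Oplus>m. \<Gamma> m m l) - d (Some l) F)"
    unfolding \<psi>_eq trace_metric by (simp add: algebra_simps)
  then show "\<psi> (Some l) = - ((\<Oplus>m. \<Gamma> m m l) - d (Some l) F)"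
    by (simp only: cancel_2)
  have "2 * d (Some l) (\<psi> k) = d (Some l) (2 * \<psi> k)"
    by simp
  also have "\<dots> = 2 * d k (d (Some l) F)
      - ((\<Oplus>a b. d (Some l) (G a b) * d k (g a b)) + (\<Oplus>a b. G a b * d k (d (Some l) (g a b))))"
    unfolding \<psi>_eq by (simp add: d_commute[of _ k "Some l"] sum.distrib)
  also have "\<dots> = d k (2 * d (Some l) F - (\<Oplus>a b. G a b * d (Some l) (g a b)))"
    by (simp add: d_trace_commute[of "Some l"] sum.distrib)
  also have "\<dots> = 2 * - d k ((\<Oplus>m. \<Gamma> m m l) - d (Some l) F)"
    unfolding trace_metric by (simp add: algebra_simps)
  finally show "d k ((\<Oplus>m. \<Gamma> m m l) - d (Some l) F) = - d (Some l) (\<psi> k)"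
    unfolding cancel_2 by simp
qed (simp_all add: G_sym \<Gamma>_sym d_inverse_metric)

end

section \<open>Smooth functions\<close>

lemma frechet_derivative_cong:
  assumes "\<And>y. y \<in> \<Omega> \<Longrightarrow> f y = g y" and "x \<in> \<Omega>"
  shows "frechet_derivative f (at x within \<Omega>) = frechet_derivative g (at x within \<Omega>)"
proof -
  have "(f has_derivative f') (at x within \<Omega>) \<longleftrightarrow> (g has_derivative f') (at x within \<Omega>)" for f'
    using assms has_derivative_transform[of x \<Omega> f g f'] has_derivative_transform[of x \<Omega> g f f'] by auto
  then show ?thesis
    by (simp add: frechet_derivative_def)
qed

lemma Ck_on_cong:
  assumes "\<And>x. x \<in> \<Omega> \<Longrightarrow> f x = g x" and "Ck_on k \<Omega> f"
  shows "Ck_on k \<Omega> g"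
  using assms
proof (induction k arbitrary: f g)
  case 0
  then show ?case using continuous_on_cong[of \<Omega> \<Omega> f g] by (metis Ck_on.simps(1))
next
  case (Suc k)
  have "g differentiable (at x within \<Omega>)" if "x \<in> \<Omega>" for x
  proof -
    have "f differentiable (at x within \<Omega>)"
      using Suc.prems(2) that by simp
    then obtain f' where "(f has_derivative f') (at x within \<Omega>)"
      by (auto simp: differentiable_def)
    then have "(g has_derivative f') (at x within \<Omega>)"
      by (rule has_derivative_transform[OF that, rotated]) (simp add: Suc.prems(1))
    then show ?thesis by (auto simp: differentiable_def)
  qed
  moreover have "Ck_on k \<Omega> (\<lambda>x. frechet_derivative g (at x within \<Omega>) v)" for v
  proof (rule Suc.IH)
    show "Ck_on k \<Omega> (\<lambda>x. frechet_derivative f (at x within \<Omega>) v)"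
      using Suc.prems(2) by simp
    show "frechet_derivative f (at x within \<Omega>) v = frechet_derivative g (at x within \<Omega>) v"
      if "x \<in> \<Omega>" for x
      using frechet_derivative_cong[of \<Omega> f g, OF Suc.prems(1) that] by (rule fun_cong)
  qed
  ultimately show ?case by simp
qed

lemma Ck_on_Suc_imp: "Ck_on (Suc k) \<Omega> f \<Longrightarrow> Ck_on k \<Omega> f"
proof (induction k arbitrary: f)
  case 0
  then show ?case
    by (simp add: continuous_on_eq_continuous_within differentiable_imp_continuous_within)
next
  case (Suc k)
  note prems = Suc.prems[unfolded Ck_on.simps(2)[of "Suc k"]]
  show ?case
    unfolding Ck_on.simps(2)
  proof (intro conjI allI)
    show "\<forall>x\<in>\<Omega>. f differentiable (at x within \<Omega>)"
      using prems by (rule conjunct1)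
    show "Ck_on k \<Omega> (\<lambda>x. frechet_derivative f (at x within \<Omega>) v)" for v
      by (rule Suc.IH) (rule prems[THEN conjunct2, THEN spec])
  qed
qed

text \<open>The condition under which derivatives within a set are unique: every point is approached
  along each axis, possibly from one side only.\<close>

locale derivative_domain =
  fixes \<Omega> :: "'a::euclidean_space set"
  assumes approachable:
    "\<And>x i e. x \<in> \<Omega> \<Longrightarrow> i \<in> Basis \<Longrightarrow> 0 < e \<Longrightarrow> \<exists>\<delta>. 0 < \<bar>\<delta>\<bar> \<and> \<bar>\<delta>\<bar> < e \<and> x + \<delta> *\<^sub>R i \<in> \<Omega>"
begin

lemma frechet_eqI:
  assumes "(f has_derivative f') (at x within \<Omega>)" and "x \<in> \<Omega>"
  shows "frechet_derivative f (at x within \<Omega>) = f'"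
proof -
  have "(f has_derivative frechet_derivative f (at x within \<Omega>)) (at x within \<Omega>)"
    using assms(1) frechet_derivative_works differentiable_def by blast
  then show ?thesis
    using assms(1) by (rule frechet_derivative_unique_within) (rule approachable[OF assms(2)])
qed

text \<open>By uniqueness, any explicit family of derivatives may stand for
  \<open>frechet_derivative\<close>, so the usual derivative rules apply.\<close>

lemma Ck_on_SucI:
  assumes "\<And>x. x \<in> \<Omega> \<Longrightarrow> (f has_derivative f' x) (at x within \<Omega>)"
    and "\<And>v. Ck_on k \<Omega> (\<lambda>x. f' x v)"
  shows "Ck_on (Suc k) \<Omega> f"
proof -
  have "Ck_on k \<Omega> (\<lambda>x. frechet_derivative f (at x within \<Omega>) v)" for v
    using assms(2) by (rule Ck_on_cong[rotated]) (simp only: frechet_eqI[OF assms(1)])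
  moreover have "\<forall>x\<in>\<Omega>. f differentiable (at x within \<Omega>)"
    using assms(1) by (blast intro: differentiableI)
  ultimately show ?thesis
    unfolding Ck_on.simps(2) by (intro conjI allI)
qed

lemma Ck_on_SucD:
  assumes "Ck_on (Suc k) \<Omega> f"
  shows "x \<in> \<Omega> \<Longrightarrow> (f has_derivative frechet_derivative f (at x within \<Omega>)) (at x within \<Omega>)"
    and "Ck_on k \<Omega> (\<lambda>x. frechet_derivative f (at x within \<Omega>) v)"
    and "Ck_on k \<Omega> f"
proof -
  show "(f has_derivative frechet_derivative f (at x within \<Omega>)) (at x within \<Omega>)" if "x \<in> \<Omega>"
    unfolding frechet_derivative_works[symmetric] using assms that by simp
  show "Ck_on k \<Omega> (\<lambda>x. frechet_derivative f (at x within \<Omega>) v)"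
    using assms by simp
  show "Ck_on k \<Omega> f"
    using assms by (rule Ck_on_Suc_imp)
qed

section \<open>Closure of smooth functions under algebra, inverses, exponentials and
  determinants\<close>

lemma Ck_on_const: "Ck_on k \<Omega> (\<lambda>x. c)"
proof (induction k arbitrary: c)
  case (Suc k)
  show ?case by (rule Ck_on_SucI[where f' = "\<lambda>_ _. 0"], rule has_derivative_const, rule Suc)
qed simp

lemma Ck_on_add: "Ck_on k \<Omega> f \<Longrightarrow> Ck_on k \<Omega> g \<Longrightarrow> Ck_on k \<Omega> (\<lambda>x. f x + g x)"
proof (induction k arbitrary: f g)
  case (Suc k)
  note f' = Ck_on_SucD[OF Suc.prems(1)]
  note g' = Ck_on_SucD[OF Suc.prems(2)]
  show ?case
    by (rule Ck_on_SucI[OF has_derivative_add[OF f'(1) g'(1)]], assumption, assumption,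
        intro Suc.IH f' g')
qed (simp add: continuous_on_add)

lemma Ck_on_mult:
  fixes f g :: "'a \<Rightarrow> real"
  shows "Ck_on k \<Omega> f \<Longrightarrow> Ck_on k \<Omega> g \<Longrightarrow> Ck_on k \<Omega> (\<lambda>x. f x * g x)"
proof (induction k arbitrary: f g)
  case (Suc k)
  note f' = Ck_on_SucD[OF Suc.prems(1)]
  note g' = Ck_on_SucD[OF Suc.prems(2)]
  show ?case
    by (rule Ck_on_SucI[OF has_derivative_mult[OF f'(1) g'(1)]], assumption, assumption,
        intro Suc.IH Ck_on_add f' g')
qed (simp add: continuous_on_mult)

lemma Ck_on_inverse:
  fixes f :: "'a \<Rightarrow> real"
  assumes "\<And>x. x \<in> \<Omega> \<Longrightarrow> f x \<noteq> 0"
  shows "Ck_on k \<Omega> f \<Longrightarrow> Ck_on k \<Omega> (\<lambda>x. inverse (f x))"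
proof (induction k)
  case 0
  then show ?case using assms by (auto intro!: continuous_on_inverse)
next
  case (Suc k)
  note f' = Ck_on_SucD[OF Suc.prems(1)]
  have "Ck_on k \<Omega> (\<lambda>x. (-1) * (inverse (f x) * frechet_derivative f (at x within \<Omega>) v * inverse (f x)))" for v
    by (intro Ck_on_mult Ck_on_const Suc.IH[OF f'(3)] f'(2))
  then show ?case
    by (intro Ck_on_SucI[OF Deriv.has_derivative_inverse[OF assms f'(1)]]) simp_all
qed

lemma Ck_on_exp:
  fixes f :: "'a \<Rightarrow> real"
  shows "Ck_on k \<Omega> f \<Longrightarrow> Ck_on k \<Omega> (\<lambda>x. exp (f x))"
proof (induction k)
  case 0
  then show ?case by (auto intro!: continuous_on_exp)
next
  case (Suc k)
  note f' = Ck_on_SucD[OF Suc.prems(1)]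
  have "((\<lambda>x. exp (f x)) has_derivative (\<lambda>v. exp (f x) * frechet_derivative f (at x within \<Omega>) v)) (at x within \<Omega>)" if "x \<in> \<Omega>" for x
    using f'(1)[OF that] by (auto intro!: derivative_eq_intros)
  then show ?case
    by (rule Ck_on_SucI) (assumption, intro Ck_on_mult Suc.IH[OF f'(3)] f'(2))
qed

lemma smooth_on_const [simp]: "smooth_on \<Omega> (\<lambda>x. c)"
  by (simp add: smooth_on_def Ck_on_const)

lemma smooth_on_add: "smooth_on \<Omega> f \<Longrightarrow> smooth_on \<Omega> g \<Longrightarrow> smooth_on \<Omega> (\<lambda>x. f x + g x)"
  by (simp add: smooth_on_def Ck_on_add)

lemma smooth_on_mult:
  fixes f g :: "'a \<Rightarrow> real"
  shows "smooth_on \<Omega> f \<Longrightarrow> smooth_on \<Omega> g \<Longrightarrow> smooth_on \<Omega> (\<lambda>x. f x * g x)"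
  by (simp add: smooth_on_def Ck_on_mult)

lemma smooth_on_uminus:
  fixes f :: "'a \<Rightarrow> real"
  shows "smooth_on \<Omega> f \<Longrightarrow> smooth_on \<Omega> (\<lambda>x. - f x)"
  using smooth_on_mult[of "\<lambda>_. -1" f] by simp

lemma smooth_on_inverse:
  fixes f :: "'a \<Rightarrow> real"
  shows "smooth_on \<Omega> f \<Longrightarrow> (\<And>x. x \<in> \<Omega> \<Longrightarrow> f x \<noteq> 0) \<Longrightarrow> smooth_on \<Omega> (\<lambda>x. inverse (f x))"
  by (simp add: smooth_on_def Ck_on_inverse)

lemma smooth_on_exp:
  fixes f :: "'a \<Rightarrow> real"
  shows "smooth_on \<Omega> f \<Longrightarrow> smooth_on \<Omega> (\<lambda>x. exp (f x))"
  by (simp add: smooth_on_def Ck_on_exp)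

lemma smooth_on_sum:
  "(\<And>i. i \<in> A \<Longrightarrow> smooth_on \<Omega> (f i)) \<Longrightarrow> smooth_on \<Omega> (\<lambda>x. \<Sum>i\<in>A. f i x)"
  by (induction A rule: infinite_finite_induct) (auto intro: smooth_on_add)

lemma smooth_on_prod:
  fixes f :: "'i \<Rightarrow> 'a \<Rightarrow> real"
  shows "(\<And>i. i \<in> A \<Longrightarrow> smooth_on \<Omega> (f i)) \<Longrightarrow> smooth_on \<Omega> (\<lambda>x. \<Prod>i\<in>A. f i x)"
  by (induction A rule: infinite_finite_induct) (auto intro: smooth_on_mult)

lemma smooth_on_det:
  fixes f :: "'n::finite \<Rightarrow> 'n \<Rightarrow> 'a \<Rightarrow> real"
  assumes "\<And>i j. smooth_on \<Omega> (f i j)"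
  shows "smooth_on \<Omega> (\<lambda>x. det (\<chi> i j. f i j x))"
  unfolding det_def by (auto intro!: smooth_on_sum smooth_on_mult smooth_on_prod assms)

lemma smooth_on_cong: "smooth_on \<Omega> f \<Longrightarrow> (\<And>x. x \<in> \<Omega> \<Longrightarrow> f x = g x) \<Longrightarrow> smooth_on \<Omega> g"
  unfolding smooth_on_def using Ck_on_cong by blast

lemma smooth_on_frechet: "smooth_on \<Omega> f \<Longrightarrow> smooth_on \<Omega> (\<lambda>x. frechet_derivative f (at x within \<Omega>) v)"
  unfolding smooth_on_def using Ck_on.simps(2) by blast

lemma smooth_on_has_derivative:
  assumes "smooth_on \<Omega> f" and "x \<in> \<Omega>"
  shows "(f has_derivative frechet_derivative f (at x within \<Omega>)) (at x within \<Omega>)"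
  using assms frechet_derivative_works by (metis Ck_on.simps(2) smooth_on_def)

lemma smooth_on_continuous: "smooth_on \<Omega> f \<Longrightarrow> continuous_on \<Omega> f"
  unfolding smooth_on_def using Ck_on.simps(1) by blast

section \<open>Symmetry of second derivatives up to the boundary\<close>

lemma line_derivative:
  fixes f :: "'a \<Rightarrow> real"
  assumes "smooth_on \<Omega> f" and "\<And>s. s \<in> {0..h} \<Longrightarrow> p + s *\<^sub>R v \<in> \<Omega>" and "t \<in> {0..h}"
  shows "((\<lambda>s. f (p + s *\<^sub>R v)) has_derivative
    (\<lambda>s. s * frechet_derivative f (at (p + t *\<^sub>R v) within \<Omega>) v)) (at t within {0..h})"
proof -
  let ?f' = "frechet_derivative f (at (p + t *\<^sub>R v) within \<Omega>)"
  have f': "(f has_derivative ?f') (at (p + t *\<^sub>R v) within \<Omega>)"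
    using assms by (intro smooth_on_has_derivative) auto
  have "((\<lambda>s. f (p + s *\<^sub>R v)) has_derivative (\<lambda>s. ?f' (s *\<^sub>R v))) (at t within {0..h})"
    by (rule has_derivative_in_compose[where f = "\<lambda>s. p + s *\<^sub>R v" and f' = "\<lambda>s. s *\<^sub>R v"])
      (auto intro!: derivative_eq_intros has_derivative_subset[OF f'] assms(2))
  moreover have "?f' (s *\<^sub>R v) = s * ?f' v" for s
    using has_derivative_linear[OF f'] by (simp add: linear_cmul)
  ultimately show ?thesis by simp
qed

text \<open>
  The rectangle may lie to one side of \<open>x\<close>, so the symmetry of second derivatives also
  holds at the endpoints of a time interval.
\<close>

lemma mixed_difference:
  fixes f :: "'a \<Rightarrow> real"
  assumes "smooth_on \<Omega> f" and "0 < h"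
    and rect: "\<And>a b. a \<in> {0..h} \<Longrightarrow> b \<in> {0..h} \<Longrightarrow> x + a *\<^sub>R v + b *\<^sub>R w \<in> \<Omega>"
  shows "\<exists>a\<in>{0..h}. \<exists>b\<in>{0..h}. f (x + h *\<^sub>R v + h *\<^sub>R w) - f (x + h *\<^sub>R v) - f (x + h *\<^sub>R w) + f x
    = h * h * frechet_derivative (\<lambda>y. frechet_derivative f (at y within \<Omega>) v)
        (at (x + a *\<^sub>R v + b *\<^sub>R w) within \<Omega>) w"
proof -
  let ?fv = "\<lambda>y. frechet_derivative f (at y within \<Omega>) v"
  let ?\<phi> = "\<lambda>a. f (x + h *\<^sub>R w + a *\<^sub>R v) - f (x + a *\<^sub>R v)"
  have r1: "x + h *\<^sub>R w + a *\<^sub>R v \<in> \<Omega>" and r2: "x + a *\<^sub>R v \<in> \<Omega>" if "a \<in> {0..h}" for a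
    using rect[OF that, of h] rect[OF that, of 0] \<open>0 < h\<close> by (simp_all add: ac_simps)
  have "(?\<phi> has_derivative (\<lambda>s. s * ?fv (x + h *\<^sub>R w + a *\<^sub>R v) - s * ?fv (x + a *\<^sub>R v))) (at a within {0..h})"
    if "0 \<le> a" "a \<le> h" for a
    using that by (intro has_derivative_diff line_derivative assms r1 r2) auto
  from mvt_simple[OF \<open>0 < h\<close> this] obtain a where a: "a \<in> {0<..<h}"
    and eq1: "?\<phi> h - ?\<phi> 0 = h * ?fv (x + h *\<^sub>R w + a *\<^sub>R v) - h * ?fv (x + a *\<^sub>R v)"
    by auto
  have "((\<lambda>b. ?fv (x + a *\<^sub>R v + b *\<^sub>R w)) has_derivative
      (\<lambda>s. s * frechet_derivative ?fv (at (x + a *\<^sub>R v + b *\<^sub>R w) within \<Omega>) w)) (at b within {0..h})"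
    if "0 \<le> b" "b \<le> h" for b
    using that a by (intro line_derivative smooth_on_frechet assms rect) auto
  from mvt_simple[OF \<open>0 < h\<close> this] obtain b where b: "b \<in> {0<..<h}"
    and eq2: "?fv (x + a *\<^sub>R v + h *\<^sub>R w) - ?fv (x + a *\<^sub>R v)
      = h * frechet_derivative ?fv (at (x + a *\<^sub>R v + b *\<^sub>R w) within \<Omega>) w"
    by auto
  have "?\<phi> h - ?\<phi> 0 = h * (?fv (x + a *\<^sub>R v + h *\<^sub>R w) - ?fv (x + a *\<^sub>R v))"
    unfolding eq1 by (simp add: algebra_simps)
  then have "f (x + h *\<^sub>R v + h *\<^sub>R w) - f (x + h *\<^sub>R v) - f (x + h *\<^sub>R w) + f x
      = h * h * frechet_derivative ?fv (at (x + a *\<^sub>R v + b *\<^sub>R w) within \<Omega>) w"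
    unfolding eq2 by (simp add: algebra_simps)
  then show ?thesis
    using a b by (intro bexI[of _ a] bexI[of _ b]) auto
qed

text \<open>The mean value theorem evaluates the second difference over a parallelogram in both
  orders, at two points of it. Shrinking it to its corner x, continuity of the second derivatives
  gives equality at x.\<close>

lemma frechet_commute:
  fixes f :: "'a \<Rightarrow> real"
  assumes f: "smooth_on \<Omega> f" and "0 < h" and "x \<in> \<Omega>"
    and rect: "\<And>a b. a \<in> {0..h} \<Longrightarrow> b \<in> {0..h} \<Longrightarrow> x + a *\<^sub>R v + b *\<^sub>R w \<in> \<Omega>"
  shows "frechet_derivative (\<lambda>y. frechet_derivative f (at y within \<Omega>) v) (at x within \<Omega>) w
    = frechet_derivative (\<lambda>y. frechet_derivative f (at y within \<Omega>) w) (at x within \<Omega>) v"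
proof -
  let ?vw = "\<lambda>x. frechet_derivative (\<lambda>y. frechet_derivative f (at y within \<Omega>) v) (at x within \<Omega>) w"
  let ?wv = "\<lambda>x. frechet_derivative (\<lambda>y. frechet_derivative f (at y within \<Omega>) w) (at x within \<Omega>) v"
  define \<epsilon> where "\<epsilon> = (\<lambda>n. h / real (Suc n))"
  have \<epsilon>: "0 < \<epsilon> n" "\<epsilon> n \<le> h" for n
    using \<open>0 < h\<close> by (auto simp: \<epsilon>_def divide_le_eq)
  have \<epsilon>0: "\<epsilon> \<longlonglongrightarrow> 0"
    unfolding \<epsilon>_def by (rule LIMSEQ_Suc[OF lim_const_over_n[of h]])
  have "\<exists>a b a' b'. a \<in> {0..\<epsilon> n} \<and> b \<in> {0..\<epsilon> n} \<and> a' \<in> {0..\<epsilon> n} \<and> b' \<in> {0..\<epsilon> n} \<and>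
      ?vw (x + a *\<^sub>R v + b *\<^sub>R w) = ?wv (x + b' *\<^sub>R v + a' *\<^sub>R w)" for n
  proof -
    have r: "x + a *\<^sub>R v + b *\<^sub>R w \<in> \<Omega>" "x + b *\<^sub>R w + a *\<^sub>R v \<in> \<Omega>"
      if "a \<in> {0..\<epsilon> n}" "b \<in> {0..\<epsilon> n}" for a b
      using rect[of a b] that \<epsilon>[of n] by (auto simp: ac_simps)
    obtain a b where ab: "a \<in> {0..\<epsilon> n}" "b \<in> {0..\<epsilon> n}"
      "f (x + \<epsilon> n *\<^sub>R v + \<epsilon> n *\<^sub>R w) - f (x + \<epsilon> n *\<^sub>R v) - f (x + \<epsilon> n *\<^sub>R w) + f x
        = \<epsilon> n * \<epsilon> n * ?vw (x + a *\<^sub>R v + b *\<^sub>R w)"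
      using mixed_difference[OF f \<epsilon>(1)[of n], of x v w] r(1) by blast
    obtain a' b' where ab': "a' \<in> {0..\<epsilon> n}" "b' \<in> {0..\<epsilon> n}"
      "f (x + \<epsilon> n *\<^sub>R w + \<epsilon> n *\<^sub>R v) - f (x + \<epsilon> n *\<^sub>R w) - f (x + \<epsilon> n *\<^sub>R v) + f x
        = \<epsilon> n * \<epsilon> n * ?wv (x + a' *\<^sub>R w + b' *\<^sub>R v)"
      using mixed_difference[OF f \<epsilon>(1)[of n], of x w v] r(2) by blast
    have "x + \<epsilon> n *\<^sub>R w + \<epsilon> n *\<^sub>R v = x + \<epsilon> n *\<^sub>R v + \<epsilon> n *\<^sub>R w"
      by simp
    then have "\<epsilon> n * \<epsilon> n * ?vw (x + a *\<^sub>R v + b *\<^sub>R w) = \<epsilon> n * \<epsilon> n * ?wv (x + a' *\<^sub>R w + b' *\<^sub>R v)"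
      using ab(3) ab'(3) by (simp only:)
    then have "?vw (x + a *\<^sub>R v + b *\<^sub>R w) = ?wv (x + a' *\<^sub>R w + b' *\<^sub>R v)"
      using \<epsilon>(1)[of n] by simp
    moreover have "x + a' *\<^sub>R w + b' *\<^sub>R v = x + b' *\<^sub>R v + a' *\<^sub>R w"
      by simp
    ultimately show ?thesis
      using ab ab' by metis
  qed
  then obtain a b a' b' where r: "\<And>n. a n \<in> {0..\<epsilon> n}" "\<And>n. b n \<in> {0..\<epsilon> n}" "\<And>n. a' n \<in> {0..\<epsilon> n}" "\<And>n. b' n \<in> {0..\<epsilon> n}"
    and eq: "\<And>n. ?vw (x + a n *\<^sub>R v + b n *\<^sub>R w) = ?wv (x + b' n *\<^sub>R v + a' n *\<^sub>R w)"
    by metis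
  have z: "s \<longlonglongrightarrow> 0" if "\<And>n. s n \<in> {0..\<epsilon> n}" for s :: "nat \<Rightarrow> real"
    using that by (intro tendsto_sandwich[OF _ _ tendsto_const \<epsilon>0]) auto
  have lim: "(\<lambda>n. x + s n *\<^sub>R v + s' n *\<^sub>R w) \<longlonglongrightarrow> x" if "s \<longlonglongrightarrow> 0" "s' \<longlonglongrightarrow> 0" for s s'
  proof -
    have "(\<lambda>n. x + s n *\<^sub>R v + s' n *\<^sub>R w) \<longlonglongrightarrow> x + 0 *\<^sub>R v + 0 *\<^sub>R w"
      by (intro tendsto_intros that)
    then show ?thesis by simp
  qed
  have mem: "x + s *\<^sub>R v + s' *\<^sub>R w \<in> \<Omega>" if "s \<in> {0..\<epsilon> n}" "s' \<in> {0..\<epsilon> n}" for s s' n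
    using rect[of s s'] that \<epsilon>[of n] by auto
  have "continuous_on \<Omega> ?vw" "continuous_on \<Omega> ?wv"
    by (intro smooth_on_continuous smooth_on_frechet f)+
  then have "(\<lambda>n. ?vw (x + a n *\<^sub>R v + b n *\<^sub>R w)) \<longlonglongrightarrow> ?vw x"
    and "(\<lambda>n. ?wv (x + b' n *\<^sub>R v + a' n *\<^sub>R w)) \<longlonglongrightarrow> ?wv x"
    using \<open>x \<in> \<Omega>\<close> by (auto intro!: continuous_on_tendsto_compose[where s = \<Omega>] lim z r mem always_eventually)
  then show ?thesis
    unfolding eq by (rule LIMSEQ_unique)
qed

end

section \<open>Segments in an interval and in an open set\<close>

lemma interval_direction:
  fixes I :: "real set"
  assumes "is_interval I" and "interior I \<noteq> {}" and "t \<in> I"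
  obtains s h where "s = 1 \<or> s = -1" and "0 < h" and "\<And>a. a \<in> {0..h} \<Longrightarrow> t + a * s \<in> I"
proof -
  obtain c e where "0 < e" and ball: "ball c e \<subseteq> I"
    using assms(2) mem_interior by blast
  then have "c \<in> I" and "c + e / 2 \<in> I"
    by (auto simp: subset_eq dist_real_def)
  \<comment> \<open>Of the two distinct points c and c + e/2 at least one differs from t.\<close>
  then obtain u where u: "u \<in> I" "u \<noteq> t"
    using \<open>0 < e\<close> by (metis add_cancel_left_right divide_eq_0_iff less_irrefl zero_neq_numeral)
  show thesis
  proof (rule that[of "sgn (u - t)" "\<bar>u - t\<bar>"])
    show "t + a * sgn (u - t) \<in> I" if "a \<in> {0..\<bar>u - t\<bar>}" for a
    proof (cases "t < u")
      case True
      then show ?thesis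
        using that mem_is_interval_1_I[OF assms(1) \<open>t \<in> I\<close> \<open>u \<in> I\<close>, of "t + a"] by simp
    next
      case False
      then show ?thesis
        using that u mem_is_interval_1_I[OF assms(1) \<open>u \<in> I\<close> \<open>t \<in> I\<close>, of "t - a"] by (simp add: sgn_if)
    qed
  qed (use u in \<open>auto simp: sgn_if\<close>)
qed

lemma open_direction:
  fixes V :: "'a::real_normed_vector set"
  assumes "open V" and "y \<in> V"
  obtains h where "0 < h" and "\<And>a. a \<in> {0..h} \<Longrightarrow> y + a *\<^sub>R v \<in> V"
    and "\<And>a b. a \<in> {0..h} \<Longrightarrow> b \<in> {0..h} \<Longrightarrow> y + a *\<^sub>R v + b *\<^sub>R w \<in> V"
proof -
  obtain e where e: "0 < e" "ball y e \<subseteq> V"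
    using assms openE by blast
  define c where "c = norm v + norm w"
  \<comment> \<open>Chosen so that h (norm v + norm w) < e; the added 1 keeps the denominator
    positive when v and w both vanish.\<close>
  define h where "h = e * (1 / (2 * (c + 1)))"
  have "0 \<le> c"
    by (simp add: c_def)
  then have "c * (1 / (2 * (c + 1))) < 1"
    by (simp add: divide_less_eq)
  then have "e * (c * (1 / (2 * (c + 1)))) < e * 1"
    using e(1) by (intro mult_strict_left_mono)
  then have h: "0 < h" "h * (norm v + norm w) < e"
    using e(1) \<open>0 \<le> c\<close> by (simp_all add: h_def c_def[symmetric] mult.commute)
  have 2: "y + a *\<^sub>R v + b *\<^sub>R w \<in> V" if "a \<in> {0..h}" "b \<in> {0..h}" for a b
  proof -
    have "norm (a *\<^sub>R v + b *\<^sub>R w) \<le> a * norm v + b * norm w"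
      using norm_triangle_ineq[of "a *\<^sub>R v" "b *\<^sub>R w"] that by simp
    also have "\<dots> \<le> h * norm v + h * norm w"
      using that by (intro add_mono mult_right_mono) auto
    also have "\<dots> < e"
      using h(2) by (simp add: distrib_left)
    finally have "dist y (y + (a *\<^sub>R v + b *\<^sub>R w)) < e"
      unfolding dist_commute[of y] by (simp add: dist_norm)
    then show ?thesis
      using e(2) by (auto simp: subset_eq add.assoc)
  qed
  show thesis
    using 2[of _ 0] h(1) by (intro that[OF h(1) _ 2]) auto
qed

lemma derivative_domain_open:
  fixes V :: "'a::euclidean_space set"
  assumes "open V"
  shows "derivative_domain V"
proof
  fix x i :: 'a and e :: real
  assume *: "x \<in> V" "0 < e"
  obtain h where "0 < h" and h: "\<And>a. a \<in> {0..h} \<Longrightarrow> x + a *\<^sub>R i \<in> V"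
    using open_direction[OF assms *(1)] by metis
  then show "\<exists>\<delta>. 0 < \<bar>\<delta>\<bar> \<and> \<bar>\<delta>\<bar> < e \<and> x + \<delta> *\<^sub>R i \<in> V"
    using *(2) h[of "min h (e / 2)"] by (intro exI[of _ "min h (e / 2)"]) auto
qed

locale spacetime =
  fixes I :: "real set" and V :: "(real ^ 'n::finite) set"
  assumes interval: "is_interval I" and nondegenerate: "interior I \<noteq> {}" and open_V: "open V"
begin

sublocale space: derivative_domain V
  by (rule derivative_domain_open[OF open_V])

sublocale derivative_domain "I \<times> V"
proof
  fix x i :: "real \<times> (real ^ 'n)" and e :: real
  assume x: "x \<in> I \<times> V" and i: "i \<in> Basis" and e: "0 < e"
  obtain t y where ty: "x = (t, y)" "t \<in> I" "y \<in> V"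
    using x by auto
  consider "i = (1, 0)" | j where "j \<in> Basis" "i = (0, j)"
    using i by (auto simp: Basis_prod_def)
  then show "\<exists>\<delta>. 0 < \<bar>\<delta>\<bar> \<and> \<bar>\<delta>\<bar> < e \<and> x + \<delta> *\<^sub>R i \<in> I \<times> V"
  proof cases
    case 1
    obtain s h where s: "s = 1 \<or> s = -1" "0 < h" and h: "\<And>a. a \<in> {0..h} \<Longrightarrow> t + a * s \<in> I"
      using interval_direction[OF interval nondegenerate \<open>t \<in> I\<close>] by metis
    show ?thesis
      using s e h[of "min h (e / 2)"] ty 1
      by (intro exI[of _ "min h (e / 2) * s"]) (auto simp: abs_mult)
  next
    case 2
    then show ?thesis
      using space.approachable[OF \<open>y \<in> V\<close> 2(1) e] ty by auto
  qed
qed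

text \<open>Turns a time-independent field, namely the background three-form, into one on
  spacetime.\<close>

lemma smooth_on_snd:
  fixes f :: "real ^ 'n \<Rightarrow> real"
  assumes "smooth_on V f"
  shows "smooth_on (I \<times> V) (\<lambda>x. f (snd x))"
proof -
  have "Ck_on k V f \<Longrightarrow> Ck_on k (I \<times> V) (\<lambda>x. f (snd x))" for k and f :: "real ^ 'n \<Rightarrow> real"
  proof (induction k arbitrary: f)
    case 0
    then show ?case
      by (auto intro!: continuous_on_compose2[of V f] continuous_intros)
  next
    case (Suc k)
    note f' = space.Ck_on_SucD[OF Suc.prems]
    have "((\<lambda>x. f (snd x)) has_derivative (\<lambda>v. frechet_derivative f (at (snd x) within V) (snd v)))
        (at x within I \<times> V)" if "x \<in> I \<times> V" for x
      by (rule has_derivative_in_compose[OF has_derivative_snd[OF has_derivative_ident]],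
          rule has_derivative_subset[OF f'(1)]) (use that in auto)
    then show ?case
      by (rule Ck_on_SucI) (assumption, rule Suc.IH[OF f'(2)])
  qed
  then show ?thesis
    using assms by (simp add: smooth_on_def)
qed

section \<open>The differential ring of functions on spacetime\<close>

definition dir :: "'n option \<Rightarrow> real \<times> (real ^ 'n)" where
  "dir k = (case k of None \<Rightarrow> (1, 0) | Some i \<Rightarrow> (0, axis i 1))"

text \<open>With the value 0 off I \<times> V, the product rule and the commutation of derivatives
  become equations between functions on the whole type.\<close>

definition dd :: "'n option \<Rightarrow> (real \<times> (real ^ 'n) \<Rightarrow> real) \<Rightarrow> real \<times> (real ^ 'n) \<Rightarrow> real" where
  "dd k f x = (if x \<in> I \<times> V then frechet_derivative f (at x within I \<times> V) (dir k) else 0)"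

lemma dd_eqI: "(f has_derivative f') (at x within I \<times> V) \<Longrightarrow> x \<in> I \<times> V \<Longrightarrow> dd k f x = f' (dir k)"
  by (simp add: dd_def frechet_eqI)

lemma dd_cong: "(\<And>x. x \<in> I \<times> V \<Longrightarrow> f x = g x) \<Longrightarrow> dd k f = dd k g"
  using frechet_derivative_cong[of "I \<times> V" f g] by (intro ext) (simp add: dd_def)

lemma smooth_on_dd: "smooth_on (I \<times> V) f \<Longrightarrow> smooth_on (I \<times> V) (dd k f)"
  by (rule smooth_on_cong[OF smooth_on_frechet[of f "dir k"]]) (auto simp: dd_def)

lemma frechet_scaleR:
  fixes f :: "real \<times> (real ^ 'n) \<Rightarrow> real"
  assumes "smooth_on (I \<times> V) f" "x \<in> I \<times> V"
  shows "frechet_derivative f (at x within I \<times> V) (s *\<^sub>R v) = s * frechet_derivative f (at x within I \<times> V) v"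
  using has_derivative_linear[OF smooth_on_has_derivative[OF assms]] by (simp add: linear_cmul)

text \<open>At an endpoint of I only one time direction is available. Symmetry is applied along s
  times the direction, and the factor s cancels by linearity.\<close>

lemma frechet_commute_sign:
  fixes f :: "real \<times> (real ^ 'n) \<Rightarrow> real"
  assumes f: "smooth_on (I \<times> V) f" and "0 < h" and x: "x \<in> I \<times> V" and "s \<noteq> 0"
    and rect: "\<And>a b. a \<in> {0..h} \<Longrightarrow> b \<in> {0..h} \<Longrightarrow> x + a *\<^sub>R s *\<^sub>R dir k + b *\<^sub>R dir l \<in> I \<times> V"
  shows "dd k (dd l f) x = dd l (dd k f) x"
proof -
  let ?f' = "\<lambda>v x. frechet_derivative f (at x within I \<times> V) v"
  have smooth: "smooth_on (I \<times> V) (?f' v)" for v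
    by (rule smooth_on_frechet[OF f])
  have "frechet_derivative (?f' (s *\<^sub>R dir k)) (at x within I \<times> V) (dir l)
      = frechet_derivative (?f' (dir l)) (at x within I \<times> V) (s *\<^sub>R dir k)"
    by (rule frechet_commute[OF f \<open>0 < h\<close> x rect])
  also have "\<dots> = s * frechet_derivative (?f' (dir l)) (at x within I \<times> V) (dir k)"
    by (rule frechet_scaleR[OF smooth x])
  also have "frechet_derivative (?f' (s *\<^sub>R dir k)) (at x within I \<times> V)
      = frechet_derivative (\<lambda>x. s * ?f' (dir k) x) (at x within I \<times> V)"
    by (rule frechet_derivative_cong[OF frechet_scaleR[OF f] x])
  also have "\<dots> = (\<lambda>v. s * frechet_derivative (?f' (dir k)) (at x within I \<times> V) v)"
    by (rule frechet_eqI[OF has_derivative_mult_right[OF smooth_on_has_derivative[OF smooth x]] x])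
  finally have *: "frechet_derivative (?f' (dir k)) (at x within I \<times> V) (dir l)
      = frechet_derivative (?f' (dir l)) (at x within I \<times> V) (dir k)"
    using \<open>s \<noteq> 0\<close> by simp
  have "dd j f z = ?f' (dir j) z" if "z \<in> I \<times> V" for j z
    using that by (simp add: dd_def)
  then have "frechet_derivative (dd j f) (at x within I \<times> V) = frechet_derivative (?f' (dir j)) (at x within I \<times> V)" for j
    by (rule frechet_derivative_cong[OF _ x])
  then show ?thesis
    using x * by (simp add: dd_def[of _ "dd _ f"])
qed

lemma dd_commute_None:
  assumes f: "smooth_on (I \<times> V) f" and x: "x \<in> I \<times> V"
  shows "dd None (dd (Some j) f) x = dd (Some j) (dd None f) x"
proof -
  obtain t y where ty: "x = (t, y)" "t \<in> I" "y \<in> V"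
    using x by auto
  obtain s h where s: "s = 1 \<or> s = -1" "0 < h" and h: "\<And>a. a \<in> {0..h} \<Longrightarrow> t + a * s \<in> I"
    using interval_direction[OF interval nondegenerate \<open>t \<in> I\<close>] by metis
  obtain h' where "0 < h'" and h': "\<And>a. a \<in> {0..h'} \<Longrightarrow> y + a *\<^sub>R axis j 1 \<in> V"
    using open_direction[OF open_V \<open>y \<in> V\<close>] by metis
  have "s \<noteq> 0"
    using s(1) by auto
  then show ?thesis
    using s h h' \<open>0 < h'\<close> ty
    by (intro frechet_commute_sign[OF f, of "min h h'" x s]) (auto simp: dir_def)
qed

lemma dd_commute_Some:
  assumes f: "smooth_on (I \<times> V) f" and x: "x \<in> I \<times> V"
  shows "dd (Some i) (dd (Some j) f) x = dd (Some j) (dd (Some i) f) x"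
proof -
  obtain t y where ty: "x = (t, y)" "t \<in> I" "y \<in> V"
    using x by auto
  obtain h where "0 < h" and h: "\<And>a b. a \<in> {0..h} \<Longrightarrow> b \<in> {0..h} \<Longrightarrow> y + a *\<^sub>R axis i 1 + b *\<^sub>R axis j 1 \<in> V"
    using open_direction[OF open_V \<open>y \<in> V\<close>] by metis
  then show ?thesis
    using ty by (intro frechet_commute_sign[OF f, of h x 1]) (auto simp: dir_def)
qed

lemma dd_commute:
  assumes f: "smooth_on (I \<times> V) f"
  shows "dd k (dd l f) = dd l (dd k f)"
proof
  fix x
  show "dd k (dd l f) x = dd l (dd k f) x"
  proof (cases "x \<in> I \<times> V")
    case True
    then show ?thesis
      using dd_commute_None[OF f True] dd_commute_Some[OF f True]
      by (cases k; cases l) auto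
  qed (simp add: dd_def)
qed

sublocale differential_ring "{f. smooth_on (I \<times> V) f}" dd
proof
  fix f g :: "real \<times> (real ^ 'n) \<Rightarrow> real" and k
  show "0 \<in> {f. smooth_on (I \<times> V) f}"
    by (simp add: zero_fun_def)
  assume f: "f \<in> {f. smooth_on (I \<times> V) f}"
  show "- f \<in> {f. smooth_on (I \<times> V) f}"
    using f by (simp add: fun_Compl_def smooth_on_uminus)
  show "dd k f \<in> {f. smooth_on (I \<times> V) f}"
    using f by (simp add: smooth_on_dd)
  show "dd k (dd l f) = dd l (dd k f)" for l
    using f by (simp add: dd_commute)
  assume g: "g \<in> {f. smooth_on (I \<times> V) f}"
  show "f + g \<in> {f. smooth_on (I \<times> V) f}"
    using f g by (simp add: plus_fun_def smooth_on_add)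
  show "f * g \<in> {f. smooth_on (I \<times> V) f}"
    using f g by (simp add: times_fun_def smooth_on_mult)
  have f': "(f has_derivative frechet_derivative f (at x within I \<times> V)) (at x within I \<times> V)"
    and g': "(g has_derivative frechet_derivative g (at x within I \<times> V)) (at x within I \<times> V)"
    if "x \<in> I \<times> V" for x
    using f g that by (auto intro!: smooth_on_has_derivative)
  show "dd k (f + g) = dd k f + dd k g"
  proof
    fix x
    show "dd k (f + g) x = (dd k f + dd k g) x"
      using dd_eqI[OF has_derivative_add[OF f' g'], of x k]
      by (cases "x \<in> I \<times> V") (auto simp: plus_fun_def dd_def)
  qed
  show "dd k (f * g) = dd k f * g + f * dd k g"
  proof
    fix x
    show "dd k (f * g) x = (dd k f * g + f * dd k g) x"
      using dd_eqI[OF has_derivative_mult[OF f' g'], of x k]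
      by (cases "x \<in> I \<times> V") (auto simp: plus_fun_def times_fun_def dd_def)
  qed
qed

end

section \<open>The flow in a chart\<close>

lemma sum_fun_apply: "(sum f A) x = (\<Sum>i\<in>A. f i x)"
  by (induction A rule: infinite_finite_induct) auto

lemmas fun_ring_apply = plus_fun_apply times_fun_apply minus_apply uminus_apply zero_fun_apply
  sum_fun_apply numeral_fun_apply

lemma matrix_inv:
  fixes A :: "real ^ 'n ^ 'n"
  assumes "det A \<noteq> 0"
  shows matrix_inv_right: "A ** matrix_inv A = mat 1" and matrix_inv_left: "matrix_inv A ** A = mat 1"
proof -
  have "\<exists>A'. A ** A' = mat 1 \<and> A' ** A = mat 1"
    using assms by (simp add: invertible_det_nz[symmetric] invertible_def)
  then have "A ** matrix_inv A = mat 1 \<and> matrix_inv A ** A = mat 1"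
    unfolding matrix_inv_def by (rule someI_ex)
  then show "A ** matrix_inv A = mat 1" "matrix_inv A ** A = mat 1"
    by auto
qed

text \<open>Writes the entries as quotients of determinants, from which smoothness of the inverse
  metric follows.\<close>

lemma matrix_inv_cramer:
  fixes A :: "real ^ 'n ^ 'n"
  assumes "det A \<noteq> 0"
  shows "matrix_inv A $ i $ j
    = det (\<chi> i' j'. if j' = i then axis j 1 $ i' else A $ i' $ j') / det A"
proof -
  have "A ** matrix_inv A = mat 1"
    by (rule matrix_inv_right[OF assms])
  then have "A *v (matrix_inv A *v axis j 1) = axis j 1"
    by (simp add: matrix_vector_mul_assoc)
  then have "matrix_inv A *v axis j 1
      = (\<chi> k. det (\<chi> i' j'. if j' = k then axis j 1 $ i' else A $ i' $ j') / det A)"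
    using cramer[OF assms] by blast
  then have "(matrix_inv A *v axis j 1) $ i
      = det (\<chi> i' j'. if j' = i then axis j 1 $ i' else A $ i' $ j') / det A"
    by simp
  moreover have "(matrix_inv A *v axis j 1) $ i = matrix_inv A $ i $ j"
    by (simp add: matrix_vector_mult_basis column_def)
  ultimately show ?thesis by simp
qed

lemma positive_definite_det:
  fixes A :: "real ^ 'n ^ 'n"
  assumes "\<And>v :: real ^ 'n. v \<noteq> 0 \<Longrightarrow> (\<Sum>i\<in>UNIV. \<Sum>j\<in>UNIV. A $ i $ j * v $ i * v $ j) > 0"
  shows "det A \<noteq> 0"
proof -
  have "v = 0" if "A *v v = 0" for v
  proof (rule ccontr)
    assume "v \<noteq> 0"
    have "(\<Sum>i\<in>UNIV. \<Sum>j\<in>UNIV. A $ i $ j * v $ i * v $ j) = (\<Sum>i\<in>UNIV. v $ i * (A *v v) $ i)"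
      by (simp add: matrix_vector_mult_def sum_distrib_left ac_simps)
    then show False
      using assms[OF \<open>v \<noteq> 0\<close>] that by simp
  qed
  then have "invertible A"
    by (simp add: invertible_left_inverse matrix_left_invertible_ker)
  then show ?thesis
    by (simp add: invertible_det_nz)
qed

locale chart_spacetime = spacetime I V
  for I :: "real set" and V :: "(real ^ 'n::finite) set" +
  fixes c :: "('m, 'n) chart"
  assumes coord_para: "y \<in> V \<Longrightarrow> coord c (para c y) = y"
begin

text \<open>\<open>pd\<close> differentiates at fixed time in an open coordinate domain,
  \<open>dd\<close> within I \<times> V; on the slice at t both give the spatial part of the
  derivative of K.\<close>

lemma pd_eq_dd:
  assumes K: "smooth_on (I \<times> V) K" and h: "\<And>z. z \<in> V \<Longrightarrow> h (para c z) = K (t, z)"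
    and "t \<in> I" "y \<in> V"
  shows "pd c i h (para c y) = dd (Some i) K (t, y)"
proof -
  let ?K' = "frechet_derivative K (at (t, y) within I \<times> V)"
  have K': "(K has_derivative ?K') (at (t, y) within I \<times> V)"
    using assms by (intro smooth_on_has_derivative) auto
  have "((\<lambda>z. K (t, z)) has_derivative (\<lambda>v. ?K' (0, v))) (at y within V)"
    by (rule has_derivative_in_compose[where f = "\<lambda>z. (t, z)" and f' = "\<lambda>v. (0, v)"])
      (auto intro!: derivative_eq_intros has_derivative_subset[OF K'] simp: \<open>t \<in> I\<close>)
  then have "((\<lambda>z. h (para c z)) has_derivative (\<lambda>v. ?K' (0, v))) (at y within V)"
    by (rule has_derivative_transform[OF \<open>y \<in> V\<close>, rotated]) (simp add: h)
  then have "((\<lambda>z. h (para c z)) has_derivative (\<lambda>v. ?K' (0, v))) (at y)"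
    using at_within_open[OF \<open>y \<in> V\<close> open_V] by simp
  then have "frechet_derivative (\<lambda>z. h (para c z)) (at y) = (\<lambda>v. ?K' (0, v))"
    by (rule frechet_derivative_at[symmetric])
  then show ?thesis
    using \<open>t \<in> I\<close> \<open>y \<in> V\<close> by (simp add: pd_def coord_para dd_def dir_def)
qed

lemma vector_derivative_eq_dd:
  assumes K: "smooth_on (I \<times> V) K" and h: "\<And>s. s \<in> I \<Longrightarrow> h s = K (s, y)"
    and "t \<in> I" "y \<in> V"
  shows "vector_derivative h (at t within I) = dd None K (t, y)"
proof -
  let ?K' = "frechet_derivative K (at (t, y) within I \<times> V)"
  have K': "(K has_derivative ?K') (at (t, y) within I \<times> V)"
    using assms by (intro smooth_on_has_derivative) auto
  have "((\<lambda>s. K (s, y)) has_derivative (\<lambda>s. ?K' (s, 0))) (at t within I)"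
    by (rule has_derivative_in_compose[where f = "\<lambda>s. (s, y)" and f' = "\<lambda>s. (s, 0)"])
      (auto intro!: derivative_eq_intros has_derivative_subset[OF K'] simp: \<open>y \<in> V\<close>)
  then have "(h has_derivative (\<lambda>s. ?K' (s, 0))) (at t within I)"
    by (rule has_derivative_transform[OF \<open>t \<in> I\<close>, rotated]) (simp add: h)
  moreover have "(\<lambda>s. ?K' (s, 0)) = (\<lambda>s. s *\<^sub>R ?K' (1, 0))"
  proof
    show "?K' (s, 0) = s *\<^sub>R ?K' (1, 0)" for s
      using has_derivative_linear[OF K'] linear_scale[of ?K' s "(1, 0)"] by simp
  qed
  ultimately have "(h has_vector_derivative ?K' (1, 0)) (at t within I)"
    unfolding has_vector_derivative_def by (simp only:)
  \<comment> \<open>The one-sided derivative is unique because I contains a segment starting at t,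
    so t is a limit point of I.\<close>
  moreover have "at t within I \<noteq> bot"
  proof -
    obtain s e where "s = 1 \<or> s = -1" "0 < e" "\<And>a. a \<in> {0..e} \<Longrightarrow> t + a * s \<in> I"
      using interval_direction[OF interval nondegenerate \<open>t \<in> I\<close>] by metis
    then have "\<exists>x\<in>I. x \<noteq> t \<and> dist x t < \<delta>" if "0 < \<delta>" for \<delta>
      using that by (intro bexI[of _ "t + min e (\<delta> / 2) * s"]) (auto simp: dist_real_def)
    then show ?thesis
      unfolding trivial_limit_within by (auto simp: islimpt_approachable)
  qed
  ultimately have "vector_derivative h (at t within I) = ?K' (1, 0)"
    by (intro vector_derivative_within)
  then show ?thesis
    using \<open>t \<in> I\<close> \<open>y \<in> V\<close> by (simp add: dd_def dir_def)
qed

end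

locale chart_potential = chart_spacetime I V c
  for I :: "real set" and V :: "(real ^ 'n::finite) set" and c :: "('m, 'n) chart" +
  fixes H :: "real \<Rightarrow> ('m, 'n) tensor3" and H0 :: "('m, 'n) tensor3" and b :: "real \<Rightarrow> ('m, 'n) tensor2"
  assumes b_smooth: "smooth_on (I \<times> V) (\<lambda>(t, y). b t c (para c y) i j)"
    and b_swap: "t \<in> I \<Longrightarrow> y \<in> V \<Longrightarrow> b t c (para c y) i j = - b t c (para c y) j i"
    and H0_smooth: "smooth_on V (\<lambda>y. H0 c (para c y) i j k)"
    and H0_swap12: "y \<in> V \<Longrightarrow> H0 c (para c y) i j k = - H0 c (para c y) j i k"
    and H0_swap23: "y \<in> V \<Longrightarrow> H0 c (para c y) i j k = - H0 c (para c y) i k j"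
    and H0_closed: "y \<in> V \<Longrightarrow> pd c i (\<lambda>q. H0 c q j k l) (para c y) - pd c j (\<lambda>q. H0 c q i k l) (para c y)
        + pd c k (\<lambda>q. H0 c q i j l) (para c y) - pd c l (\<lambda>q. H0 c q i j k) (para c y) = 0"
    and H_eq: "t \<in> I \<Longrightarrow> y \<in> V \<Longrightarrow>
      H t c (para c y) i j k = H0 c (para c y) i j k + ext_d2 (b t) c (para c y) i j k"
begin

section \<open>The three-form built from its background and its potential\<close>

definition b_loc :: "'n \<Rightarrow> 'n \<Rightarrow> real \<times> (real ^ 'n) \<Rightarrow> real" where
  "b_loc i j x = b (fst x) c (para c (snd x)) i j"

definition H0_loc :: "'n \<Rightarrow> 'n \<Rightarrow> 'n \<Rightarrow> real \<times> (real ^ 'n) \<Rightarrow> real" where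
  "H0_loc i j k x = H0 c (para c (snd x)) i j k"

text \<open>H_0 + db formed in the differential ring, where its closedness and time derivative can
  be computed.\<close>

definition H_pot :: "'n \<Rightarrow> 'n \<Rightarrow> 'n \<Rightarrow> real \<times> (real ^ 'n) \<Rightarrow> real" where
  "H_pot i j k = H0_loc i j k + (dd (Some i) (b_loc j k) + dd (Some j) (b_loc k i) + dd (Some k) (b_loc i j))"

lemma b_loc_S: "b_loc i j \<in> {f. smooth_on (I \<times> V) f}"
  using b_smooth[of i j] by (simp add: b_loc_def[abs_def] case_prod_beta')

lemma H0_loc_S: "H0_loc i j k \<in> {f. smooth_on (I \<times> V) f}"
  using smooth_on_snd[OF H0_smooth[of i j k]] by (simp add: H0_loc_def[abs_def])

lemma H_pot_S: "H_pot i j k \<in> {f. smooth_on (I \<times> V) f}"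
  unfolding H_pot_def by (intro S_add S_d b_loc_S H0_loc_S)

text \<open>b is antisymmetric on I \<times> V only, but \<open>dd\<close> sees no other values;
  hence an equation between functions.\<close>

lemma dd_b_loc_swap: "dd l (b_loc i j) = - dd l (b_loc j i)"
proof -
  have "b_loc i j x = (- b_loc j i) x" if "x \<in> I \<times> V" for x
    using that b_swap[of "fst x" "snd x" i j] by (auto simp: b_loc_def)
  then have "dd l (b_loc i j) = dd l (- b_loc j i)"
    by (rule dd_cong)
  then show ?thesis
    by (simp only: d_uminus[OF b_loc_S])
qed

lemma H_H_pot:
  assumes "t \<in> I" "y \<in> V"
  shows "H t c (para c y) i j k = H_pot i j k (t, y)"
proof -
  have "pd c l (\<lambda>q. b t c q i j) (para c y) = dd (Some l) (b_loc i j) (t, y)" for i j l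
    using assms b_loc_S by (intro pd_eq_dd) (auto simp: b_loc_def)
  then show ?thesis
    by (simp add: H_eq[OF assms] ext_d2_def H_pot_def H0_loc_def)
qed

lemma H_smooth: "smooth_on (I \<times> V) (\<lambda>(t, y). H t c (para c y) i j k)"
  using H_pot_S[of i j k] by (auto intro: smooth_on_cong[of "H_pot i j k"] simp: H_H_pot)

lemma H_swap12:
  assumes "t \<in> I" "y \<in> V"
  shows "H t c (para c y) i j k = - H t c (para c y) j i k"
  unfolding H_H_pot[OF assms] H_pot_def H0_loc_def plus_fun_apply snd_conv
    H0_swap12[OF assms(2), of i j k] dd_b_loc_swap[of _ k i] dd_b_loc_swap[of _ i j] dd_b_loc_swap[of _ j k]
  by simp

lemma H_swap23:
  assumes "t \<in> I" "y \<in> V"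
  shows "H t c (para c y) i j k = - H t c (para c y) i k j"
  unfolding H_H_pot[OF assms] H_pot_def H0_loc_def plus_fun_apply snd_conv
    H0_swap23[OF assms(2), of i j k] dd_b_loc_swap[of _ k i] dd_b_loc_swap[of _ i j] dd_b_loc_swap[of _ j k]
  by simp

text \<open>H_0 is closed, and the second derivatives of b cancel once the commuting derivatives and
  the antisymmetric index pairs are put in a fixed order.\<close>

lemma H_closed3:
  assumes ty: "t \<in> I" "y \<in> V"
  shows "pd c i (\<lambda>q. H t c q j k l) (para c y) - pd c j (\<lambda>q. H t c q i k l) (para c y)
    + pd c k (\<lambda>q. H t c q i j l) (para c y) - pd c l (\<lambda>q. H t c q i j k) (para c y) = 0"
proof -
  have H: "pd c l (\<lambda>q. H t c q i j k) (para c y) = dd (Some l) (H_pot i j k) (t, y)" for i j k l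
    using ty H_pot_S by (intro pd_eq_dd) (auto simp: H_H_pot)
  have H0: "dd (Some l) (H0_loc i j k) (t, y) = pd c l (\<lambda>q. H0 c q i j k) (para c y)" for i j k l
    using ty H0_loc_S by (intro pd_eq_dd[symmetric]) (auto simp: H0_loc_def)
  have dH: "dd (Some l) (H_pot i j k) = dd (Some l) (H0_loc i j k) + (dd (Some l) (dd (Some i) (b_loc j k))
      + dd (Some l) (dd (Some j) (b_loc k i)) + dd (Some l) (dd (Some k) (b_loc i j)))" for i j k l
    unfolding H_pot_def by (simp only: d_add S_add S_d b_loc_S H0_loc_S)
  have swap: "dd (Some l) (dd m (b_loc i j)) = - dd (Some l) (dd m (b_loc j i))" for i j l m
    unfolding dd_b_loc_swap[of m i j] by (simp only: d_uminus S_d b_loc_S)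
  have comm: "dd (Some i) (dd (Some j) (b_loc k l)) = dd (Some j) (dd (Some i) (b_loc k l))" for i j k l
    by (rule d_commute[OF b_loc_S])
  show ?thesis
    using H0_closed[OF ty(2), of i j k l]
    unfolding H dH plus_fun_apply H0
      comm[of j i] comm[of k i] comm[of k j] comm[of l i] comm[of l j] comm[of l k]
      swap[of _ _ l j] swap[of _ _ k i] swap[of _ _ l i]
    by simp
qed

end

locale chart_flow = chart_potential I V c H H0 b
  for I :: "real set" and V :: "(real ^ 'n::finite) set" and c :: "('m, 'n) chart"
    and H :: "real \<Rightarrow> ('m, 'n) tensor3" and H0 b +
  fixes g :: "real \<Rightarrow> ('m, 'n) tensor2" and F :: "real \<Rightarrow> 'm \<Rightarrow> real"
  assumes g_smooth: "smooth_on (I \<times> V) (\<lambda>(t, y). g t c (para c y) i j)"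
    and g_swap: "t \<in> I \<Longrightarrow> y \<in> V \<Longrightarrow> g t c (para c y) i j = g t c (para c y) j i"
    and g_pos: "t \<in> I \<Longrightarrow> y \<in> V \<Longrightarrow> v \<noteq> 0 \<Longrightarrow>
      (\<Sum>i\<in>UNIV. \<Sum>j\<in>UNIV. g t c (para c y) i j * v $ i * v $ j) > 0"
    and F_smooth: "smooth_on (I \<times> V) (\<lambda>(t, y). F t (para c y))"
begin

text \<open>
  The components are extended to all of spacetime, the metric by the identity matrix, so that
  the algebraic identities hold as equations between functions and not only on \<open>I \<times> V\<close>.
\<close>

definition g_loc :: "'n \<Rightarrow> 'n \<Rightarrow> real \<times> (real ^ 'n) \<Rightarrow> real" where
  "g_loc i j x = (if x \<in> I \<times> V then g (fst x) c (para c (snd x)) i j else if i = j then 1 else 0)"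

definition ginv_loc :: "'n \<Rightarrow> 'n \<Rightarrow> real \<times> (real ^ 'n) \<Rightarrow> real" where
  "ginv_loc i j x = matrix_inv (\<chi> a b. g_loc a b x) $ i $ j"

definition \<Gamma>_loc :: "'n \<Rightarrow> 'n \<Rightarrow> 'n \<Rightarrow> real \<times> (real ^ 'n) \<Rightarrow> real" where
  "\<Gamma>_loc k i j x = (1/2) * (\<Sum>l\<in>UNIV. ginv_loc k l x *
    (dd (Some i) (g_loc j l) x + dd (Some j) (g_loc i l) x - dd (Some l) (g_loc i j) x))"

definition H_loc :: "'n \<Rightarrow> 'n \<Rightarrow> 'n \<Rightarrow> real \<times> (real ^ 'n) \<Rightarrow> real" where
  "H_loc i j k x = (if x \<in> I \<times> V then H (fst x) c (para c (snd x)) i j k else 0)"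

definition F_loc :: "real \<times> (real ^ 'n) \<Rightarrow> real" where
  "F_loc x = F (fst x) (para c (snd x))"

definition \<psi>_loc :: "'n option \<Rightarrow> real \<times> (real ^ 'n) \<Rightarrow> real" where
  "\<psi>_loc p x = dd p F_loc x - (1/2) * (\<Sum>a\<in>UNIV. \<Sum>b\<in>UNIV. ginv_loc a b x * dd p (g_loc a b) x)"

lemma g_loc_det: "det (\<chi> a b. g_loc a b x) \<noteq> 0"
proof (cases "x \<in> I \<times> V")
  case True
  then show ?thesis
    by (intro positive_definite_det) (auto simp: g_loc_def intro: g_pos)
next
  case False
  then have "(\<chi> a b. g_loc a b x) = mat 1"
    by (auto simp: g_loc_def mat_def vec_eq_iff)
  then show ?thesis by simp
qed

lemma g_loc_swap: "g_loc i j x = g_loc j i x"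
  by (auto simp: g_loc_def intro: g_swap)

lemma ginv_loc_g_loc: "(\<Sum>j\<in>UNIV. ginv_loc i j x * g_loc j k x) = (if i = k then 1 else 0)"
proof -
  have "matrix_inv (\<chi> a b. g_loc a b x) ** (\<chi> a b. g_loc a b x) = mat 1"
    by (rule matrix_inv_left[OF g_loc_det])
  then have "(matrix_inv (\<chi> a b. g_loc a b x) ** (\<chi> a b. g_loc a b x)) $ i $ k = (if i = k then 1 else 0)"
    by (simp add: mat_def)
  then show ?thesis
    by (simp add: matrix_matrix_mult_def ginv_loc_def)
qed

lemma g_loc_ginv_loc: "(\<Sum>j\<in>UNIV. g_loc i j x * ginv_loc j k x) = (if i = k then 1 else 0)"
proof -
  have "(\<chi> a b. g_loc a b x) ** matrix_inv (\<chi> a b. g_loc a b x) = mat 1"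
    by (rule matrix_inv_right[OF g_loc_det])
  then have "((\<chi> a b. g_loc a b x) ** matrix_inv (\<chi> a b. g_loc a b x)) $ i $ k = (if i = k then 1 else 0)"
    by (simp add: mat_def)
  then show ?thesis
    by (simp add: matrix_matrix_mult_def ginv_loc_def)
qed

lemma ginv_loc_swap: "ginv_loc i j x = ginv_loc j i x"
proof -
  have delta: "(\<Sum>k\<in>UNIV. f k * (if i = k then 1 else 0)) = f i" for f :: "'n \<Rightarrow> real" and i
    by (simp add: if_distrib[of "\<lambda>z. _ * z"] cong: if_cong)
  have 1: "(\<Sum>m\<in>UNIV. g_loc k m x * ginv_loc j m x) = (if j = k then 1 else 0)" for j k
    using ginv_loc_g_loc[of j x k] by (simp add: g_loc_swap mult.commute)
  have "ginv_loc i j x = (\<Sum>k\<in>UNIV. ginv_loc i k x * (\<Sum>m\<in>UNIV. g_loc k m x * ginv_loc j m x))"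
    unfolding 1 delta ..
  also have "\<dots> = (\<Sum>m\<in>UNIV. ginv_loc j m x * (\<Sum>k\<in>UNIV. ginv_loc i k x * g_loc k m x))"
    unfolding sum_distrib_left by (subst sum.swap) (simp add: ac_simps)
  also have "\<dots> = ginv_loc j i x"
    unfolding ginv_loc_g_loc delta ..
  finally show ?thesis .
qed

lemma g_loc_smooth: "smooth_on (I \<times> V) (g_loc i j)"
  by (rule smooth_on_cong[OF g_smooth[of i j]]) (auto simp: g_loc_def)

lemma ginv_loc_smooth: "smooth_on (I \<times> V) (ginv_loc i j)"
proof -
  have "smooth_on (I \<times> V) (\<lambda>x. det (\<chi> i' j'. (if j' = i then (\<lambda>x. axis j 1 $ i') else g_loc i' j') x)
      * inverse (det (\<chi> a b. g_loc a b x)))"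
    by (intro smooth_on_mult smooth_on_inverse smooth_on_det g_loc_det) (auto simp: g_loc_smooth)
  then show ?thesis
    by (rule smooth_on_cong)
      (simp add: ginv_loc_def matrix_inv_cramer[OF g_loc_det] divide_inverse if_distrib[of "\<lambda>f. f _"] cong: if_cong)
qed

lemma \<Gamma>_loc_smooth: "smooth_on (I \<times> V) (\<Gamma>_loc k i j)"
  unfolding \<Gamma>_loc_def[abs_def] diff_conv_add_uminus
  by (intro smooth_on_mult smooth_on_const smooth_on_sum smooth_on_add smooth_on_uminus smooth_on_dd
      g_loc_smooth ginv_loc_smooth)

lemma F_loc_smooth: "smooth_on (I \<times> V) F_loc"
  using F_smooth by (simp add: F_loc_def[abs_def] case_prod_beta')

lemma H_loc_smooth: "smooth_on (I \<times> V) (H_loc i j k)"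
  by (rule smooth_on_cong[OF H_smooth[of i j k]]) (auto simp: H_loc_def)

lemma \<psi>_loc_smooth: "smooth_on (I \<times> V) (\<psi>_loc p)"
  unfolding \<psi>_loc_def[abs_def] diff_conv_add_uminus
  by (intro smooth_on_mult smooth_on_const smooth_on_sum smooth_on_add smooth_on_uminus smooth_on_dd
      g_loc_smooth ginv_loc_smooth F_loc_smooth)

sublocale m: metric_ring "{f. smooth_on (I \<times> V) f}" dd g_loc ginv_loc \<Gamma>_loc F_loc \<psi>_loc
proof
  fix i j k l p
  have g_loc_sym: "g_loc i j = g_loc j i" for i j
    by (rule ext) (rule g_loc_swap)
  then show "g_loc i j = g_loc j i" .
  show "ginv_loc i j = ginv_loc j i"
    by (rule ext) (rule ginv_loc_swap)
  show "\<Gamma>_loc l i j = \<Gamma>_loc l j i"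
    by (rule ext) (simp add: \<Gamma>_loc_def g_loc_sym[of j i] add.commute)
  show "(\<Oplus>j. ginv_loc i j * g_loc j k) = (if i = k then 1 else 0)"
    by (rule ext) (simp add: fun_ring_apply ginv_loc_g_loc)
  show "2 * (\<Oplus>m. g_loc k m * \<Gamma>_loc m i j)
      = dd (Some i) (g_loc j k) + dd (Some j) (g_loc i k) - dd (Some k) (g_loc i j)" (is "?L = ?R")
  proof
    fix x
    let ?Z = "\<lambda>l. dd (Some i) (g_loc j l) x + dd (Some j) (g_loc i l) x - dd (Some l) (g_loc i j) x"
    have "?L x = (\<Sum>m\<in>UNIV. \<Sum>l\<in>UNIV. g_loc k m x * ginv_loc m l x * ?Z l)"
      by (simp add: fun_ring_apply \<Gamma>_loc_def sum_distrib_left mult.assoc)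
    also have "\<dots> = (\<Sum>l\<in>UNIV. (\<Sum>m\<in>UNIV. g_loc k m x * ginv_loc m l x) * ?Z l)"
      by (subst sum.swap) (simp only: sum_distrib_right)
    also have "\<dots> = ?Z k"
      by (simp add: g_loc_ginv_loc if_distrib[of "\<lambda>z. z * _"] cong: if_cong)
    finally show "?L x = ?R x"
      by (simp add: fun_ring_apply)
  qed
  show "2 * \<psi>_loc p = 2 * dd p F_loc - (\<Oplus>a b. ginv_loc a b * dd p (g_loc a b))"
    by (rule ext) (simp add: fun_ring_apply \<psi>_loc_def)
  show "a = 0" if "a + a = 0" for a :: "real \<times> (real ^ 'n) \<Rightarrow> real"
    using that by (auto simp: fun_eq_iff)
qed (simp_all add: g_loc_smooth ginv_loc_smooth \<Gamma>_loc_smooth F_loc_smooth \<psi>_loc_smooth)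

lemma dd_outside: "x \<notin> I \<times> V \<Longrightarrow> dd k K x = 0"
  by (auto simp: dd_def)

lemma pd_H:
  assumes "t \<in> I" "y \<in> V"
  shows "pd c l (\<lambda>q. H t c q i j k) (para c y) = dd (Some l) (H_loc i j k) (t, y)"
  using assms by (intro pd_eq_dd H_loc_smooth) (auto simp: H_loc_def)

sublocale w: weighted_metric_flux "{f. smooth_on (I \<times> V) f}" dd ginv_loc \<Gamma>_loc F_loc
  "\<lambda>l. (\<Oplus>m. \<Gamma>_loc m m l) - dd (Some l) F_loc" \<psi>_loc H_loc
proof (rule weighted_metric_flux.intro[OF m.weighted_metric], unfold_locales)
  fix i j k l
  show "H_loc i j k \<in> {f. smooth_on (I \<times> V) f}"
    by (simp add: H_loc_smooth)
  show "H_loc i j k = - H_loc j i k" "H_loc i j k = - H_loc i k j"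
    using H_swap12[of _ _ i j k] H_swap23[of _ _ i j k]
    by (simp_all only: H_loc_def fun_eq_iff uminus_apply) auto
  show "dd (Some i) (H_loc j k l) - dd (Some j) (H_loc i k l) + dd (Some k) (H_loc i j l) - dd (Some l) (H_loc i j k) = 0"
  proof
    fix x
    show "(dd (Some i) (H_loc j k l) - dd (Some j) (H_loc i k l) + dd (Some k) (H_loc i j l) - dd (Some l) (H_loc i j k)) x = 0 x"
      using H_closed3[of "fst x" "snd x" i j k l]
      by (cases "x \<in> I \<times> V") (auto simp: fun_ring_apply pd_H dd_outside)
  qed
qed (rule m.torsion_free)

section \<open>Coordinate tensors at a point identified with ring elements\<close>

context
  fixes t y
  assumes t: "t \<in> I" and y: "y \<in> V"
begin

lemma ginv_link: "ginv (g t) c (para c y) i j = ginv_loc i j (t, y)"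
  using t y by (simp add: ginv_def ginv_loc_def g_loc_def)

lemma pd_g: "pd c l (\<lambda>q. g t c q i j) (para c y) = dd (Some l) (g_loc i j) (t, y)"
  using t y by (intro pd_eq_dd g_loc_smooth) (auto simp: g_loc_def)

lemma christoffel_link: "christoffel (g t) c (para c y) k i j = \<Gamma>_loc k i j (t, y)"
  by (simp add: christoffel_def \<Gamma>_loc_def ginv_link pd_g)

end

context
  fixes t y
  assumes t: "t \<in> I" and y: "y \<in> V"
begin

text \<open>Differentiating \<Gamma> takes its identification on all of V; closing the preceding
  context has generalised \<open>christoffel_link\<close> over the point.\<close>

lemma pd_christoffel:
  "pd c l (\<lambda>q. christoffel (g t) c q k i j) (para c y) = dd (Some l) (\<Gamma>_loc k i j) (t, y)"
  using t y by (intro pd_eq_dd \<Gamma>_loc_smooth christoffel_link)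

lemma hess_link:
  assumes K: "smooth_on (I \<times> V) K" and h: "\<And>z. z \<in> V \<Longrightarrow> h (para c z) = K (t, z)"
  shows "hess (g t) h c (para c y) i j
    = dd (Some i) (dd (Some j) K) (t, y) - (\<Oplus>m. \<Gamma>_loc m i j (t, y) * dd (Some m) K (t, y))"
proof -
  have 1: "differential h c (para c z) l = dd (Some l) K (t, z)" if "z \<in> V" for z l
    unfolding differential_def by (rule pd_eq_dd[OF K h t that])
  have "pd c i (\<lambda>q. differential h c q j) (para c y) = dd (Some i) (dd (Some j) K) (t, y)"
    using 1 by (intro pd_eq_dd smooth_on_dd K t y)
  then show ?thesis
    by (simp add: hess_def cov1_def 1 y christoffel_link t)
qed

lemma laplacian_link:
  assumes K: "smooth_on (I \<times> V) K" and h: "\<And>z. z \<in> V \<Longrightarrow> h (para c z) = K (t, z)"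
  shows "laplacian (g t) h c (para c y)
    = w.drift_lap K (t, y) + (\<Oplus>l. w.X l (t, y) * dd (Some l) K (t, y))"
proof -
  have "(\<Oplus>j m. ginv_loc j m * (dd (Some j) (dd (Some m) K) - (\<Oplus>l. \<Gamma>_loc l j m * dd (Some l) K))) (t, y)
      = (w.drift_lap K + (\<Oplus>l. w.X l * dd (Some l) K)) (t, y)"
    using K by (subst w.trace_hessian) auto
  then show ?thesis
    by (simp add: laplacian_def trace_g_def hess_link[OF K h] ginv_link t y fun_ring_apply)
qed

lemma inner1_link:
  assumes K: "smooth_on (I \<times> V) K" and h: "\<And>z. z \<in> V \<Longrightarrow> h (para c z) = K (t, z)"
    and K': "smooth_on (I \<times> V) K'" and h': "\<And>z. z \<in> V \<Longrightarrow> h' (para c z) = K' (t, z)"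
  shows "inner1 (g t) c (para c y) (differential h c (para c y)) (differential h' c (para c y))
    = (\<Oplus>i j. ginv_loc i j (t, y) * dd (Some i) K (t, y) * dd (Some j) K' (t, y))"
  by (simp add: inner1_def differential_def ginv_link t y pd_eq_dd[OF K h] pd_eq_dd[OF K' h'])

lemma F_link: "z \<in> V \<Longrightarrow> F t (para c z) = F_loc (t, z)"
  by (simp add: F_loc_def)

lemma grad_link: "grad (g t) (F t) c (para c y) i = w.X i (t, y)"
  by (simp add: grad_def w.X_def differential_def ginv_link t y pd_eq_dd[OF F_loc_smooth F_link] fun_ring_apply)

text \<open>The traced Christoffel symbols and dF combine to \<theta>: its product with \<Gamma>
  completes \<partial>_l to D_l, and its derivative collects the remaining second-order
  terms.\<close>

lemma ricci_link: "ricci (g t) c (para c y) j k + hess (g t) (F t) c (para c y) j k = w.ric j k (t, y)"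
proof -
  have swap: "(\<Oplus>i m. \<Gamma>_loc i i m (t, y) * \<Gamma>_loc m j k (t, y)) = (\<Oplus>l m. \<Gamma>_loc m m l (t, y) * \<Gamma>_loc l j k (t, y))"
    by (rule sum.swap)
  have comm: "(\<Oplus>m. \<Gamma>_loc m j k (t, y) * dd (Some m) F_loc (t, y)) = (\<Oplus>m. dd (Some m) F_loc (t, y) * \<Gamma>_loc m j k (t, y))"
    by (simp add: mult.commute)
  have "dd (Some j) ((\<Oplus>m. \<Gamma>_loc m m k) - dd (Some k) F_loc)
      = (\<Oplus>m. dd (Some j) (\<Gamma>_loc m m k)) - dd (Some j) (dd (Some k) F_loc)"
    by (simp del: mem_Collect_eq)
  then show ?thesis
    by (simp add: ricci_def riemann_def christoffel_link pd_christoffel t y hess_link[OF F_loc_smooth F_link]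
        w.ric_def w.D_def fun_ring_apply \<Gamma>_loc_smooth F_loc_smooth smooth_on_dd sum.distrib sum_subtractf
        swap comm sum_distrib_right left_diff_distrib)
qed

lemma inner3_link: "inner3 (g t) c (para c y) (H t c (para c y)) (H t c (para c y)) = w.H_norm (t, y)"
  using t y by (simp add: inner3_def w.H_norm_def contract3_def ginv_link fun_ring_apply H_loc_def)

lemma Hsq_link: "Hsq (g t) (H t) c (para c y) i j = w.H_sq i j (t, y)"
  using t y by (simp add: Hsq_def inner2_def w.H_sq_def ginv_link fun_ring_apply H_loc_def)

lemma codiff_link: "codiff3 (g t) (H t) c (para c y) j k = w.codiff j k (t, y)"
proof -
  have "H t c (para c y) i j k = H_loc i j k (t, y)" for i j k
    using t y by (simp add: H_loc_def)
  then show ?thesis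
    by (simp add: codiff3_def cov3_def w.codiff_def w.cov_H_def ginv_link christoffel_link pd_H t y
        fun_ring_apply)
qed

lemma i_grad_link: "i_grad (g t) (F t) (H t) c (para c y) j k = w.contract_X_H j k (t, y)"
  using t y by (simp add: i_grad_def grad_link w.contract_X_H_def fun_ring_apply H_loc_def)

lemma Rc_gen_link: "Rc_gen (g t) (H t) (F t) c (para c y) i j
    = w.ric i j (t, y) - (1/4) * w.H_sq i j (t, y) - (1/2) * w.B i j (t, y)"
  using ricci_link[of i j]
  by (simp add: Rc_gen_def Hsq_link codiff_link i_grad_link w.B_def fun_ring_apply)

lemma X_dF: "(\<Oplus>i j. ginv_loc i j (t, y) * dd (Some i) K (t, y) * dd (Some j) F_loc (t, y))
    = (\<Oplus>l. w.X l (t, y) * dd (Some l) K (t, y))"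
  by (simp add: w.X_def fun_ring_apply sum_distrib_left sum_distrib_right ac_simps)

lemma scalar_link: "scalar_curv (g t) c (para c y) + laplacian (g t) (F t) c (para c y)
    = (\<Oplus>i j. ginv_loc i j (t, y) * w.ric i j (t, y))"
  unfolding scalar_curv_def laplacian_def trace_g_def ginv_link[OF t y] ricci_link[symmetric]
  by (simp add: distrib_left sum.distrib)

text \<open>One Laplacian of F belongs to the trace of \<open>ric\<close>; the other, together with
  -|\<nabla>F|^2, is \<open>drift_lap F\<close>.\<close>

lemma R_gen_link: "R_gen (g t) (H t) (F t) c (para c y) = w.scal (t, y) - (1/12) * w.H_norm (t, y)"
proof -
  have "w.scal (t, y) = scalar_curv (g t) c (para c y) + 2 * laplacian (g t) (F t) c (para c y)
      - (\<Oplus>l. w.X l (t, y) * dd (Some l) F_loc (t, y))"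
    using scalar_link laplacian_link[OF F_loc_smooth F_link]
    by (simp add: w.scal_def fun_ring_apply)
  then show ?thesis
    by (simp add: R_gen_def inner3_link inner1_link[OF F_loc_smooth F_link F_loc_smooth F_link] X_dF)
qed

end

end

locale chart_evolution = chart_flow I V c H H0 b g F
  for I :: "real set" and V :: "(real ^ 'n::finite) set" and c :: "('m, 'n) chart"
    and H :: "real \<Rightarrow> ('m, 'n) tensor3" and H0 b g F +
  fixes f \<phi> u :: "real \<Rightarrow> 'm \<Rightarrow> real"
  assumes F_eq: "F t = (\<lambda>q. f t q + \<phi> t q)"
    and f_smooth: "smooth_on (I \<times> V) (\<lambda>(t, y). f t (para c y))"
    and \<phi>_smooth: "smooth_on (I \<times> V) (\<lambda>(t, y). \<phi> t (para c y))"
    and b_flow: "t \<in> I \<Longrightarrow> y \<in> V \<Longrightarrow>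
      vector_derivative (\<lambda>s. b s c (para c y) i j) (at t within I) = - codiff3 (g t) (H t) c (para c y) i j"
    and g_flow: "t \<in> I \<Longrightarrow> y \<in> V \<Longrightarrow>
      vector_derivative (\<lambda>s. g s c (para c y) i j) (at t within I)
        = - 2 * ricci (g t) c (para c y) i j + (1/2) * Hsq (g t) (H t) c (para c y) i j"
    and \<phi>_flow: "t \<in> I \<Longrightarrow> y \<in> V \<Longrightarrow>
      heat_op I g \<phi> t c (para c y) = (1/6) * inner3 (g t) c (para c y) (H t c (para c y)) (H t c (para c y))"
    and u_eq: "t \<in> I \<Longrightarrow> y \<in> V \<Longrightarrow> u t (para c y) = exp (- f t (para c y))"
    and u_flow: "t \<in> I \<Longrightarrow> y \<in> V \<Longrightarrow> conj_heat_op I g H \<phi> u t c (para c y) = 0"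
begin

section \<open>The flow equations as identities in the ring\<close>

definition f_loc :: "real \<times> (real ^ 'n) \<Rightarrow> real" where "f_loc x = f (fst x) (para c (snd x))"
definition \<phi>_loc :: "real \<times> (real ^ 'n) \<Rightarrow> real" where "\<phi>_loc x = \<phi> (fst x) (para c (snd x))"
definition u_loc :: "real \<times> (real ^ 'n) \<Rightarrow> real" where "u_loc x = exp (- f_loc x)"
text \<open>Twelve times R^{H,F}, which clears the coefficient 1/12 of |H|^2.\<close>

definition w_loc :: "real \<times> (real ^ 'n) \<Rightarrow> real" where "w_loc = 12 * w.scal - w.H_norm"
definition R_loc :: "real \<times> (real ^ 'n) \<Rightarrow> real" where "R_loc x = w.scal x - (1/12) * w.H_norm x"

lemma f_loc_smooth: "smooth_on (I \<times> V) f_loc"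
  using f_smooth by (simp add: f_loc_def[abs_def] case_prod_beta')

lemma \<phi>_loc_smooth: "smooth_on (I \<times> V) \<phi>_loc"
  using \<phi>_smooth by (simp add: \<phi>_loc_def[abs_def] case_prod_beta')

lemma u_loc_smooth: "smooth_on (I \<times> V) u_loc"
  unfolding u_loc_def[abs_def] by (intro smooth_on_exp smooth_on_uminus f_loc_smooth)

lemma scal_smooth: "smooth_on (I \<times> V) w.scal"
  using w.S_scal by (simp only: mem_Collect_eq)

lemma H_norm_smooth: "smooth_on (I \<times> V) w.H_norm"
  using w.S_H_more(3) by (simp only: mem_Collect_eq)

lemma R_loc_smooth: "smooth_on (I \<times> V) R_loc"
proof -
  have "smooth_on (I \<times> V) (\<lambda>x. w.scal x + (- 1/12) * w.H_norm x)"
    by (intro smooth_on_add smooth_on_mult smooth_on_const scal_smooth H_norm_smooth)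
  then show ?thesis
    by (rule smooth_on_cong) (simp add: R_loc_def)
qed

lemma w_loc_R_loc: "w_loc = 12 * R_loc"
  by (rule ext) (simp add: w_loc_def R_loc_def fun_ring_apply)

lemma F_loc_eq: "F_loc = f_loc + \<phi>_loc"
  by (rule ext) (simp add: F_loc_def F_eq f_loc_def \<phi>_loc_def)

lemma dd_u_loc: "dd k u_loc = - u_loc * dd k f_loc"
proof
  fix x
  show "dd k u_loc x = (- u_loc * dd k f_loc) x"
  proof (cases "x \<in> I \<times> V")
    case True
    have "(u_loc has_derivative (\<lambda>v. - u_loc x * frechet_derivative f_loc (at x within I \<times> V) v)) (at x within I \<times> V)"
      unfolding u_loc_def[abs_def]
      by (auto intro!: derivative_eq_intros smooth_on_has_derivative[OF f_loc_smooth True] simp: mult.commute)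
    from dd_eqI[OF this True, of k] show ?thesis
      using True by (simp add: dd_def fun_ring_apply)
  qed (simp add: dd_outside fun_ring_apply)
qed

lemma grad_inner_u_loc: "w.grad_inner u_loc k = - u_loc * w.grad_inner f_loc k"
  by (simp add: w.grad_inner_def dd_u_loc sum_distrib_left sum_negf ac_simps)

lemma drift_lap_u_loc: "w.drift_lap u_loc = u_loc * (w.grad_inner f_loc f_loc - w.drift_lap f_loc)"
proof -
  have u_loc: "u_loc \<in> {f. smooth_on (I \<times> V) f}" and f_loc: "f_loc \<in> {f. smooth_on (I \<times> V) f}"
    by (simp_all add: u_loc_smooth f_loc_smooth)
  have "w.drift_lap u_loc = - u_loc * w.drift_lap f_loc + w.grad_inner (- u_loc) f_loc"
    by (rule w.drift_lap_chain[OF S_uminus[OF u_loc] f_loc dd_u_loc])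
  moreover have "w.grad_inner (- u_loc) f_loc = - w.grad_inner u_loc f_loc"
    using u_loc by (simp add: w.grad_inner_def sum_negf d_uminus del: mem_Collect_eq)
  ultimately show ?thesis
    by (simp add: grad_inner_u_loc right_diff_distrib)
qed

lemma b_loc_flow:
  assumes "x \<in> I \<times> V"
  shows "dd None (b_loc i j) x = - w.codiff i j x"
proof -
  obtain t y where x: "x = (t, y)" "t \<in> I" "y \<in> V"
    using assms by auto
  have "vector_derivative (\<lambda>s. b s c (para c y) i j) (at t within I) = dd None (b_loc i j) (t, y)"
    using x b_loc_S by (intro vector_derivative_eq_dd) (auto simp: b_loc_def)
  then show ?thesis
    using b_flow[OF x(2,3), of i j] codiff_link[OF x(2,3), of i j] by (simp add: x)
qed

lemma H0_loc_static: "dd None (H0_loc i j k) = 0"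
proof
  fix x
  show "dd None (H0_loc i j k) x = 0 x"
  proof (cases "x \<in> I \<times> V")
    case True
    then obtain t y where x: "x = (t, y)" "t \<in> I" "y \<in> V"
      by auto
    have "vector_derivative (\<lambda>s. H0_loc i j k (t, y)) (at t within I) = dd None (H0_loc i j k) (t, y)"
      using x H0_loc_S by (intro vector_derivative_eq_dd) (auto simp: H0_loc_def)
    moreover have "vector_derivative (\<lambda>s. H0_loc i j k (t, y)) (at t within I)
        = dd None (\<lambda>x. H0_loc i j k (t, y)) (t, y)"
      using x by (intro vector_derivative_eq_dd smooth_on_const) auto
    moreover have "dd None (\<lambda>x. H0_loc i j k (t, y)) (t, y) = 0"
      using x by (intro dd_eqI[where f' = "\<lambda>_. 0"]) auto
    ultimately show ?thesis by (simp add: x)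
  qed (simp add: dd_outside)
qed

text \<open>H_0 is static and \<partial>_t commutes with the exterior derivative, so the equation
  for b gives that for H.\<close>

lemma H_loc_flow: "dd None (H_loc i j k)
  = - (dd (Some i) (w.codiff j k) + dd (Some j) (w.codiff k i) + dd (Some k) (w.codiff i j))"
proof -
  have comm: "dd None (dd l (b_loc i j)) = dd l (dd None (b_loc i j))" for l i j
    by (rule d_commute[OF b_loc_S])
  have flow: "dd l (dd None (b_loc i j)) = - dd l (w.codiff i j)" for l i j
  proof -
    have "dd l (dd None (b_loc i j)) = dd l (- w.codiff i j)"
      by (rule dd_cong) (simp add: b_loc_flow)
    then show ?thesis
      by (simp only: d_uminus[OF w.S_B(1)])
  qed
  have "dd None (H_loc i j k) = dd None (H_pot i j k)"
    by (rule dd_cong) (auto simp: H_loc_def H_H_pot)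
  also have "\<dots> = dd None (H0_loc i j k) + (dd None (dd (Some i) (b_loc j k)) + dd None (dd (Some j) (b_loc k i))
      + dd None (dd (Some k) (b_loc i j)))"
    unfolding H_pot_def by (simp only: d_add S_add S_d b_loc_S H0_loc_S)
  finally show ?thesis
    by (simp add: H0_loc_static comm flow)
qed

lemma g_loc_flow:
  assumes "t \<in> I" "y \<in> V"
  shows "dd None (g_loc i j) (t, y) = - 2 * (w.ric i j (t, y) - (dd (Some i) (dd (Some j) F_loc) (t, y)
    - (\<Oplus>m. \<Gamma>_loc m i j (t, y) * dd (Some m) F_loc (t, y)))) + (1/2) * w.H_sq i j (t, y)"
proof -
  have "dd None (g_loc i j) (t, y) = vector_derivative (\<lambda>s. g s c (para c y) i j) (at t within I)"
    using assms by (intro vector_derivative_eq_dd[symmetric] g_loc_smooth) (auto simp: g_loc_def)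
  then show ?thesis
    using ricci_link[OF assms, of i j] hess_link[OF assms F_loc_smooth F_link[OF assms], of i j]
    unfolding g_flow[OF assms] Hsq_link[OF assms] by simp
qed

lemma ginv_loc_flow:
  "2 * dd None (ginv_loc i j) = 4 * (\<Oplus>k. w.ric1 i k * ginv_loc k j) - (\<Oplus>k. w.H_sq1 i k * ginv_loc k j)
    - 4 * (\<Oplus>k. w.hess1 i k * ginv_loc k j)"
proof
  fix x
  let ?hess = "\<lambda>a b. dd (Some a) (dd (Some b) F_loc) x - (\<Oplus>m. \<Gamma>_loc m a b x * dd (Some m) F_loc x)"
  show "(2 * dd None (ginv_loc i j)) x = (4 * (\<Oplus>k. w.ric1 i k * ginv_loc k j) - (\<Oplus>k. w.H_sq1 i k * ginv_loc k j)
    - 4 * (\<Oplus>k. w.hess1 i k * ginv_loc k j)) x"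
  proof (cases "x \<in> I \<times> V")
    case True
    have *: "(\<Oplus>k. (\<Oplus>a. ginv_loc i a x * Z a k) * ginv_loc k j x) = (\<Oplus>a b. ginv_loc i a x * Z a b * ginv_loc b j x)" for Z
      by (subst sum.swap) (simp add: sum_distrib_right)
    have "dd None (g_loc a b) x = - 2 * (w.ric a b x - ?hess a b) + (1/2) * w.H_sq a b x" for a b
      using g_loc_flow[of "fst x" "snd x" a b] True by auto
    then have "(2 * dd None (ginv_loc i j)) x
        = - 2 * (\<Oplus>a b. ginv_loc i a x * (- 2 * (w.ric a b x - ?hess a b) + (1/2) * w.H_sq a b x) * ginv_loc b j x)"
      by (simp add: m.d_inverse fun_ring_apply)
    also have "\<dots> = (\<Oplus>a b. 4 * (ginv_loc i a x * w.ric a b x * ginv_loc b j x) - ginv_loc i a x * w.H_sq a b x * ginv_loc b j x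
        - 4 * (ginv_loc i a x * ?hess a b * ginv_loc b j x))"
      unfolding sum_distrib_left by (intro sum.cong refl) (simp add: field_simps)
    also have "\<dots> = 4 * (\<Oplus>a b. ginv_loc i a x * w.ric a b x * ginv_loc b j x)
        - (\<Oplus>a b. ginv_loc i a x * w.H_sq a b x * ginv_loc b j x) - 4 * (\<Oplus>a b. ginv_loc i a x * ?hess a b * ginv_loc b j x)"
      by (simp only: sum_subtractf sum_distrib_left)
    finally show ?thesis
      by (simp add: w.ric1_def w.H_sq1_def w.hess1_eq fun_ring_apply *)
  next
    \<comment> \<open>Off I \<times> V all derivatives vanish, hence also \<Gamma>,
      \<open>ric\<close> and \<open>hess1\<close>, and H is 0 there by definition; both sides are
      0.\<close>
    case False
    then show ?thesis
      by (simp add: fun_ring_apply dd_outside w.ric1_def w.ric_def w.D_def \<Gamma>_loc_def w.H_sq1_def w.H_sq_def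
          H_loc_def w.hess1_def w.X_def)
  qed
qed

lemma laplacian_eq:
  assumes "t \<in> I" "y \<in> V" and K: "smooth_on (I \<times> V) K" and "\<And>z. z \<in> V \<Longrightarrow> h (para c z) = K (t, z)"
  shows "laplacian (g t) h c (para c y) = w.drift_lap K (t, y) + w.grad_inner K F_loc (t, y)"
  using fun_cong[OF w.X_eq_grad_inner[of K], of "(t, y)"]
  by (simp add: laplacian_link[OF assms] fun_ring_apply)

lemma inner1_eq:
  assumes "t \<in> I" "y \<in> V" and "smooth_on (I \<times> V) K" and "\<And>z. z \<in> V \<Longrightarrow> h (para c z) = K (t, z)"
    and "smooth_on (I \<times> V) K'" and "\<And>z. z \<in> V \<Longrightarrow> h' (para c z) = K' (t, z)"
  shows "inner1 (g t) c (para c y) (differential h c (para c y)) (differential h' c (para c y))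
    = w.grad_inner K K' (t, y)"
  by (simp add: inner1_link[OF assms] w.grad_inner_def fun_ring_apply)

lemma scalar_curv_eq:
  assumes "t \<in> I" "y \<in> V"
  shows "scalar_curv (g t) c (para c y)
    = w.scal (t, y) - 2 * w.drift_lap F_loc (t, y) - w.grad_inner F_loc F_loc (t, y)"
  using scalar_link[OF assms] laplacian_eq[OF assms F_loc_smooth F_link[OF assms]]
  by (simp add: w.scal_def fun_ring_apply)

lemma grad_inner_F_loc: "smooth_on (I \<times> V) K \<Longrightarrow> w.grad_inner K F_loc = w.grad_inner K f_loc + w.grad_inner K \<phi>_loc"
  using w.grad_inner_add[of f_loc \<phi>_loc K] f_loc_smooth \<phi>_loc_smooth by (simp add: F_loc_eq[symmetric])

lemma drift_lap_F_loc: "w.drift_lap F_loc = w.drift_lap f_loc + w.drift_lap \<phi>_loc"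
  using w.drift_lap_add[of f_loc \<phi>_loc] f_loc_smooth \<phi>_loc_smooth by (simp add: F_loc_eq[symmetric])

lemma \<phi>_loc_flow:
  assumes "t \<in> I" "y \<in> V"
  shows "dd None \<phi>_loc (t, y) = w.drift_lap \<phi>_loc (t, y) + w.grad_inner \<phi>_loc F_loc (t, y) + (1/6) * w.H_norm (t, y)"
proof -
  have "vector_derivative (\<lambda>s. \<phi> s (para c y)) (at t within I) = dd None \<phi>_loc (t, y)"
    using assms by (intro vector_derivative_eq_dd \<phi>_loc_smooth) (auto simp: \<phi>_loc_def)
  moreover have "laplacian (g t) (\<phi> t) c (para c y) = w.drift_lap \<phi>_loc (t, y) + w.grad_inner \<phi>_loc F_loc (t, y)"
    by (rule laplacian_eq[OF assms \<phi>_loc_smooth]) (simp add: \<phi>_loc_def)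
  ultimately show ?thesis
    using \<phi>_flow[OF assms] by (simp add: heat_op_def inner3_link[OF assms])
qed

lemma R_gen_\<phi>:
  assumes "t \<in> I" "y \<in> V"
  shows "R_gen (g t) (H t) (\<phi> t) c (para c y)
    = w.scal (t, y) - 2 * w.drift_lap F_loc (t, y) - w.grad_inner F_loc F_loc (t, y) - (1/12) * w.H_norm (t, y)
      + 2 * (w.drift_lap \<phi>_loc (t, y) + w.grad_inner \<phi>_loc F_loc (t, y)) - w.grad_inner \<phi>_loc \<phi>_loc (t, y)"
proof -
  have "\<phi> t (para c z) = \<phi>_loc (t, z)" for z
    by (simp add: \<phi>_loc_def)
  then show ?thesis
    by (simp add: R_gen_def scalar_curv_eq[OF assms] inner3_link[OF assms]
        laplacian_eq[OF assms \<phi>_loc_smooth] inner1_eq[OF assms \<phi>_loc_smooth _ \<phi>_loc_smooth])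
qed

lemma conj_heat_op_eq:
  assumes "t \<in> I" "y \<in> V" and K: "smooth_on (I \<times> V) K"
    and h: "\<And>s z. s \<in> I \<Longrightarrow> z \<in> V \<Longrightarrow> h s (para c z) = K (s, z)"
  shows "conj_heat_op I g H \<phi> h t c (para c y) = - dd None K (t, y) - w.drift_lap K (t, y)
    - w.grad_inner K F_loc (t, y) + 2 * w.grad_inner \<phi>_loc K (t, y)
    + R_gen (g t) (H t) (\<phi> t) c (para c y) * K (t, y)"
proof -
  have "vector_derivative (\<lambda>s. h s (para c y)) (at t within I) = dd None K (t, y)"
    using assms by (intro vector_derivative_eq_dd K) auto
  moreover have "\<phi> t (para c z) = \<phi>_loc (t, z)" for z
    by (simp add: \<phi>_loc_def)
  ultimately show ?thesis
    using h[OF assms(1)]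
    by (simp add: conj_heat_op_def laplacian_eq[OF assms(1,2) K] inner1_eq[OF assms(1,2) \<phi>_loc_smooth _ K] h assms)
qed

lemma u_link: "s \<in> I \<Longrightarrow> z \<in> V \<Longrightarrow> u s (para c z) = u_loc (s, z)"
  by (simp add: u_eq u_loc_def f_loc_def)

text \<open>The equation for u divided by the nonzero u. The terms |\<nabla>f|^2 cancel when the
  Laplacian is replaced by the drift Laplacian.\<close>

lemma f_loc_flow:
  assumes "t \<in> I" "y \<in> V"
  shows "dd None f_loc (t, y) = - w.drift_lap f_loc (t, y) + w.grad_inner f_loc \<phi>_loc (t, y)
    - R_gen (g t) (H t) (\<phi> t) c (para c y)"
proof -
  have "u_loc (t, y) * (dd None f_loc (t, y) - w.grad_inner f_loc f_loc (t, y) + w.drift_lap f_loc (t, y)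
      + w.grad_inner f_loc F_loc (t, y) - 2 * w.grad_inner f_loc \<phi>_loc (t, y) + R_gen (g t) (H t) (\<phi> t) c (para c y)) = 0"
    using conj_heat_op_eq[OF assms u_loc_smooth u_link] u_flow[OF assms]
    by (simp add: dd_u_loc drift_lap_u_loc w.grad_inner_commute[of \<phi>_loc u_loc] grad_inner_u_loc fun_ring_apply algebra_simps)
  moreover have "u_loc (t, y) \<noteq> 0"
    by (simp add: u_loc_def)
  ultimately show ?thesis
    by (simp add: grad_inner_F_loc[OF f_loc_smooth] fun_ring_apply)
qed

lemma trace_flow:
  assumes "t \<in> I" "y \<in> V"
  shows "(\<Oplus>a b. ginv_loc a b (t, y) * dd None (g_loc a b) (t, y)) = - 2 * w.scal (t, y) + 4 * w.drift_lap F_loc (t, y)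
    + 2 * w.grad_inner F_loc F_loc (t, y) + (1/2) * w.H_norm (t, y)"
proof -
  let ?hess = "\<lambda>a b. dd (Some a) (dd (Some b) F_loc) (t, y) - (\<Oplus>m. \<Gamma>_loc m a b (t, y) * dd (Some m) F_loc (t, y))"
  have 1: "(\<Oplus>a b. ginv_loc a b (t, y) * ?hess a b) = w.drift_lap F_loc (t, y) + w.grad_inner F_loc F_loc (t, y)"
    using fun_cong[OF w.trace_hessian[OF w.S_F], of "(t, y)"]
    by (simp add: fun_ring_apply flip: w.X_eq_grad_inner)
  have 2: "(\<Oplus>a b. ginv_loc a b (t, y) * w.ric a b (t, y)) = w.scal (t, y) - w.drift_lap F_loc (t, y)"
    by (simp add: w.scal_def fun_ring_apply)
  have 3: "(\<Oplus>a b. ginv_loc a b (t, y) * w.H_sq a b (t, y)) = w.H_norm (t, y)"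
    using fun_cong[OF w.H_norm_trace, of "(t, y)"] by (simp add: fun_ring_apply)
  have "(\<Oplus>a b. ginv_loc a b (t, y) * dd None (g_loc a b) (t, y)) = (\<Oplus>a b. - 2 * (ginv_loc a b (t, y) * w.ric a b (t, y))
      + 2 * (ginv_loc a b (t, y) * ?hess a b) + (1/2) * (ginv_loc a b (t, y) * w.H_sq a b (t, y)))"
    unfolding g_loc_flow[OF assms] by (intro sum.cong refl) (simp add: field_simps)
  also have "\<dots> = - 2 * (\<Oplus>a b. ginv_loc a b (t, y) * w.ric a b (t, y))
      + 2 * (\<Oplus>a b. ginv_loc a b (t, y) * ?hess a b) + (1/2) * (\<Oplus>a b. ginv_loc a b (t, y) * w.H_sq a b (t, y))"
    by (simp only: sum.distrib sum_distrib_left)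
  finally show ?thesis
    unfolding 1 2 3 by simp
qed

text \<open>To the equations for f and \<phi> one adds minus half the trace of \<partial>_t g. The
  scalar curvature cancels, the coefficients 1/12 + 1/6 - 1/4 of |H|^2 add up to 0, and the drift
  Laplacians combine to that of F. This is where the dilaton flow enters.\<close>

lemma \<psi>_loc_flow: "\<psi>_loc None = - w.drift_lap F_loc"
proof
  fix x
  show "\<psi>_loc None x = (- w.drift_lap F_loc) x"
  proof (cases "x \<in> I \<times> V")
    case True
    then obtain t y where x: "x = (t, y)" and ty: "t \<in> I" "y \<in> V"
      by auto
    have "dd None F_loc = dd None f_loc + dd None \<phi>_loc"
      unfolding F_loc_eq using f_loc_smooth \<phi>_loc_smooth by (intro d_add) simp_all
    moreover have "w.grad_inner f_loc \<phi>_loc (t, y) = w.grad_inner \<phi>_loc f_loc (t, y)"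
      by (simp add: w.grad_inner_commute[of \<phi>_loc f_loc])
    ultimately show ?thesis
      using \<phi>_loc_flow[OF ty] f_loc_flow[OF ty]
      unfolding x \<psi>_loc_def trace_flow[OF ty] R_gen_\<phi>[OF ty]
      by (simp add: fun_ring_apply grad_inner_F_loc[OF \<phi>_loc_smooth] drift_lap_F_loc field_simps)
  next
    case False
    then show ?thesis
      by (simp add: fun_ring_apply \<psi>_loc_def dd_outside w.drift_lap_def w.D_def \<Gamma>_loc_def)
  qed
qed

text \<open>Rc^{H,F} has symmetric part ric - H^2/4 and antisymmetric part -B/2, which are
  orthogonal by \<open>norm2_B\<close>.\<close>

lemma inner2_Rc_gen:
  assumes "t \<in> I" "y \<in> V"
  shows "inner2 (g t) c (para c y) (Rc_gen (g t) (H t) (F t) c (para c y))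
      (Rc_gen (g t) (H t) (F t) c (para c y))
    = w.norm2 w.ric w.ric (t, y) - (1/2) * w.norm2 w.ric w.H_sq (t, y)
      + (1/16) * w.norm2 w.H_sq w.H_sq (t, y) + (1/4) * w.norm2 w.B w.B (t, y)"
proof -
  have expand: "a * (r - (1/4) * h - (1/2) * e) * (r' - (1/4) * h' - (1/2) * e')
    = a * r * r' + (1/16) * (a * h * h') + (1/4) * (a * e * e') - (1/4) * (a * r * h') - (1/4) * (a * h * r')
      - (1/2) * (a * r * e') - (1/2) * (a * e * r') + (1/8) * (a * h * e') + (1/8) * (a * e * h')"
    for a r h e r' h' e' :: real
    by (simp add: algebra_simps)
  let ?N = "\<lambda>T U. \<Oplus>i i' j j'. ginv_loc i i' (t, y) * ginv_loc j j' (t, y) * T i j (t, y) * U i' j' (t, y)"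
  have N: "?N T U = w.norm2 T U (t, y)" for T U
    by (simp add: w.norm2_def fun_ring_apply)
  have "inner2 (g t) c (para c y) (Rc_gen (g t) (H t) (F t) c (para c y))
      (Rc_gen (g t) (H t) (F t) c (para c y))
    = (\<Oplus>i i' j j'. ginv_loc i i' (t, y) * ginv_loc j j' (t, y)
        * (w.ric i j (t, y) - (1/4) * w.H_sq i j (t, y) - (1/2) * w.B i j (t, y))
        * (w.ric i' j' (t, y) - (1/4) * w.H_sq i' j' (t, y) - (1/2) * w.B i' j' (t, y)))"
    unfolding inner2_def Rc_gen_link[OF assms] ginv_link[OF assms] ..
  also have "\<dots> = ?N w.ric w.ric + (1/16) * ?N w.H_sq w.H_sq + (1/4) * ?N w.B w.B
      - (1/4) * ?N w.ric w.H_sq - (1/4) * ?N w.H_sq w.ric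
      - (1/2) * ?N w.ric w.B - (1/2) * ?N w.B w.ric + (1/8) * ?N w.H_sq w.B + (1/8) * ?N w.B w.H_sq"
    by (simp only: expand sum.distrib sum_subtractf sum_distrib_left)
  finally show ?thesis
    unfolding N w.norm2_commute[of w.H_sq w.ric] w.norm2_commute[of w.B w.ric] w.norm2_commute[of w.B w.H_sq]
      w.norm2_B[OF w.ric_sym] w.norm2_B[OF w.H_sq_sym] by simp
qed

text \<open>The ring identity divided by 24: a factor 2 from the doubling and 12 from
  \<open>w_loc\<close>.\<close>

lemma R_loc_flow:
  "dd None R_loc x = - w.drift_lap R_loc x + w.grad_inner R_loc F_loc x + 2 * (w.norm2 w.ric w.ric x
    - (1/2) * w.norm2 w.ric w.H_sq x + (1/16) * w.norm2 w.H_sq w.H_sq x + (1/4) * w.norm2 w.B w.B x)"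
proof -
  have R_loc: "R_loc \<in> {f. smooth_on (I \<times> V) f}"
    by (simp add: R_loc_smooth)
  have "w.grad_inner (12 * R_loc) F_loc = 12 * w.grad_inner R_loc F_loc"
    by (simp only: w.grad_inner_def d_numeral_mult[OF R_loc] sum_distrib_left ac_simps)
  moreover have "dd None w_loc = 12 * dd None R_loc" "w.drift_lap w_loc = 12 * w.drift_lap R_loc"
    unfolding w_loc_R_loc by (simp_all only: d_numeral_mult[OF R_loc] w.drift_lap_numeral[OF R_loc])
  ultimately show ?thesis
    using fun_cong[OF w.evolution_norm2[OF ginv_loc_flow H_loc_flow \<psi>_loc_flow w_loc_def], of x]
    by (simp add: fun_ring_apply w_loc_R_loc)
qed

theorem conj_heat_op_R_gen:
  assumes "t \<in> I" "y \<in> V"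
  shows "conj_heat_op I g H \<phi> (\<lambda>s q. R_gen (g s) (H s) (\<lambda>x. f s x + \<phi> s x) c q * u s q) t c (para c y)
    = - 2 * inner2 (g t) c (para c y) (Rc_gen (g t) (H t) (\<lambda>x. f t x + \<phi> t x) c (para c y))
        (Rc_gen (g t) (H t) (\<lambda>x. f t x + \<phi> t x) c (para c y)) * u t (para c y)"
proof -
  have R_loc: "R_loc \<in> {f. smooth_on (I \<times> V) f}" and u_loc: "u_loc \<in> {f. smooth_on (I \<times> V) f}"
    by (simp_all add: R_loc_smooth u_loc_smooth)
  have "smooth_on (I \<times> V) (R_loc * u_loc)"
    using S_mult[OF R_loc u_loc] by (simp only: mem_Collect_eq)
  then have "conj_heat_op I g H \<phi> (\<lambda>s q. R_gen (g s) (H s) (\<lambda>x. f s x + \<phi> s x) c q * u s q) t c (para c y)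
      = - dd None (R_loc * u_loc) (t, y) - w.drift_lap (R_loc * u_loc) (t, y) - w.grad_inner (R_loc * u_loc) F_loc (t, y)
        + 2 * w.grad_inner \<phi>_loc (R_loc * u_loc) (t, y)
        + R_gen (g t) (H t) (\<phi> t) c (para c y) * (R_loc * u_loc) (t, y)"
    unfolding F_eq[symmetric] by (rule conj_heat_op_eq[OF assms]) (simp add: R_gen_link u_link R_loc_def)
  moreover have U: "conj_heat_op I g H \<phi> u t c (para c y) = - dd None u_loc (t, y) - w.drift_lap u_loc (t, y)
      - w.grad_inner u_loc F_loc (t, y) + 2 * w.grad_inner \<phi>_loc u_loc (t, y)
      + R_gen (g t) (H t) (\<phi> t) c (para c y) * u_loc (t, y)"
    by (rule conj_heat_op_eq[OF assms u_loc_smooth]) (rule u_link)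
  \<comment> \<open>This is where F = f + \<phi> originates. Since \<nabla>u = -u \<nabla>f, the
    mixed term of the Laplacian gives 2u <\<nabla>f, \<nabla>R^{H,F}>, and the drift of the operator
    adds 2u <\<nabla>\<phi>, \<nabla>R^{H,F}>. Half of the total is used up in passing to the drift
    Laplacian.\<close>
  moreover have "- dd None (R_loc * u_loc) (t, y) - w.drift_lap (R_loc * u_loc) (t, y) - w.grad_inner (R_loc * u_loc) F_loc (t, y)
        + 2 * w.grad_inner \<phi>_loc (R_loc * u_loc) (t, y)
        + R_gen (g t) (H t) (\<phi> t) c (para c y) * (R_loc * u_loc) (t, y)
      = R_loc (t, y) * conj_heat_op I g H \<phi> u t c (para c y)
      + u_loc (t, y) * (- dd None R_loc (t, y) - w.drift_lap R_loc (t, y) + w.grad_inner R_loc F_loc (t, y))"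
    unfolding U w.grad_inner_commute[of \<phi>_loc]
      d_mult[OF R_loc u_loc] w.drift_lap_mult[OF R_loc u_loc] w.grad_inner_mult[OF R_loc u_loc]
      w.grad_inner_commute[of R_loc u_loc] grad_inner_u_loc grad_inner_F_loc[OF R_loc_smooth] w.grad_inner_commute[of f_loc R_loc]
    by (simp add: fun_ring_apply algebra_simps)
  ultimately show ?thesis
    unfolding F_eq[symmetric] u_flow[OF assms] R_loc_flow inner2_Rc_gen[OF assms] u_link[OF assms]
    by (simp add: algebra_simps)
qed

end

section \<open>From the chart to the manifold\<close>

theorem proposition1p5:
  fixes M :: "'m::{t2_space, second_countable_topology} set"
    and A :: "('m, 'n::finite) chart set"
    and I :: "real set"
    and g :: "real \<Rightarrow> ('m, 'n) tensor2"
    and H :: "real \<Rightarrow> ('m, 'n) tensor3"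
    and \<phi> f u :: "real \<Rightarrow> 'm \<Rightarrow> real"
  assumes "smooth_manifold M A"
    and "is_interval I" and "interior I \<noteq> {}"
    and "generalized_Ricci_flow I A g H \<phi>"
    and "smooth_function_family I A f"
    and "\<And>t p. t \<in> I \<Longrightarrow> p \<in> M \<Longrightarrow> u t p = exp (- f t p)"
    and "\<And>t c p. t \<in> I \<Longrightarrow> c \<in> A \<Longrightarrow> p \<in> chart_dom c \<Longrightarrow> conj_heat_op I g H \<phi> u t c p = 0"
  shows "\<forall>t\<in>I. \<forall>c\<in>A. \<forall>p\<in>chart_dom c.
    conj_heat_op I g H \<phi>
      (\<lambda>s q. R_gen (g s) (H s) (\<lambda>x. f s x + \<phi> s x) c q * u s q) t c p
    = - 2 * inner2 (g t) c p (Rc_gen (g t) (H t) (\<lambda>x. f t x + \<phi> t x) c p)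
                             (Rc_gen (g t) (H t) (\<lambda>x. f t x + \<phi> t x) c p) * u t p"
proof (intro ballI)
  fix t c p
  assume t: "t \<in> I" and c: "c \<in> A" and p: "p \<in> chart_dom c"
  \<comment> \<open>The claim is pointwise and both sides are computed in the chart c, so it is
    enough to work over the coordinate image of its domain.\<close>
  define V where "V = coord c ` chart_dom c"
  have chart: "is_chart c" and M: "chart_dom c \<subseteq> M"
    using assms(1) c by (auto simp: smooth_manifold_def)
  have V: "open V" and homeo: "homeomorphism (chart_dom c) V (coord c) (para c)"
    using chart by (auto simp: is_chart_def V_def)
  have coord_para: "coord c (para c y) = y" and para_dom: "para c y \<in> chart_dom c" if "y \<in> V" for y
    using homeo that by (auto simp: homeomorphism_def)
  have para_coord: "para c (coord c p) = p" and coord: "coord c p \<in> V"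
    using homeo p by (auto simp: homeomorphism_def)
  note flow = assms(4)[unfolded generalized_Ricci_flow_def]
  have metric: "metric_family I A g" and \<phi>: "smooth_function_family I A \<phi>"
    using flow by blast+
  have g_flow: "vector_derivative (\<lambda>s. g s c p i j) (at t within I)
      = - 2 * ricci (g t) c p i j + (1/2) * Hsq (g t) (H t) c p i j"
    and \<phi>_flow: "heat_op I g \<phi> t c p = (1/6) * inner3 (g t) c p (H t c p) (H t c p)"
    if "t \<in> I" "p \<in> chart_dom c" for t p i j
    using flow c that by blast+
  from flow obtain H0 b where H0: "three_form A H0" "closed3 A H0" and b: "two_form_family I A b"
    and H_b: "\<forall>t\<in>I. \<forall>c\<in>A. \<forall>p\<in>chart_dom c.
      (\<forall>i j k. H t c p i j k = H0 c p i j k + ext_d2 (b t) c p i j k) \<and>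
      (\<forall>i j. vector_derivative (\<lambda>s. b s c p i j) (at t within I) = - codiff3 (g t) (H t) c p i j)"
    by (elim conjE exE) (rule that; assumption)
  have g_smooth: "smooth_on (I \<times> V) (\<lambda>(t, y). g t c (para c y) i j)" for i j
    using metric c by (simp add: metric_family_def V_def)
  have b_smooth: "smooth_on (I \<times> V) (\<lambda>(t, y). b t c (para c y) i j)" for i j
    using b c by (simp add: two_form_family_def V_def)
  have H0_smooth: "smooth_on V (\<lambda>y. H0 c (para c y) i j k)" for i j k
    using H0(1) c by (simp add: three_form_def V_def)
  have f_smooth: "smooth_on (I \<times> V) (\<lambda>(t, y). f t (para c y))"
    and \<phi>_smooth: "smooth_on (I \<times> V) (\<lambda>(t, y). \<phi> t (para c y))"
    using assms(5) \<phi> c by (simp_all add: smooth_function_family_def V_def)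
  interpret chart_potential I V c H H0 b
  proof
    fix t y i j k l
    assume y: "y \<in> V"
    show "H0 c (para c y) i j k = - H0 c (para c y) j i k" "H0 c (para c y) i j k = - H0 c (para c y) i k j"
      using H0(1) c para_dom[OF y] unfolding three_form_def by blast+
    show "pd c i (\<lambda>q. H0 c q j k l) (para c y) - pd c j (\<lambda>q. H0 c q i k l) (para c y)
        + pd c k (\<lambda>q. H0 c q i j l) (para c y) - pd c l (\<lambda>q. H0 c q i j k) (para c y) = 0"
      using H0(2) c para_dom[OF y] unfolding closed3_def by blast
    assume t: "t \<in> I"
    show "b t c (para c y) i j = - b t c (para c y) j i"
      using b c t para_dom[OF y] unfolding two_form_family_def by blast
    show "H t c (para c y) i j k = H0 c (para c y) i j k + ext_d2 (b t) c (para c y) i j k"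
      using H_b c t para_dom[OF y] by blast
  qed (fact assms(2) assms(3) V coord_para b_smooth H0_smooth)+
  interpret F: chart_evolution I V c H H0 b g "\<lambda>t q. f t q + \<phi> t q" f \<phi> u
  proof
    have "smooth_on (I \<times> V) (\<lambda>x. (case x of (t, y) \<Rightarrow> f t (para c y)) + (case x of (t, y) \<Rightarrow> \<phi> t (para c y)))"
      by (rule smooth_on_add[OF f_smooth \<phi>_smooth])
    then show "smooth_on (I \<times> V) (\<lambda>(t, y). f t (para c y) + \<phi> t (para c y))"
      by (simp add: case_prod_beta')
    fix t y i j
    assume t: "t \<in> I" and y: "y \<in> V"
    show "g t c (para c y) i j = g t c (para c y) j i"
      using metric c t para_dom[OF y] unfolding metric_family_def by blast
    show "(\<Sum>i\<in>UNIV. \<Sum>j\<in>UNIV. g t c (para c y) i j * v $ i * v $ j) > 0" if "v \<noteq> 0" for v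
      using metric c t para_dom[OF y] that unfolding metric_family_def by blast
    show "u t (para c y) = exp (- f t (para c y))"
      using assms(6) t para_dom[OF y] M by auto
    show "vector_derivative (\<lambda>s. b s c (para c y) i j) (at t within I) = - codiff3 (g t) (H t) c (para c y) i j"
      using H_b c t para_dom[OF y] by blast
    show "vector_derivative (\<lambda>s. g s c (para c y) i j) (at t within I)
        = - 2 * ricci (g t) c (para c y) i j + (1/2) * Hsq (g t) (H t) c (para c y) i j"
      by (rule g_flow[OF t para_dom[OF y]])
    show "heat_op I g \<phi> t c (para c y) = (1/6) * inner3 (g t) c (para c y) (H t c (para c y)) (H t c (para c y))"
      by (rule \<phi>_flow[OF t para_dom[OF y]])
    show "conj_heat_op I g H \<phi> u t c (para c y) = 0"
      by (rule assms(7)[OF t c para_dom[OF y]])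
  qed (fact g_smooth f_smooth \<phi>_smooth refl)+
  show "conj_heat_op I g H \<phi>
      (\<lambda>s q. R_gen (g s) (H s) (\<lambda>x. f s x + \<phi> s x) c q * u s q) t c p
    = - 2 * inner2 (g t) c p (Rc_gen (g t) (H t) (\<lambda>x. f t x + \<phi> t x) c p)
                             (Rc_gen (g t) (H t) (\<lambda>x. f t x + \<phi> t x) c p) * u t p"
    using F.conj_heat_op_R_gen[OF t coord] unfolding para_coord .
qed

end
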